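(* Let $m\ge 2$ be an integer, let $T_n$ be a random recursive tree with $n$ vertices, and let $\mathbf X^{(m)}=\mathbf X^{(m)}(T_n)=(X^{(m)}_0,\dots,X^{(m)}_{m-1})$, where $X^{(m)}_j$ is the number of vertices of $T_n$ whose depth is congruent to $j$ modulo $m$. Then the following holds as $n\to\infty$. (i) If $2\le m\le 5$, then $$n^{-1/2}\Bigl(\mathbf X^{(m)}-\frac nm\mathbf 1\Bigr)\overset{\mathrm d}{\longrightarrow} N(0,\Sigma_m),$$ where $$\Sigma_2=\frac1{12}\begin{pmatrix}1&-1\\-1&1\end{pmatrix},\qquad \Sigma_3=\frac1{18}\begin{pmatrix}2&-1&-1\\-1&2&-1\\-1&-1&2\end{pmatrix},$$ $$\Sigma_4=\frac1{48}\begin{pmatrix}7&-1&-5&-1\\-1&7&-1&-5\\-5&-1&7&-1\\-1&-5&-1&7\end{pmatrix},\qquad \Sigma_5=\frac1{25}\begin{pmatrix}6&1&-4&-4&1\\1&6&1&-4&-4\\-4&1&6&1&-4\\-4&-4&1&6&1\\1&-4&-4&1&6\end{pmatrix}.$$ (ii) If $m=6$, then $$(n\ln n)^{-1/2}\Bigl(\mathbf X^{(6)}-\frac n6\mathbf 1\Bigr)\overset{\mathrm d}{\longrightarrow} N(0,\Sigma_6),\qquad \Sigma_6=\frac1{36}\begin{pmatrix}2&1&-1&-2&-1&1\\1&2&1&-1&-2&-1\\-1&1&2&1&-1&-2\\-2&-1&1&2&1&-1\\-1&-2&-1&1&2&1\\1&-1&-2&-1&1&2\end{pmatrix}.$$ (iii)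 If $m\ge 7$, let $\alpha=\cos(2\pi/m)>1/2$ and $\beta=\sin(2\pi/m)$. Then $$n^{-\alpha}\Bigl(\mathbf X^{(m)}-\frac nm\mathbf 1\Bigr)-\operatorname{Re}\bigl(n^{\mathrm i\beta}\widetilde W_m\bigr)\overset{\mathrm{a.s.}}{\longrightarrow}0$$ for some complex random vector $\widetilde W_m=\bigl(\widetilde Z_m e^{-2\pi j\mathrm i/m}\bigr)_{j=0}^{m-1}$, where $\widetilde Z_m$ is a complex random variable. In particular, along any subsequence of $n$ such that $\beta\ln n \bmod 2\pi\to\gamma$ for some $\gamma\in[0,2\pi]$, $$n^{-\alpha}\Bigl(X^{(m)}_j-\frac nm\Bigr)\overset{\mathrm d}{\longrightarrow}\operatorname{Re}\bigl(e^{\mathrm i(\gamma-2\pi j/m)}\widetilde Z_m\bigr),$$ jointly in $j=0,\dots,m-1$.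
   Context: A random recursive tree with $n$ vertices is the random rooted tree obtained by starting with a single root and then adding $n-1$ vertices one by one, each time joining the new vertex to an old vertex chosen uniformly at random, the choices being independent of each other. The trees $T_1,T_2,\dots$ are the successive states of this growth process, so they are all defined on one probability space (this is the meaning of the almost sure convergence). The depth of a vertex is its distance from the root. $\mathbf 1=(1,\dots,1)$ is the $m$-dimensional all-ones vector, $\mathrm i$ is the imaginary unit, $\operatorname{Re}$ of a vector is taken componentwise, $N(0,\Sigma)$ is the (possibly degenerate) multivariate normal distribution with mean $0$ and covariance matrix $\Sigma$, and $\overset{\mathrm d}{\longrightarrow}$, $\overset{\mathrm{a.s.}}{\longrightarrow}$ denote convergence in distribution and almost surely. *)

theory Defs
  imports "HOL-Probability.Probability" "HOL-Library.Real_Mod"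
begin

section \<open>Random recursive trees\<close>

text \<open>
  Vertices are numbered in order of arrival, so that \<open>T_n\<close> has the vertex set \<open>{..<n}\<close> and the
  root \<open>0\<close>; \<open>p k\<close> is the old vertex which the new vertex \<open>k \<ge> 1\<close> is joined to.
  Edges are undirected, i.e. both orientations are present.
\<close>

definition tree_edges :: "(nat \<Rightarrow> nat) \<Rightarrow> nat \<Rightarrow> (nat \<times> nat) set" where
  "tree_edges p n = (\<Union>k\<in>{1..<n}. {(p k, k), (k, p k)})"

definition depth :: "(nat \<Rightarrow> nat) \<Rightarrow> nat \<Rightarrow> nat \<Rightarrow> nat" where
  "depth p n v = (LEAST d. (0, v) \<in> tree_edges p n ^^ d)"

definition residue_count :: "nat \<Rightarrow> (nat \<Rightarrow> nat) \<Rightarrow> nat \<Rightarrow> nat \<Rightarrow> nat" where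
  "residue_count m p n j = card {v \<in> {..<n}. depth p n v mod m = j}"

locale random_recursive_tree = prob_space M for M :: "'a measure" +
  fixes parent :: "nat \<Rightarrow> 'a \<Rightarrow> nat"
  assumes parent_indep: "indep_vars (\<lambda>_. count_space UNIV) parent {1..}"
    and parent_uniform:
      "\<And>k. k \<ge> 1 \<Longrightarrow> distr M (count_space UNIV) (parent k) = measure_pmf (pmf_of_set {..<k})"

section \<open>Random vectors and convergence in distribution\<close>

text \<open>
  \<open>\<real>\<^sup>m\<close> is represented by the functions on \<open>{..<m}\<close> that are extensional (\<open>undefined\<close> elsewhere),
  with the product topology and the product sigma algebra.
\<close>

abbreviation vec_borel :: "nat \<Rightarrow> (nat \<Rightarrow> real) measure" where
  "vec_borel m \<equiv> Pi\<^sub>M {..<m} (\<lambda>_. borel)"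

abbreviation vec_topology :: "nat \<Rightarrow> (nat \<Rightarrow> real) topology" where
  "vec_topology m \<equiv> product_topology (\<lambda>_. euclideanreal) {..<m}"

definition vec_law :: "nat \<Rightarrow> 'a measure \<Rightarrow> ('a \<Rightarrow> nat \<Rightarrow> real) \<Rightarrow> (nat \<Rightarrow> real) measure" where
  "vec_law m M V = distr M (vec_borel m) (\<lambda>\<omega>. \<lambda>j\<in>{..<m}. V \<omega> j)"

definition weak_conv_vec :: "nat \<Rightarrow> (nat \<Rightarrow> (nat \<Rightarrow> real) measure) \<Rightarrow> (nat \<Rightarrow> real) measure \<Rightarrow> bool" where
  "weak_conv_vec m \<mu> \<nu> \<longleftrightarrow>
     (\<forall>f. continuous_map (vec_topology m) euclideanreal f \<and> bounded (f ` topspace (vec_topology m)) \<longrightarrow>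
          (\<lambda>n. integral\<^sup>L (\<mu> n) f) \<longlonglongrightarrow> integral\<^sup>L \<nu> f)"

section \<open>Possibly degenerate multivariate normal distributions\<close>

definition normal_law :: "real \<Rightarrow> real \<Rightarrow> real measure" where
  "normal_law a \<sigma> = (if \<sigma> = 0 then return borel a else density lborel (normal_density a \<sigma>))"

definition mv_normal :: "nat \<Rightarrow> (nat \<Rightarrow> real) \<Rightarrow> (nat \<Rightarrow> nat \<Rightarrow> real) \<Rightarrow> (nat \<Rightarrow> real) measure \<Rightarrow> bool" where
  "mv_normal m a S \<nu> \<longleftrightarrow>
     prob_space \<nu> \<and> sets \<nu> = sets (vec_borel m) \<and>
     (\<forall>t. \<exists>b. \<exists>\<sigma>\<ge>0. distr \<nu> borel (\<lambda>x. \<Sum>i<m. t i * x i) = normal_law b \<sigma>) \<and>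
     (\<forall>i<m. (\<integral>x. x i \<partial>\<nu>) = a i) \<and>
     (\<forall>i<m. \<forall>j<m. (\<integral>x. (x i - a i) * (x j - a j) \<partial>\<nu>) = S i j)"

definition weak_conv_normal ::
    "nat \<Rightarrow> (nat \<Rightarrow> (nat \<Rightarrow> real) measure) \<Rightarrow> (nat \<Rightarrow> real) \<Rightarrow> (nat \<Rightarrow> nat \<Rightarrow> real) \<Rightarrow> bool" where
  "weak_conv_normal m \<mu> a S \<longleftrightarrow> (\<exists>\<nu>. mv_normal m a S \<nu> \<and> weak_conv_vec m \<mu> \<nu>)"

definition scaled_matrix :: "real \<Rightarrow> real list list \<Rightarrow> nat \<Rightarrow> nat \<Rightarrow> real" where
  "scaled_matrix c A i j = c * (A ! i ! j)"

definition Sigma2 :: "nat \<Rightarrow> nat \<Rightarrow> real" where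
  "Sigma2 = scaled_matrix (1/12)
     [[ 1, -1],
      [-1,  1]]"

definition Sigma3 :: "nat \<Rightarrow> nat \<Rightarrow> real" where
  "Sigma3 = scaled_matrix (1/18)
     [[ 2, -1, -1],
      [-1,  2, -1],
      [-1, -1,  2]]"

definition Sigma4 :: "nat \<Rightarrow> nat \<Rightarrow> real" where
  "Sigma4 = scaled_matrix (1/48)
     [[ 7, -1, -5, -1],
      [-1,  7, -1, -5],
      [-5, -1,  7, -1],
      [-1, -5, -1,  7]]"

definition Sigma5 :: "nat \<Rightarrow> nat \<Rightarrow> real" where
  "Sigma5 = scaled_matrix (1/25)
     [[ 6,  1, -4, -4,  1],
      [ 1,  6,  1, -4, -4],
      [-4,  1,  6,  1, -4],
      [-4, -4,  1,  6,  1],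
      [ 1, -4, -4,  1,  6]]"

definition Sigma6 :: "nat \<Rightarrow> nat \<Rightarrow> real" where
  "Sigma6 = scaled_matrix (1/36)
     [[ 2,  1, -1, -2, -1,  1],
      [ 1,  2,  1, -1, -2, -1],
      [-1,  1,  2,  1, -1, -2],
      [-2, -1,  1,  2,  1, -1],
      [-1, -2, -1,  1,  2,  1],
      [ 1, -1, -2, -1,  1,  2]]"

end

theory Submission
  imports Defs "HOL-Real_Asymp.Real_Asymp"
begin

text \<open>
  Let \<open>\<omega> = exp (2 \<pi> \<i> / m)\<close> and \<open>Z\<^sub>k(n) = (\<Sum>v<n. \<omega>^(k * depth v))\<close>. By Fourier inversion on the residues modulo \<open>m\<close> the
  centred counts are linear combinations of \<open>Z\<^sub>1, \<dots>, Z\<^bsub>m-1\<^esub>\<close>, and since the new vertex is joined to a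
  uniform old one, \<open>E (Z\<^sub>k(n+1) | T\<^sub>n) = (1 + \<omega>^k / n) Z\<^sub>k(n)\<close>. So \<open>Z\<^sub>k\<close> is a martingale times a product which grows
  like \<open>n^(\<omega>^k)\<close>, and everything depends on whether \<open>Re \<omega>^k = cos (2 \<pi> k / m)\<close> exceeds \<open>1/2\<close>.

  If \<open>m \<le> 6\<close>, each linear functional of the counts at time \<open>n\<close> is the end point of a martingale with
  small increments. The proportions of the residue classes are close to \<open>1 / m\<close> in mean square, so the conditional
  variances are close in \<open>L\<^sup>1\<close> to deterministic numbers, and the characteristic function can be followed one step
  at a time; no general martingale central limit theorem is needed. If \<open>m \<ge> 7\<close>, the martingale
  belonging to \<open>k = 1\<close> is bounded in \<open>L\<^sup>2\<close> and converges almost surely by the maximal inequality, and the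
  \<open>Z\<^sub>k\<close> with \<open>2 \<le> k \<le> m - 2\<close> are of smaller order.
\<close>

section \<open>Levels of the vertices and their Fourier transform\<close>

text \<open>The threshold 1/2 reflects the influence of early choices. Seen from time n, the choice
  made at time l enters frequency k with modulus of order (n / l)^c, where c = cos (2 pi k / m).
  Over all l the squares add up to order n for c < 1/2 and n ln n for c = 1/2, but to n^(2c) for c >
  1/2, where the first choices dominate. The martingale for \<open>m \<le> 6\<close> is built
  backwards: weights on the levels prescribed at time n are pulled back by w_l(j) = w_(l+1)(j) +
  w_(l+1)(j+1) / l, which makes the weighted sum at time l the conditional mean of the one at time l
  + 1. In Fourier coordinates this recursion is diagonal with factors 1 + \<omega>^k / l, so step
  bounds and variances become explicit. Replacing the random conditional variance of a step by a
  constant costs the squared step bound times the mean deviation of the proportions. With step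
  bounds O(l^(-2/5)) times a null sequence in n, and deviations O(l^(-1/4)) obtained from second
  moments O(l^(3/2)), these errors have order l^(-21/20) and are summable; the exponents serve c <
  1/2 and c = 1/2 alike.\<close>

function level :: "(nat \<Rightarrow> nat) \<Rightarrow> nat \<Rightarrow> nat" where
  "level p v = (if v = 0 \<or> v \<le> p v then 0 else Suc (level p (p v)))"
  by auto
termination by (relation "Wellfounded.measure snd") auto

declare level.simps [simp del]

lemma level_0 [simp]: "level p 0 = 0"
  by (simp add: level.simps)

lemma level_Suc: "k \<ge> 1 \<Longrightarrow> p k < k \<Longrightarrow> level p k = Suc (level p (p k))"
  by (subst level.simps) auto

lemma level_cong: "(\<And>i. 1 \<le> i \<Longrightarrow> i \<le> v \<Longrightarrow> p i = q i) \<Longrightarrow> level p v = level q v"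
proof (induction v rule: less_induct)
  case (less v)
  show ?case
  proof (cases "v = 0 \<or> v \<le> p v")
    case True
    then show ?thesis using less.prems[of v] by (auto simp: level.simps[of _ v])
  next
    case False
    then have "p v < v" "p v = q v" using less.prems[of v] by auto
    moreover have "level p (p v) = level q (p v)"
      by (intro less.IH \<open>p v < v\<close> less.prems) (use \<open>p v < v\<close> in auto)
    ultimately show ?thesis
      by (metis False level.simps)
  qed
qed

text \<open>Following the parents gives a path of length \<open>level p v\<close>, and crossing an
  edge raises the level by at most one, so no path from the root is shorter. From here on the
  recursive \<open>level\<close> replaces the graph distance; its value 0 when
  \<open>v \<le> p v\<close> makes it total, so later pointwise estimates can range over every
  \<open>p\<close>.\<close>

lemma depth_eq_level:
  assumes p: "\<And>k. 1 \<le> k \<Longrightarrow> k < n \<Longrightarrow> p k < k" and v: "v < n"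
  shows "depth p n v = level p v"
  unfolding depth_def
proof (rule Least_equality)
  show "(0, v) \<in> tree_edges p n ^^ level p v"
    using v
  proof (induction v rule: less_induct)
    case (less v)
    show ?case
    proof (cases "v = 0")
      case False
      then have pv: "p v < v" using p less.prems by auto
      have "(p v, v) \<in> tree_edges p n"
        unfolding tree_edges_def using False less.prems by force
      moreover have "(0, p v) \<in> tree_edges p n ^^ level p (p v)"
        using less pv by auto
      ultimately show ?thesis
        using level_Suc[of v p] False pv by auto
    qed simp
  qed
next
  fix d assume "(0, v) \<in> tree_edges p n ^^ d"
  then show "level p v \<le> d"
  proof (induction d arbitrary: v)
    case (Suc d)
    then obtain u where u: "(0, u) \<in> tree_edges p n ^^ d" "(u, v) \<in> tree_edges p n"
      by auto
    then obtain k where "1 \<le> k" "k < n" "(u = p k \<and> v = k) \<or> (u = k \<and> v = p k)"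
      unfolding tree_edges_def by auto
    then have "level p v \<le> Suc (level p u)"
      using level_Suc[of k p] p[of k] by auto
    then show ?case using Suc.IH[OF u(1)] by simp
  qed simp
qed

definition level_count :: "nat \<Rightarrow> (nat \<Rightarrow> nat) \<Rightarrow> nat \<Rightarrow> nat \<Rightarrow> real" where
  "level_count m p n j = (\<Sum>v<n. of_bool (level p v mod m = j))"

lemma residue_count_eq:
  assumes "\<And>k. 1 \<le> k \<Longrightarrow> p k < k"
  shows "real (residue_count m p n j) = level_count m p n j"
proof -
  have "{v \<in> {..<n}. depth p n v mod m = j} = {v\<in>{..<n}. level p v mod m = j}"
    using depth_eq_level[of n p] assms by auto
  then show ?thesis
    by (simp add: residue_count_def level_count_def sum.If_cases Int_def)
qed

definition unit_root :: "nat \<Rightarrow> nat \<Rightarrow> complex" where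
  "unit_root m k = cis (2 * pi * real k / real m)"

lemma norm_unit_root [simp]: "cmod (unit_root m k) = 1"
  by (simp add: unit_root_def)

lemma unit_root_power_mod: "m > 0 \<Longrightarrow> unit_root m k ^ (j mod m) = unit_root m k ^ j"
proof -
  assume m: "m > 0"
  have "unit_root m k ^ m = cis (2 * pi * real k)"
    using m by (simp add: unit_root_def Complex.DeMoivre)
  then have 1: "unit_root m k ^ m = 1"
    using cis_multiple_2pi[of "real k"] by (simp add: mult.commute)
  have "unit_root m k ^ j = unit_root m k ^ (m * (j div m) + j mod m)"
    by (simp only: mult_div_mod_eq)
  also have "\<dots> = unit_root m k ^ (j mod m)" by (simp only: power_add power_mult 1 power_one mult_1)
  finally show ?thesis by simp
qed

lemma unit_root_power_swap: "unit_root m k ^ j = unit_root m j ^ k"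
  by (simp add: unit_root_def Complex.DeMoivre mult_ac)

lemma sum_unit_root:
  assumes m: "m > 0" and i: "i < m" and j: "j < m"
  shows "(\<Sum>k<m. unit_root m k ^ i * cnj (unit_root m k) ^ j) = (if i = j then of_nat m else 0)"
proof (cases "i = j")
  case True
  have "unit_root m k ^ i * cnj (unit_root m k) ^ i = 1" for k
    by (metis complex_norm_square norm_unit_root of_real_1 power_mult_distrib power_one)
  then show ?thesis using True by simp
next
  case False
  define z where "z = cis (2 * pi * (real i - real j) / real m)"
  have z: "unit_root m k ^ i * cnj (unit_root m k) ^ j = z ^ k" for k
    by (simp add: unit_root_def z_def Complex.DeMoivre cis_mult cis_cnj) (simp add: field_simps diff_divide_distrib)
  have zm: "z ^ m = 1"
    using m cis_multiple_2pi[of "real i - real j"] by (simp add: z_def Complex.DeMoivre)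
  \<comment> \<open>Otherwise \<open>m\<close> would divide \<open>i - j\<close>, which two
    different residues below \<open>m\<close> exclude; then the geometric sum of the
    \<open>m\<close>-th root of unity \<open>z\<close> is 0.\<close>
  have "z \<noteq> 1"
  proof
    assume "z = 1"
    then have "cos (2 * pi * (real i - real j) / real m) = 1"
      by (simp add: z_def complex_eq_iff)
    then obtain x :: int where "2 * pi * (real i - real j) / real m = of_int x * 2 * pi"
      by (auto simp: cos_one_2pi_int)
    then have "real i - real j = of_int x * real m"
    proof -
      assume "2 * pi * (real i - real j) / real m = of_int x * 2 * pi"
      then have "(2 * pi) * (real i - real j) = (2 * pi) * (of_int x * real m)"
        using m by (simp add: divide_eq_eq mult_ac)
      then show ?thesis by simp
    qed
    then have "int i - int j = x * int m"
      by (metis of_int_diff of_int_eq_iff of_int_mult of_int_of_nat_eq)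
    then have "int m dvd int i - int j" by simp
    then have "int i mod int m = int j mod int m" by (simp add: mod_eq_dvd_iff)
    then show False using i j False by simp
  qed
  then show ?thesis using False zm by (simp add: z sum_gp_strict)
qed

lemma unit_root_0 [simp]: "unit_root m 0 = 1"
  by (simp add: unit_root_def)

text \<open>The case \<open>z = unit_root m k\<close> is \<open>Z\<^sub>k\<close> of the overview.
  With \<open>z\<close> left free it is visible that the moment estimates depend only on
  \<open>cmod z = 1\<close> and \<open>Re z\<close>.\<close>

definition level_sum :: "complex \<Rightarrow> (nat \<Rightarrow> nat) \<Rightarrow> nat \<Rightarrow> complex" where
  "level_sum z p n = (\<Sum>v<n. z ^ level p v)"

text \<open>Frequency 0 contributes exactly \<open>n\<close>, the number of vertices, and this is
  what the centring by \<open>n / m\<close> removes; hence the sum starts at frequency 1.\<close>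

lemma level_count_fourier:
  assumes m: "m > 0" and j: "j < m"
  shows "complex_of_real (level_count m p n j - real n / real m) =
         (\<Sum>k\<in>{1..<m}. cnj (unit_root m k) ^ j * level_sum (unit_root m k) p n) / of_nat m"
proof -
  have "(\<Sum>k<m. cnj (unit_root m k) ^ j * level_sum (unit_root m k) p n)
      = (\<Sum>v<n. \<Sum>k<m. unit_root m k ^ (level p v mod m) * cnj (unit_root m k) ^ j)"
    unfolding level_sum_def sum_distrib_left using m
    by (subst sum.swap) (simp add: unit_root_power_mod mult_ac)
  also have "\<dots> = (\<Sum>v<n. if level p v mod m = j then of_nat m else 0)"
    using m j by (intro sum.cong refl, subst sum_unit_root) auto
  also have "\<dots> = of_nat m * complex_of_real (level_count m p n j)"
    by (simp add: level_count_def sum.If_cases Int_def)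
  finally have *: "(\<Sum>k<m. cnj (unit_root m k) ^ j * level_sum (unit_root m k) p n)
     = of_nat m * complex_of_real (level_count m p n j)" .
  have "{..<m} = insert 0 {1..<m}" using m by auto
  then have "(\<Sum>k<m. cnj (unit_root m k) ^ j * level_sum (unit_root m k) p n)
     = of_nat n + (\<Sum>k\<in>{1..<m}. cnj (unit_root m k) ^ j * level_sum (unit_root m k) p n)"
    by (simp add: level_sum_def)
  with * show ?thesis using m by (simp add: field_simps)
qed

section \<open>Martingales along the growth process\<close>

text \<open>Adaptedness to the growth process, encoded as dependence on the parents of the vertices
  \<open>1, ..., n - 1\<close> only, that is, on the tree with \<open>n\<close> vertices. With this
  encoding a conditional mean given the history is a finite average over the updates
  \<open>p(l := v)\<close>.\<close>

definition past :: "nat \<Rightarrow> ((nat \<Rightarrow> nat) \<Rightarrow> 'b) \<Rightarrow> bool" where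
  "past n f \<longleftrightarrow> (\<forall>p q. (\<forall>i\<in>{1..<n}. p i = q i) \<longrightarrow> f p = f q)"

lemma pastI:
  assumes f: "\<And>p q. (\<And>i. 1 \<le> i \<Longrightarrow> i < n \<Longrightarrow> p i = q i) \<Longrightarrow> f p = f q"
  shows "past n f"
  unfolding past_def
proof (intro allI impI)
  fix p q :: "nat \<Rightarrow> nat" assume "\<forall>i\<in>{1..<n}. p i = q i"
  then have "p i = q i" if "1 \<le> i" "i < n" for i using that by simp
  then show "f p = f q" by (rule f[of p q])
qed

lemma pastD:
  assumes f: "past n f" and pq: "\<And>i. 1 \<le> i \<Longrightarrow> i < n \<Longrightarrow> p i = q i"
  shows "f p = f q"
proof -
  have "\<forall>i\<in>{1..<n}. p i = q i" using pq by simp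
  with f show ?thesis unfolding past_def by blast
qed

lemma past_upd: "past n f \<Longrightarrow> n \<le> k \<Longrightarrow> f (p(k := v)) = f p"
  by (erule pastD) auto

lemma past_mono: "past n f \<Longrightarrow> n \<le> n' \<Longrightarrow> past n' f"
  by (rule pastI, erule pastD) auto

lemma past_comp:
  assumes f: "past n f"
  shows "past n (\<lambda>p. h (f p))"
proof (rule pastI)
  fix p q :: "nat \<Rightarrow> nat" assume pq: "\<And>i. 1 \<le> i \<Longrightarrow> i < n \<Longrightarrow> p i = q i"
  show "h (f p) = h (f q)" by (simp only: pastD[OF f, where p = p and q = q, OF pq])
qed

lemma past_comp2:
  assumes f: "past n f" and g: "past n g"
  shows "past n (\<lambda>p. h (f p) (g p))"
proof (rule pastI)
  fix p q :: "nat \<Rightarrow> nat" assume pq: "\<And>i. 1 \<le> i \<Longrightarrow> i < n \<Longrightarrow> p i = q i"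
  show "h (f p) (g p) = h (f q) (g q)"
    by (simp only: pastD[OF f, where p = p and q = q, OF pq] pastD[OF g, where p = p and q = q, OF pq])
qed

lemma past_sum:
  assumes f: "\<And>i. i \<in> I \<Longrightarrow> past n (f i)"
  shows "past n (\<lambda>p. \<Sum>i\<in>I. f i p)"
proof (rule pastI)
  fix p q :: "nat \<Rightarrow> nat" assume pq: "\<And>i. 1 \<le> i \<Longrightarrow> i < n \<Longrightarrow> p i = q i"
  show "(\<Sum>i\<in>I. f i p) = (\<Sum>i\<in>I. f i q)"
    by (rule sum.cong[OF refl]) (rule pastD[where p = p and q = q, OF f pq])
qed

lemma past_Ball:
  assumes f: "\<And>i. i \<in> I \<Longrightarrow> past n (f i)"
  shows "past n (\<lambda>p. \<forall>i\<in>I. f i p)"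
proof (rule pastI)
  fix p q :: "nat \<Rightarrow> nat" assume pq: "\<And>i. 1 \<le> i \<Longrightarrow> i < n \<Longrightarrow> p i = q i"
  show "(\<forall>i\<in>I. f i p) = (\<forall>i\<in>I. f i q)"
    by (rule ball_cong[OF refl]) (rule pastD[where p = p and q = q, OF f pq])
qed

lemma past_level: "v < n \<Longrightarrow> past n (\<lambda>p. level p v)"
  by (intro pastI level_cong) simp

lemma past_level_sum: "past n (\<lambda>p. level_sum z p n)"
  unfolding level_sum_def by (intro past_sum past_comp[where h = "\<lambda>x. z ^ x", OF past_level]) simp

lemma past_level_count: "past n (\<lambda>p. level_count m p n j)"
  unfolding level_count_def
  by (intro past_sum past_comp[where h = "\<lambda>x. of_bool (x mod m = j)", OF past_level]) simp

section \<open>Averaging over the parent of the newest vertex\<close>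

context random_recursive_tree
begin

lemma parent_measurable: "k \<ge> 1 \<Longrightarrow> parent k \<in> measurable M (count_space UNIV)"
  by (rule bspec[OF conjunct1[OF parent_indep[unfolded indep_vars_def2]]]) simp

lemma AE_parent_less: "AE \<omega> in M. \<forall>k\<ge>1. parent k \<omega> < k"
proof -
  have "AE \<omega> in M. parent k \<omega> < k" if k: "k \<ge> 1" for k
  proof -
    have "AE v in measure_pmf (pmf_of_set {..<k}). v < k"
      using k by (auto simp: AE_measure_pmf_iff set_pmf_of_set lessThan_empty_iff)
    then show ?thesis
      unfolding parent_uniform[OF k, symmetric] by (rule AE_distrD[OF parent_measurable[OF k]])
  qed
  then have "AE \<omega> in M. \<forall>k\<in>{1..}. parent k \<omega> < k"
    by (subst AE_ball_countable) auto
  then show ?thesis by eventually_elim auto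
qed

lemma restrict_parent_measurable:
  "I \<subseteq> {1..} \<Longrightarrow> (\<lambda>\<omega>. \<lambda>k\<in>I. parent k \<omega>) \<in> measurable M (PiM I (\<lambda>_. count_space UNIV))"
  by (intro measurable_restrict parent_measurable) auto

text \<open>A finite product of countable discrete spaces is discrete, so measurability costs
  nothing on it.\<close>

lemma past_measurable_restrict:
  fixes f :: "(nat \<Rightarrow> nat) \<Rightarrow> 'b::topological_space"
  shows "f \<in> borel_measurable (PiM {1..<n} (\<lambda>_. count_space UNIV))"
  using count_space_PiM_finite[of "{1..<n}" "\<lambda>_. UNIV :: nat set"] by (simp add: space_PiM)

lemma past_restrict: "past n f \<Longrightarrow> f (\<lambda>k. parent k \<omega>) = f (\<lambda>k\<in>{1..<n}. parent k \<omega>)"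
  by (erule pastD) auto

lemma past_measurable:
  fixes f :: "(nat \<Rightarrow> nat) \<Rightarrow> 'b::topological_space"
  assumes "past n f"
  shows "(\<lambda>\<omega>. f (\<lambda>k. parent k \<omega>)) \<in> borel_measurable M"
  unfolding past_restrict[OF assms]
  by (rule measurable_compose[OF restrict_parent_measurable past_measurable_restrict]) auto

text \<open>Apart from a null set only finitely many parent sequences occur up to time
  \<open>n\<close>, so \<open>f\<close> is almost surely bounded.\<close>

lemma past_integrable:
  fixes f :: "(nat \<Rightarrow> nat) \<Rightarrow> 'b::{banach, second_countable_topology}"
  assumes f: "past n f"
  shows "integrable M (\<lambda>\<omega>. f (\<lambda>k. parent k \<omega>))"
proof -
  define K where "K = PiE {1..<n} (\<lambda>k. {..<k})"
  have "finite ((\<lambda>p. norm (f p)) ` K)" unfolding K_def by (intro finite_imageI finite_PiE) auto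
  then obtain B where B: "\<And>p. p \<in> K \<Longrightarrow> norm (f p) \<le> B"
    by (meson Max_ge imageI)
  have "AE \<omega> in M. norm (f (\<lambda>k. parent k \<omega>)) \<le> B"
    using AE_parent_less
  proof eventually_elim
    case (elim \<omega>)
    then have "(\<lambda>k\<in>{1..<n}. parent k \<omega>) \<in> K" by (auto simp: K_def)
    then show ?case unfolding past_restrict[OF f] by (rule B)
  qed
  then show ?thesis
    by (rule integrable_const_bound[OF _ past_measurable[OF f]])
qed

text \<open>One-step tower property. Almost surely exactly one of the events
  \<open>parent l = v\<close> with \<open>v < l\<close> occurs; each has probability
  \<open>1 / l\<close> and is independent of \<open>f\<close> at the updated sequence, which
  involves only earlier parents.\<close>

lemma expectation_step:
  fixes f :: "(nat \<Rightarrow> nat) \<Rightarrow> complex"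
  assumes l: "l \<ge> 1" and f: "past (Suc l) f"
  shows "(\<integral>\<omega>. f (\<lambda>k. parent k \<omega>) \<partial>M) = (\<integral>\<omega>. (\<Sum>v<l. f ((\<lambda>k. parent k \<omega>)(l := v))) / of_nat l \<partial>M)"
proof -
  let ?P = "\<lambda>\<omega> k. parent k \<omega>"
  have past_v: "past l (\<lambda>p. f (p(l := v)))" for v
    by (rule pastI, rule pastD[OF f]) auto
  define I where "I v \<omega> = (of_bool (parent l \<omega> = v) :: complex)" for v \<omega>
  have Iint: "integrable M (I v)" for v
    unfolding I_def using parent_measurable[OF l]
    by (intro integrable_const_bound[where B = 1]) auto
  have EI: "(\<integral>\<omega>. I v \<omega> \<partial>M) = 1 / of_nat l" if "v < l" for v
  proof -
    have "(\<integral>\<omega>. I v \<omega> \<partial>M) = (\<integral>x. of_bool (x = v) \<partial>distr M (count_space UNIV) (parent l))"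
      unfolding I_def by (subst integral_distr[OF parent_measurable[OF l]]) auto
    also have "\<dots> = (\<integral>x. indicator {v} x *\<^sub>R (1::complex) \<partial>measure_pmf (pmf_of_set {..<l}))"
      unfolding parent_uniform[OF l] by (intro Bochner_Integration.integral_cong refl) (auto simp: indicator_def)
    also have "\<dots> = of_real (pmf (pmf_of_set {..<l}) v)"
      by (subst integral_scaleR_left) (auto simp: measure_pmf_single scaleR_conv_of_real intro!: measure_pmf.integrable_const_bound[where B = 1])
    also have "\<dots> = 1 / of_nat l"
      using that by (subst pmf_of_set) (auto simp: lessThan_empty_iff)
    finally show ?thesis .
  qed
  have ind: "indep_var borel (I v) borel (\<lambda>\<omega>. f ((?P \<omega>)(l := v)))" for v
  proof -
    have "indep_var (PiM {l} (\<lambda>_. count_space UNIV)) (\<lambda>\<omega>. \<lambda>k\<in>{l}. parent k \<omega>)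
        (PiM {1..<l} (\<lambda>_. count_space UNIV)) (\<lambda>\<omega>. \<lambda>k\<in>{1..<l}. parent k \<omega>)"
      by (rule indep_var_restrict[OF parent_indep]) (use l in auto)
    then have "indep_var borel ((\<lambda>x. of_bool (x l = v)) \<circ> (\<lambda>\<omega>. \<lambda>k\<in>{l}. parent k \<omega>))
        borel ((\<lambda>p. f (p(l := v))) \<circ> (\<lambda>\<omega>. \<lambda>k\<in>{1..<l}. parent k \<omega>))"
      by (rule indep_var_compose) (auto simp: past_measurable_restrict count_space_PiM_finite[of _ "\<lambda>_. UNIV :: nat set"])
    also have "((\<lambda>x. of_bool (x l = v)) \<circ> (\<lambda>\<omega>. \<lambda>k\<in>{l}. parent k \<omega>)) = I v"
      by (auto simp: I_def fun_eq_iff)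
    also have "((\<lambda>p. f (p(l := v))) \<circ> (\<lambda>\<omega>. \<lambda>k\<in>{1..<l}. parent k \<omega>)) = (\<lambda>\<omega>. f ((?P \<omega>)(l := v)))"
      by (rule ext) (simp only: comp_apply past_restrict[OF past_v, symmetric])
    finally show ?thesis .
  qed
  have fint: "integrable M (\<lambda>\<omega>. f ((?P \<omega>)(l := v)))" for v
    using past_integrable[OF past_v] .
  have "(\<integral>\<omega>. f (?P \<omega>) \<partial>M) = (\<integral>\<omega>. (\<Sum>v<l. I v \<omega> * f ((?P \<omega>)(l := v))) \<partial>M)"
  proof (rule integral_cong_AE)
    show "(\<lambda>\<omega>. f (?P \<omega>)) \<in> borel_measurable M" by (rule past_measurable[OF f])
    show "(\<lambda>\<omega>. \<Sum>v<l. I v \<omega> * f ((?P \<omega>)(l := v))) \<in> borel_measurable M"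
      using Iint past_measurable[OF past_v] by (intro borel_measurable_sum borel_measurable_times) auto
    show "AE \<omega> in M. f (?P \<omega>) = (\<Sum>v<l. I v \<omega> * f ((?P \<omega>)(l := v)))"
      using AE_parent_less
    proof eventually_elim
      case (elim \<omega>)
      have "(\<Sum>v<l. I v \<omega> * f ((?P \<omega>)(l := v))) = (\<Sum>v<l. if v = parent l \<omega> then f ((?P \<omega>)(l := v)) else 0)"
        by (intro sum.cong) (auto simp: I_def)
      also have "\<dots> = f (?P \<omega>)" using elim l by (subst sum.delta) (auto simp: fun_upd_idem)
      finally show ?case ..
    qed
  qed
  also have "\<dots> = (\<Sum>v<l. (\<integral>\<omega>. I v \<omega> * f ((?P \<omega>)(l := v)) \<partial>M))"
    by (intro Bochner_Integration.integral_sum indep_var_integrable ind Iint fint)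
  also have "\<dots> = (\<Sum>v<l. (\<integral>\<omega>. f ((?P \<omega>)(l := v)) \<partial>M) / of_nat l)"
    by (intro sum.cong refl, subst indep_var_lebesgue_integral[OF ind Iint fint]) (simp add: EI)
  also have "\<dots> = (\<integral>\<omega>. (\<Sum>v<l. f ((?P \<omega>)(l := v))) / of_nat l \<partial>M)"
    using fint by (simp add: Bochner_Integration.integral_sum sum_divide_distrib)
  finally show ?thesis .
qed

end

section \<open>Second moments of the level sums\<close>

lemma level_upd: "1 \<le> l \<Longrightarrow> v < l \<Longrightarrow> level (p(l := v)) l = Suc (level p v)"
  by (simp add: level_Suc) (rule level_cong, auto)

lemma level_upd_less: "v < l \<Longrightarrow> level (p(l := k)) v = level p v"
  by (rule level_cong) auto

lemma level_sum_upd: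
  "1 \<le> l \<Longrightarrow> v < l \<Longrightarrow> level_sum z (p(l := v)) (Suc l) = level_sum z p l + z * z ^ level p v"
  unfolding level_sum_def sum.lessThan_Suc by (simp add: level_upd_less level_upd)

lemma cmod_add_unit:
  assumes "cmod z = 1"
  shows "(cmod (a + z * w))\<^sup>2 = (cmod a)\<^sup>2 + 2 * Re (cnj a * (z * w)) + (cmod w)\<^sup>2"
proof -
  have "(cmod (a + b))\<^sup>2 = (cmod a)\<^sup>2 + 2 * Re (cnj a * b) + (cmod b)\<^sup>2" for b
    by (simp add: cmod_power2) (simp add: power2_eq_square algebra_simps)
  from this[of "z * w"] show ?thesis using assms by (simp add: norm_mult)
qed

context random_recursive_tree
begin

definition level_moment :: "complex \<Rightarrow> nat \<Rightarrow> real" where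
  "level_moment z n = (\<integral>\<omega>. (cmod (level_sum z (\<lambda>k. parent k \<omega>) n))\<^sup>2 \<partial>M)"

lemma level_moment_nonneg: "level_moment z n \<ge> 0"
  by (simp add: level_moment_def)

lemma level_moment_1: "level_moment z (Suc 0) = 1"
  by (simp add: level_moment_def level_sum_def prob_space)

text \<open>Joining the new vertex to \<open>v\<close> adds \<open>z * z ^ level p v\<close>, and
  the average of these over \<open>v\<close> is \<open>z / l\<close> times the level sum itself. The
  cross term is therefore a multiple of the squared modulus and the recursion closes, with only
  \<open>Re z\<close> entering.\<close>

lemma level_moment_Suc:
  assumes z: "cmod z = 1" and l: "l \<ge> 1"
  shows "level_moment z (Suc l) = (1 + 2 * Re z / real l) * level_moment z l + 1"
proof -
  let ?Z = "\<lambda>\<omega> n. level_sum z (\<lambda>k. parent k \<omega>) n"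
  have *: "(\<Sum>v<l. (cmod (level_sum z (p(l := v)) (Suc l)))\<^sup>2) / real l
        = (1 + 2 * Re z / real l) * (cmod (level_sum z p l))\<^sup>2 + 1" for p
  proof -
    have "(\<Sum>v<l. (cmod (level_sum z (p(l := v)) (Suc l)))\<^sup>2)
       = (\<Sum>v<l. (cmod (level_sum z p l))\<^sup>2 + 2 * Re (cnj (level_sum z p l) * (z * z ^ level p v)) + 1)"
      using l z by (intro sum.cong refl, subst level_sum_upd) (auto simp: cmod_add_unit norm_power)
    also have "\<dots> = real l * (cmod (level_sum z p l))\<^sup>2
       + 2 * Re (cnj (level_sum z p l) * (z * level_sum z p l)) + real l"
      by (simp add: sum.distrib level_sum_def sum_distrib_left)
    also have "cnj (level_sum z p l) * (z * level_sum z p l) = z * (of_real ((cmod (level_sum z p l))\<^sup>2))"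
      unfolding complex_norm_square by (simp only: mult_ac)
    finally have A: "(\<Sum>v<l. (cmod (level_sum z (p(l := v)) (Suc l)))\<^sup>2) = real l * (cmod (level_sum z p l))\<^sup>2
       + 2 * Re (z * of_real ((cmod (level_sum z p l))\<^sup>2)) + real l" .
    show ?thesis unfolding A using l by (simp add: field_simps)
  qed
  have pst: "past n (\<lambda>p. (cmod (level_sum z p n))\<^sup>2)" for n
    by (rule past_comp[where h = "\<lambda>x. (cmod x)\<^sup>2", OF past_level_sum])
  have "complex_of_real (level_moment z (Suc l)) = (\<integral>\<omega>. of_real ((cmod (?Z \<omega> (Suc l)))\<^sup>2) \<partial>M)"
    unfolding level_moment_def by (rule integral_complex_of_real[symmetric])
  also have "\<dots> = (\<integral>\<omega>. (\<Sum>v<l. of_real ((cmod (level_sum z ((\<lambda>k. parent k \<omega>)(l := v)) (Suc l)))\<^sup>2)) / of_nat l \<partial>M)"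
    by (rule expectation_step[OF l past_comp[where h = of_real, OF pst]])
  also have "\<dots> = (\<integral>\<omega>. of_real ((1 + 2 * Re z / real l) * (cmod (?Z \<omega> l))\<^sup>2 + 1) \<partial>M)"
    by (simp only: *[symmetric] of_real_divide of_real_sum of_real_of_nat_eq)
  also have "\<dots> = of_real (\<integral>\<omega>. (1 + 2 * Re z / real l) * (cmod (?Z \<omega> l))\<^sup>2 + 1 \<partial>M)"
    by (rule integral_complex_of_real)
  also have "(\<integral>\<omega>. (1 + 2 * Re z / real l) * (cmod (?Z \<omega> l))\<^sup>2 + 1 \<partial>M) = (1 + 2 * Re z / real l) * level_moment z l + 1"
  proof -
    have "integrable M (\<lambda>\<omega>. (cmod (?Z \<omega> l))\<^sup>2)" by (rule past_integrable[OF pst])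
    then show ?thesis
      unfolding level_moment_def by (subst Bochner_Integration.integral_add) (auto simp: prob_space)
  qed
  finally show ?thesis by (simp only: of_real_eq_iff)
qed


text \<open>The multipliers \<open>B\<close> are predictable: \<open>B l\<close> is known before the
  parent of \<open>l\<close> is drawn, so the products are again martingale differences and
  orthogonal. Taking for \<open>B\<close> the event that a threshold has not yet been reached stops
  the martingale, which yields the maximal inequality below.\<close>

lemma stopped_martingale_bound:
  fixes D :: "nat \<Rightarrow> (nat \<Rightarrow> nat) \<Rightarrow> complex"
  assumes D: "\<And>l. l \<ge> 1 \<Longrightarrow> past (Suc l) (D l)"
    and zero: "\<And>l p. l \<ge> 1 \<Longrightarrow> (\<Sum>v<l. D l (p(l := v))) = 0"
    and bound: "\<And>l p. l \<ge> 1 \<Longrightarrow> cmod (D l p) \<le> d l"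
    and B: "\<And>l. past l (B l)" and N: "N \<ge> 1"
  shows "N \<le> n \<Longrightarrow> past n (\<lambda>p. \<Sum>l\<in>{N..<n}. of_bool (B l p) * D l p)" (is "_ \<Longrightarrow> past n (?X n)")
    and "N \<le> n \<Longrightarrow> (\<integral>\<omega>. (cmod (\<Sum>l\<in>{N..<n}. of_bool (B l (\<lambda>k. parent k \<omega>)) * D l (\<lambda>k. parent k \<omega>)))\<^sup>2 \<partial>M)
           \<le> (\<Sum>l\<in>{N..<n}. (d l)\<^sup>2)"
proof -
  let ?P = "\<lambda>\<omega> k. parent k \<omega>"
  show pastX: "past n (?X n)" if "N \<le> n" for n
  proof (rule past_sum)
    fix l assume l: "l \<in> {N..<n}"
    have "past l (\<lambda>p. of_bool (B l p) :: complex)" by (rule past_comp[where h = of_bool, OF B])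
    then have 1: "past n (\<lambda>p. of_bool (B l p) :: complex)" by (rule past_mono) (use l in simp)
    have 2: "past n (D l)" by (rule past_mono[OF D]) (use l N in auto)
    show "past n (\<lambda>p. of_bool (B l p) * D l p)" by (rule past_comp2[where h = "(*)", OF 1 2])
  qed
  show "N \<le> n \<Longrightarrow> (\<integral>\<omega>. (cmod (?X n (?P \<omega>)))\<^sup>2 \<partial>M) \<le> (\<Sum>l\<in>{N..<n}. (d l)\<^sup>2)"
  proof (induction n rule: dec_induct)
    case base
    then show ?case by simp
  next
    case (step n)
    have n1: "n \<ge> 1" using step N by simp
    let ?Y = "\<lambda>p. of_bool (B n p) * D n p"
    have pX: "past n (?X n)" using pastX step by simp
    have pX': "past (Suc n) (?X n)" using past_mono[OF pX, of "Suc n"] by simp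
    have "past n (\<lambda>p. of_bool (B n p) :: complex)" by (rule past_comp[where h = of_bool, OF B])
    then have 1: "past (Suc n) (\<lambda>p. of_bool (B n p) :: complex)" by (rule past_mono) simp
    have pY: "past (Suc n) ?Y" by (rule past_comp2[where h = "(*)", OF 1 D[OF n1]])
    have pc: "past (Suc n) (\<lambda>p. cnj (?X n p) * ?Y p)"
      by (rule past_comp2[where h = "\<lambda>x y. cnj x * y", OF pX' pY])
    \<comment> \<open>\<open>B n\<close> and the earlier sum do not see the parent of
      \<open>n\<close>, so they factor out of the average and \<open>zero\<close> applies.\<close>
    have z0: "(\<Sum>v<n. cnj (?X n (p(n := v))) * ?Y (p(n := v))) = 0" for p
    proof -
      have "?X n (p(n := v)) = ?X n p" "B n (p(n := v)) = B n p" for v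
        using past_upd[OF pX] past_upd[OF B] by auto
      then have "(\<Sum>v<n. cnj (?X n (p(n := v))) * ?Y (p(n := v))) = cnj (?X n p) * of_bool (B n p) * (\<Sum>v<n. D n (p(n := v)))"
        by (simp only: sum_distrib_left mult.assoc)
      then show ?thesis by (simp add: zero[OF n1])
    qed
    have c0: "(\<integral>\<omega>. cnj (?X n (?P \<omega>)) * ?Y (?P \<omega>) \<partial>M) = 0"
      unfolding expectation_step[OF n1 pc] z0 by simp
    have ic: "integrable M (\<lambda>\<omega>. cnj (?X n (?P \<omega>)) * ?Y (?P \<omega>))"
      by (rule past_integrable[OF pc])
    have iX: "integrable M (\<lambda>\<omega>. (cmod (?X n (?P \<omega>)))\<^sup>2)"
      by (rule past_integrable[OF past_comp[where h = "\<lambda>x. (cmod x)\<^sup>2", OF pX]])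
    have iX': "integrable M (\<lambda>\<omega>. (cmod (?X (Suc n) (?P \<omega>)))\<^sup>2)"
      by (rule past_integrable[OF past_comp[where h = "\<lambda>x. (cmod x)\<^sup>2", OF pastX]]) (use step in simp)
    have split: "(\<integral>\<omega>. u \<omega> + (2 * Re (w \<omega>) + c) \<partial>M) = (\<integral>\<omega>. u \<omega> \<partial>M) + (2 * Re (\<integral>\<omega>. w \<omega> \<partial>M) + c)"
      if "integrable M u" "integrable M w" for u :: "'a \<Rightarrow> real" and w c
    proof -
      have r: "integrable M (\<lambda>\<omega>. 2 * Re (w \<omega>))" "(\<integral>\<omega>. 2 * Re (w \<omega>) \<partial>M) = 2 * Re (\<integral>\<omega>. w \<omega> \<partial>M)"
        using that(2) by simp_all
      have "(\<integral>\<omega>. u \<omega> + (2 * Re (w \<omega>) + c) \<partial>M) = (\<integral>\<omega>. u \<omega> \<partial>M) + (\<integral>\<omega>. 2 * Re (w \<omega>) + c \<partial>M)"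
        using that(1) r(1) by (intro Bochner_Integration.integral_add) auto
      also have "(\<integral>\<omega>. 2 * Re (w \<omega>) + c \<partial>M) = (\<integral>\<omega>. 2 * Re (w \<omega>) \<partial>M) + (\<integral>\<omega>. c \<partial>M)"
        using r(1) by (intro Bochner_Integration.integral_add) auto
      finally show ?thesis using r(2) that(2) by (simp add: prob_space)
    qed
    have int_split: "integrable M (\<lambda>\<omega>. u \<omega> + (2 * Re (w \<omega>) + c))"
      if "integrable M u" "integrable M w" for u :: "'a \<Rightarrow> real" and w and c :: real
      using that by simp
    have "(\<integral>\<omega>. (cmod (?X (Suc n) (?P \<omega>)))\<^sup>2 \<partial>M)
       \<le> (\<integral>\<omega>. (cmod (?X n (?P \<omega>)))\<^sup>2 + (2 * Re (cnj (?X n (?P \<omega>)) * ?Y (?P \<omega>)) + (d n)\<^sup>2) \<partial>M)"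
    proof (rule integral_mono[OF iX' int_split[OF iX ic]])
      fix \<omega> :: 'a
      have "cmod (?Y (?P \<omega>)) \<le> d n" using bound[OF n1, of "?P \<omega>"] by (auto simp: norm_mult intro: order_trans[OF norm_ge_zero])
      then have "(cmod (?Y (?P \<omega>)))\<^sup>2 \<le> (d n)\<^sup>2" by (intro power_mono) auto
      moreover have "?X (Suc n) (?P \<omega>) = ?X n (?P \<omega>) + 1 * ?Y (?P \<omega>)"
        using step by simp
      ultimately show "(cmod (?X (Suc n) (?P \<omega>)))\<^sup>2 \<le> (cmod (?X n (?P \<omega>)))\<^sup>2 + (2 * Re (cnj (?X n (?P \<omega>)) * ?Y (?P \<omega>)) + (d n)\<^sup>2)"
        using cmod_add_unit[of 1 "?X n (?P \<omega>)" "?Y (?P \<omega>)"] by simp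
    qed
    also have "\<dots> = (\<integral>\<omega>. (cmod (?X n (?P \<omega>)))\<^sup>2 \<partial>M) + (2 * Re (\<integral>\<omega>. cnj (?X n (?P \<omega>)) * ?Y (?P \<omega>) \<partial>M) + (d n)\<^sup>2)"
      by (rule split[OF iX ic])
    also have "\<dots> \<le> (\<Sum>l\<in>{N..<n}. (d l)\<^sup>2) + (d n)\<^sup>2"
      using step c0 by simp
    also have "\<dots> = (\<Sum>l\<in>{N..<Suc n}. (d l)\<^sup>2)" using step by simp
    finally show ?case .
  qed
qed


text \<open>Kolmogorov's inequality bounds the probability that the sums started at \<open>N\<close>
  ever reach \<epsilon> by the tail of the series of \<open>(d l)\<^sup>2\<close>, divided by
  \<open>\<epsilon>\<^sup>2\<close>. Letting \<open>N\<close> grow, for each \<epsilon> = 1 / (j +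
  1), makes the partial sums almost surely Cauchy.\<close>

lemma AE_convergent_martingale:
  fixes D :: "nat \<Rightarrow> (nat \<Rightarrow> nat) \<Rightarrow> complex"
  assumes D: "\<And>l. l \<ge> 1 \<Longrightarrow> past (Suc l) (D l)"
    and zero: "\<And>l p. l \<ge> 1 \<Longrightarrow> (\<Sum>v<l. D l (p(l := v))) = 0"
    and bound: "\<And>l p. l \<ge> 1 \<Longrightarrow> cmod (D l p) \<le> d l"
    and d: "summable (\<lambda>l. (d l)\<^sup>2)"
  shows "AE \<omega> in M. convergent (\<lambda>n. \<Sum>l\<in>{1..<n}. D l (\<lambda>k. parent k \<omega>))"
proof -
  let ?P = "\<lambda>\<omega> k. parent k \<omega>"
  define S where "S N n p = (\<Sum>l\<in>{N..<n}. D l p)" for N n p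
  have pastS: "past n (S N n)" if "N \<ge> 1" for N n
    unfolding S_def
  proof (rule past_sum)
    fix l assume "l \<in> {N..<n}"
    then show "past n (D l)" by (intro past_mono[OF D]) (use that in auto)
  qed
  have S_meas: "(\<lambda>\<omega>. S N n (?P \<omega>)) \<in> borel_measurable M" if "N \<ge> 1" for N n
    by (rule past_measurable[OF pastS[OF that]])
  have fin: "prob {\<omega> \<in> space M. \<exists>k\<in>{N..n}. \<epsilon> \<le> cmod (S N k (?P \<omega>))} \<le> (\<Sum>l\<in>{N..<n}. (d l)\<^sup>2) / \<epsilon>\<^sup>2"
    if N: "N \<ge> 1" and n: "N \<le> n" and \<epsilon>: "\<epsilon> > 0" for N n \<epsilon>
  proof -
    define B where "B l p = (\<forall>k\<in>{N..l}. cmod (S N k p) < \<epsilon>)" for l p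
    have pastB: "past l (B l)" for l
      unfolding B_def
    proof (rule past_Ball)
      fix k assume k: "k \<in> {N..l}"
      have "past l (S N k)" using k N by (intro past_mono[OF pastS]) auto
      then show "past l (\<lambda>p. cmod (S N k p) < \<epsilon>)" by (rule past_comp)
    qed
    define X where "X p = (\<Sum>l\<in>{N..<n}. of_bool (B l p) * D l p)" for p
    note sm = stopped_martingale_bound[where D = D and d = d and B = B and N = N and n = n, OF D zero bound pastB N n]
    have iX: "integrable M (\<lambda>\<omega>. (cmod (X (?P \<omega>)))\<^sup>2)"
      unfolding X_def by (rule past_integrable[OF past_comp[where h = "\<lambda>x. (cmod x)\<^sup>2", OF sm(1)]])
    have big: "\<epsilon>\<^sup>2 \<le> (cmod (X p))\<^sup>2" if "\<exists>k\<in>{N..n}. \<epsilon> \<le> cmod (S N k p)" for p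
    proof -
      \<comment> \<open>\<open>B l\<close> is true before the first crossing \<open>k\<close> and
        false from \<open>k\<close> on. So the stopped sum equals \<open>S N k\<close> and stays
        there until \<open>n\<close>, where its square still records the crossing.\<close>
      define k where "k = (LEAST k. k \<in> {N..n} \<and> \<epsilon> \<le> cmod (S N k p))"
      have "\<exists>k. k \<in> {N..n} \<and> \<epsilon> \<le> cmod (S N k p)" using that by blast
      then have k: "k \<in> {N..n}" "\<epsilon> \<le> cmod (S N k p)"
        using LeastI_ex[of "\<lambda>k. k \<in> {N..n} \<and> \<epsilon> \<le> cmod (S N k p)"] by (auto simp: k_def)
      have less: "cmod (S N l p) < \<epsilon>" if "l \<in> {N..<k}" for l
        using not_less_Least[of l "\<lambda>k. k \<in> {N..n} \<and> \<epsilon> \<le> cmod (S N k p)"] that k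
        unfolding k_def[symmetric] by auto
      have B1: "B l p" if "l < k" for l using less that by (auto simp: B_def)
      have B0: "\<not> B l p" if "k \<le> l" for l using k that by (auto simp: B_def not_less)
      have "X p = (\<Sum>l\<in>{N..<k}. of_bool (B l p) * D l p) + (\<Sum>l\<in>{k..<n}. of_bool (B l p) * D l p)"
        unfolding X_def using k by (subst sum.atLeastLessThan_concat) auto
      also have "(\<Sum>l\<in>{N..<k}. of_bool (B l p) * D l p) = S N k p"
        unfolding S_def by (intro sum.cong) (auto simp: B1)
      also have "(\<Sum>l\<in>{k..<n}. of_bool (B l p) * D l p) = 0"
        by (intro sum.neutral) (auto simp: B0)
      finally show ?thesis using k \<epsilon> by (auto intro: power_mono)
    qed
    have "prob {\<omega> \<in> space M. \<exists>k\<in>{N..n}. \<epsilon> \<le> cmod (S N k (?P \<omega>))} \<le> prob {\<omega>\<in>space M. (cmod (X (?P \<omega>)))\<^sup>2 \<ge> \<epsilon>\<^sup>2}"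
      using big iX by (intro finite_measure_mono) auto
    also have "\<dots> \<le> (\<integral>\<omega>. (cmod (X (?P \<omega>)))\<^sup>2 \<partial>M) / \<epsilon>\<^sup>2"
      using \<epsilon> iX by (intro integral_Markov_inequality_measure[where A = "{}"]) auto
    also have "\<dots> \<le> (\<Sum>l\<in>{N..<n}. (d l)\<^sup>2) / \<epsilon>\<^sup>2"
      using sm(2) \<epsilon> unfolding X_def by (intro divide_right_mono) auto
    finally show ?thesis .
  qed
  define A where "A \<epsilon> N = {\<omega> \<in> space M. \<exists>k\<in>{N..}. \<epsilon> \<le> cmod (S N k (?P \<omega>))}" for \<epsilon> N
  have A_sets [measurable]: "A \<epsilon> N \<in> sets M" if "N \<ge> 1" for \<epsilon> N
    unfolding A_def using S_meas[OF that] by measurable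
  have A_prob: "prob (A \<epsilon> N) \<le> (\<Sum>l. (d (l + N))\<^sup>2) / \<epsilon>\<^sup>2" if N: "N \<ge> 1" and \<epsilon>: "\<epsilon> > 0" for N \<epsilon>
  proof -
    define F where "F n = {\<omega> \<in> space M. \<exists>k\<in>{N..n}. \<epsilon> \<le> cmod (S N k (?P \<omega>))}" for n
    have "(\<lambda>n. prob (F n)) \<longlonglongrightarrow> prob (\<Union>n. F n)"
    proof (rule finite_Lim_measure_incseq)
      show "range F \<subseteq> sets M" unfolding F_def using S_meas[OF N] by auto
      show "incseq F" by (auto simp: incseq_def F_def)
    qed
    moreover have "(\<Union>n. F n) = A \<epsilon> N" by (auto simp: F_def A_def) (metis atLeastAtMost_iff order_refl)
    ultimately have lim: "(\<lambda>n. prob (F n)) \<longlonglongrightarrow> prob (A \<epsilon> N)" by simp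
    have "prob (F n) \<le> (\<Sum>l. (d (l + N))\<^sup>2) / \<epsilon>\<^sup>2" if "n \<ge> N" for n
    proof -
      have "prob (F n) \<le> (\<Sum>l\<in>{N..<n}. (d l)\<^sup>2) / \<epsilon>\<^sup>2"
        unfolding F_def by (rule fin[OF N that \<epsilon>])
      also have "(\<Sum>l\<in>{N..<n}. (d l)\<^sup>2) = (\<Sum>l\<in>{0..<n - N}. (d (l + N))\<^sup>2)"
        using sum.shift_bounds_nat_ivl[of "\<lambda>l. (d l)\<^sup>2" 0 N "n - N"] that by simp
      also have "\<dots> \<le> (\<Sum>l. (d (l + N))\<^sup>2)"
        using summable_ignore_initial_segment[OF d, of N] by (intro sum_le_suminf) auto
      finally show ?thesis using \<epsilon> by (simp add: divide_right_mono)
    qed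
    then show ?thesis by (intro LIMSEQ_le_const2[OF lim]) auto
  qed
  have "AE \<omega> in M. \<exists>N\<ge>1. \<forall>k\<ge>N. cmod (S N k (?P \<omega>)) < \<epsilon>" if \<epsilon>: "\<epsilon> > 0" for \<epsilon>
  proof -
    \<comment> \<open>Being in every \<open>A \<epsilon> N\<close> means that the sums never settle
      within \<epsilon>; the probability is below every tail bound, hence 0.\<close>
    define C where "C = (\<Inter>N\<in>{1..}. A \<epsilon> N)"
    have C_sets: "C \<in> sets M" unfolding C_def by (intro sets.countable_INT') (auto intro: A_sets)
    have "(\<lambda>N. (\<Sum>l. (d (l + N))\<^sup>2) / \<epsilon>\<^sup>2) \<longlonglongrightarrow> 0 / \<epsilon>\<^sup>2"
      using suminf_exist_split2[OF d] \<epsilon> by (intro tendsto_divide) auto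
    moreover have "prob C \<le> (\<Sum>l. (d (l + N))\<^sup>2) / \<epsilon>\<^sup>2" if "N \<ge> 1" for N
      using finite_measure_mono[of C "A \<epsilon> N"] A_prob[OF that \<epsilon>] A_sets[OF that, of \<epsilon>] that by (force simp: C_def)
    ultimately have "prob C \<le> 0 / \<epsilon>\<^sup>2"
      by (intro LIMSEQ_le_const[of "\<lambda>N. (\<Sum>l. (d (l + N))\<^sup>2) / \<epsilon>\<^sup>2"]) auto
    then have "prob C = 0" using measure_nonneg[of M C] by simp
    then have "AE \<omega> in M. \<omega> \<notin> C" using prob_eq_0[OF C_sets] by simp
    then show ?thesis
      using AE_space
    proof eventually_elim
      case (elim \<omega>)
      then obtain N where "N \<ge> 1" "\<omega> \<notin> A \<epsilon> N" by (auto simp: C_def)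
      then show ?case using elim by (intro exI[of _ N]) (auto simp: A_def not_le)
    qed
  qed
  then have "AE \<omega> in M. \<forall>j. \<exists>N\<ge>1. \<forall>k\<ge>N. cmod (S N k (?P \<omega>)) < 1 / real (Suc j)"
    unfolding AE_all_countable by auto
  then show ?thesis
  proof eventually_elim
    case (elim \<omega>)
    have "Cauchy (\<lambda>n. \<Sum>l\<in>{1..<n}. D l (?P \<omega>))"
    proof (rule CauchyI')
      fix r :: real assume r: "r > 0"
      obtain j where j: "1 / real (Suc j) < r / 2" using r nat_approx_posE[of "r / 2"] by auto
      obtain N where N: "N \<ge> 1" "\<And>k. k \<ge> N \<Longrightarrow> cmod (S N k (?P \<omega>)) < 1 / real (Suc j)" using elim by blast
      have eq: "(\<Sum>l\<in>{1..<k}. D l (?P \<omega>)) = (\<Sum>l\<in>{1..<N}. D l (?P \<omega>)) + S N k (?P \<omega>)" if "k \<ge> N" for k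
        unfolding S_def using N that by (subst sum.atLeastLessThan_concat) auto
      show "\<exists>K. \<forall>m\<ge>K. \<forall>n>m. dist (\<Sum>l\<in>{1..<m}. D l (?P \<omega>)) (\<Sum>l\<in>{1..<n}. D l (?P \<omega>)) < r"
      proof (intro exI[of _ N] allI impI)
        fix m n assume mn: "N \<le> m" "m < n"
        have "dist (\<Sum>l\<in>{1..<m}. D l (?P \<omega>)) (\<Sum>l\<in>{1..<n}. D l (?P \<omega>)) = cmod (S N m (?P \<omega>) - S N n (?P \<omega>))"
          using mn eq[of m] eq[of n] by (simp add: dist_norm)
        also have "\<dots> \<le> cmod (S N m (?P \<omega>)) + cmod (S N n (?P \<omega>))" by (rule norm_triangle_ineq4)
        also have "\<dots> < r" using N(2)[of m] N(2)[of n] mn j by linarith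
        finally show "dist (\<Sum>l\<in>{1..<m}. D l (?P \<omega>)) (\<Sum>l\<in>{1..<n}. D l (?P \<omega>)) < r" .
      qed
    qed
    then show ?case by (rule Cauchy_convergent)
  qed
qed

end

section \<open>Products and recursions with factors \<open>1 + z / n\<close>\<close>

lemma one_over_le_ln_diff:
  assumes "n \<ge> 1"
  shows "1 / (real n + 1) \<le> ln (real n + 1) - ln (real n)" "ln (real n + 1) - ln (real n) \<le> 1 / real n"
proof -
  have n: "real n > 0" using assms by simp
  have "ln (real n / (real n + 1)) \<le> real n / (real n + 1) - 1"
    using n by (intro ln_le_minus_one) auto
  then show "1 / (real n + 1) \<le> ln (real n + 1) - ln (real n)"
    using n by (simp add: ln_div field_simps)
  have "ln ((real n + 1) / real n) \<le> (real n + 1) / real n - 1"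
    using n by (intro ln_le_minus_one) auto
  then show "ln (real n + 1) - ln (real n) \<le> 1 / real n"
    using n by (simp add: ln_div field_simps)
qed

text \<open>Fix a threshold \<open>d\<close>. Once \<open>e n < kap * d\<close>, the excess of
  \<open>x\<close> over \<open>d\<close> is multiplied by at most \<open>1 - kap / n\<close>, so the
  excess times \<open>n powr kap\<close> does not increase and the excess tends to 0.\<close>

lemma contraction_tendsto_0:
  fixes x e :: "nat \<Rightarrow> real"
  assumes nonneg: "\<And>n. n \<ge> N \<Longrightarrow> x n \<ge> 0" and kap: "kap > 0"
    and rec: "\<And>n. n \<ge> N \<Longrightarrow> x (Suc n) \<le> (1 - kap / real n) * x n + e n / real n"
    and e: "e \<longlonglongrightarrow> 0"
  shows "x \<longlonglongrightarrow> 0"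
proof (rule LIMSEQ_I)
  fix r :: real assume r: "r > 0"
  define d where "d = r / 2"
  have d: "d > 0" using r by (simp add: d_def)
  have "eventually (\<lambda>n. e n < kap * d) sequentially"
    using e d kap by (intro order_tendstoD) auto
  moreover have "eventually (\<lambda>n. real n \<ge> kap + 1) sequentially"
    using eventually_ge_at_top[of "nat \<lceil>kap + 1\<rceil>"] by eventually_elim linarith
  ultimately have "eventually (\<lambda>n. e n < kap * d \<and> real n \<ge> kap + 1 \<and> n \<ge> N \<and> n \<ge> 1) sequentially"
    using eventually_ge_at_top[of N] eventually_ge_at_top[of 1] by eventually_elim auto
  then obtain K where K: "\<And>n. n \<ge> K \<Longrightarrow> e n < kap * d \<and> real n \<ge> kap + 1 \<and> n \<ge> N \<and> n \<ge> 1"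
    by (auto simp: eventually_sequentially)
  define y where "y n = max (x n - d) 0" for n
  have y: "y (Suc n) * exp (kap * ln (real (Suc n))) \<le> y n * exp (kap * ln (real n))" if n: "n \<ge> K" for n
  proof -
    note k = K[OF n]
    have le: "1 - kap / real n \<ge> 0" using k kap by (simp add: field_simps)
    have "x (Suc n) - d \<le> (1 - kap / real n) * x n + e n / real n - d" using rec[of n] k by simp
    also have "e n / real n \<le> kap * d / real n" using k by (intro divide_right_mono) auto
    also have "(1 - kap / real n) * x n + kap * d / real n - d = (1 - kap / real n) * (x n - d)"
      by (simp add: algebra_simps add_divide_distrib diff_divide_distrib)
    also have "\<dots> \<le> (1 - kap / real n) * y n"
      using le by (intro mult_left_mono) (auto simp: y_def)
    finally have "y (Suc n) \<le> (1 - kap / real n) * y n"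
      using le by (auto simp: y_def[of "Suc n"] intro: mult_nonneg_nonneg simp: y_def)
    also have "\<dots> \<le> exp (- kap / real n) * y n"
      using exp_ge_add_one_self[of "- kap / real n"] by (intro mult_right_mono) (auto simp: y_def)
    finally have "y (Suc n) * exp (kap * ln (real (Suc n))) \<le> exp (- kap / real n) * y n * exp (kap * ln (real (Suc n)))"
      by (intro mult_right_mono) auto
    also have "\<dots> = y n * exp (kap * ln (real (Suc n)) - kap / real n)"
      by (simp add: exp_diff exp_minus field_simps)
    also have "\<dots> \<le> y n * exp (kap * ln (real n))"
    proof -
      have "kap * (ln (real n + 1) - ln (real n)) \<le> kap * (1 / real n)"
        using one_over_le_ln_diff[of n] k kap by (intro mult_left_mono) auto
      then show ?thesis by (intro mult_left_mono) (auto simp: y_def algebra_simps)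
    qed
    finally show ?thesis .
  qed
  have "y n * exp (kap * ln (real n)) \<le> y K * exp (kap * ln (real K))" if "n \<ge> K" for n
    using that by (induction n rule: dec_induct) (use y in \<open>auto intro: order_trans\<close>)
  then have yb: "y n \<le> y K * exp (kap * ln (real K)) * exp (- kap * ln (real n))" if "n \<ge> K" for n
    using that by (simp add: exp_minus field_simps)
  have "(\<lambda>n. y K * exp (kap * ln (real K)) * exp (- kap * ln (real n))) \<longlonglongrightarrow> 0"
    using kap by real_asymp
  then have "eventually (\<lambda>n. y K * exp (kap * ln (real K)) * exp (- kap * ln (real n)) < d) sequentially"
    using d by (intro order_tendstoD) auto
  then have "eventually (\<lambda>n. norm (x n - 0) < r) sequentially"
    using eventually_ge_at_top[of K]
  proof eventually_elim
    case (elim n)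
    then have "y n < d" using yb[of n] by simp
    then have "x n < r" by (auto simp: y_def d_def max_def split: if_splits)
    then show ?case using nonneg[of n] K[of n] elim by simp
  qed
  then show "\<exists>no. \<forall>n\<ge>no. norm (x n - 0) < r" by (simp add: eventually_sequentially)
qed

text \<open>The factor by which the conditional mean of \<open>level_sum z\<close> grows between the
  times \<open>l\<close> and \<open>n\<close>. The starting time is a parameter because the same
  products propagate weights backwards from time \<open>n\<close>.\<close>

definition growth_prod :: "complex \<Rightarrow> nat \<Rightarrow> nat \<Rightarrow> complex" where
  "growth_prod z l n = (\<Prod>i\<in>{l..<n}. 1 + z / of_nat i)"

lemma growth_prod_same [simp]: "growth_prod z n n = 1"
  by (simp add: growth_prod_def)

lemma growth_prod_Suc: "l \<le> n \<Longrightarrow> growth_prod z l (Suc n) = growth_prod z l n * (1 + z / of_nat n)"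
  by (simp add: growth_prod_def)

lemma growth_prod_head: "l < n \<Longrightarrow> growth_prod z l n = (1 + z / of_nat l) * growth_prod z (Suc l) n"
  by (simp add: growth_prod_def prod.atLeast_Suc_lessThan)

lemma norm_growth_factor:
  assumes "cmod z = 1" "n \<ge> 1"
  shows "(cmod (1 + z / of_nat n))\<^sup>2 = 1 + 2 * Re z / real n + 1 / (real n)\<^sup>2"
proof -
  have 1: "(Re z)\<^sup>2 + (Im z)\<^sup>2 = 1" using assms(1) by (simp add: cmod_def)
  have "(cmod (1 + z / of_nat n))\<^sup>2 = (1 + Re z / real n)\<^sup>2 + (Im z / real n)\<^sup>2"
    by (simp add: cmod_power2)
  also have "\<dots> = 1 + 2 * Re z / real n + ((Re z)\<^sup>2 + (Im z)\<^sup>2) / (real n)\<^sup>2"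
    by (simp add: power2_sum power_divide add_divide_distrib)
  finally show ?thesis using 1 by simp
qed

lemma inverse_square_le: "k \<ge> 1 \<Longrightarrow> 1 / (real k + 1)\<^sup>2 \<le> 1 / real k - 1 / (real k + 1)"
proof -
  assume k: "k \<ge> 1"
  have "1 / (real k + 1)\<^sup>2 \<le> 1 / (real k * (real k + 1))"
    unfolding power2_eq_square using k by (intro divide_left_mono mult_right_mono) auto
  also have "\<dots> = 1 / real k - 1 / (real k + 1)" using k by (simp add: field_simps)
  finally show ?thesis .
qed

text \<open>The squared modulus of a factor is \<open>1 + 2 * Re z / i + 1 / i\<^sup>2\<close>. The
  harmonic terms are compared with increments of the logarithm; the quadratic ones telescope to at
  most 1, rounded up to 2 so that the square root leaves \<open>exp 1\<close>.\<close>

lemma norm_growth_prod_le: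
  assumes z: "cmod z = 1" "Re z \<le> c" "c \<ge> 0" and l: "1 \<le> l" "l < n"
  shows "cmod (growth_prod z (Suc l) n) \<le> exp 1 * (real n / real l) powr c"
proof -
  have *: "(cmod (growth_prod z (Suc l) (Suc k)))\<^sup>2 \<le> exp (2 * c * (ln (real k) - ln (real l)) + 1 / real l - 1 / real k)"
    if "l \<le> k" for k
    using that
  proof (induction k rule: dec_induct)
    case (step k)
    have k: "k \<ge> 1" using step l by simp
    have "(cmod (growth_prod z (Suc l) (Suc (Suc k))))\<^sup>2
        = (cmod (growth_prod z (Suc l) (Suc k)))\<^sup>2 * (1 + 2 * Re z / (real k + 1) + 1 / (real k + 1)\<^sup>2)"
      using step norm_growth_factor[OF z(1), of "Suc k"]
      by (subst growth_prod_Suc) (auto simp: norm_mult power_mult_distrib add_ac)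
    also have "\<dots> \<le> exp (2 * c * (ln (real k) - ln (real l)) + 1 / real l - 1 / real k)
        * exp (2 * c * (ln (real k + 1) - ln (real k)) + (1 / real k - 1 / (real k + 1)))"
    proof (rule mult_mono)
      have "2 * Re z / (real k + 1) \<le> 2 * c * (1 / (real k + 1))"
        using z by (simp add: divide_right_mono)
      also have "\<dots> \<le> 2 * c * (ln (real k + 1) - ln (real k))"
        using one_over_le_ln_diff[OF k] z by (intro mult_left_mono) auto
      finally have "1 + 2 * Re z / (real k + 1) + 1 / (real k + 1)\<^sup>2
         \<le> 1 + (2 * c * (ln (real k + 1) - ln (real k)) + (1 / real k - 1 / (real k + 1)))"
        using inverse_square_le[OF k] by linarith
      also have "\<dots> \<le> exp (2 * c * (ln (real k + 1) - ln (real k)) + (1 / real k - 1 / (real k + 1)))"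
        by (rule exp_ge_add_one_self)
      finally show "1 + 2 * Re z / (real k + 1) + 1 / (real k + 1)\<^sup>2
         \<le> exp (2 * c * (ln (real k + 1) - ln (real k)) + (1 / real k - 1 / (real k + 1)))" .
      have "0 \<le> (cmod (1 + z / of_nat (Suc k)))\<^sup>2" by simp
      also have "\<dots> = 1 + 2 * Re z / (real k + 1) + 1 / (real k + 1)\<^sup>2"
        using norm_growth_factor[OF z(1), of "Suc k"] by (simp add: add_ac)
      finally show "0 \<le> 1 + 2 * Re z / (real k + 1) + 1 / (real k + 1)\<^sup>2" .
    qed (use step in auto)
    also have "\<dots> = exp (2 * c * (ln (real (Suc k)) - ln (real l)) + 1 / real l - 1 / real (Suc k))"
      unfolding exp_add[symmetric] by (simp add: algebra_simps)
    finally show ?case .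
  qed simp
  obtain k where k: "n = Suc k" "l \<le> k" using l by (cases n) auto
  have "(cmod (growth_prod z (Suc l) n))\<^sup>2 \<le> exp (2 * c * (ln (real k) - ln (real l)) + 1 / real l - 1 / real k)"
    using *[OF k(2)] k by simp
  also have "\<dots> \<le> exp (2 * c * (ln (real n) - ln (real l)) + 2)"
  proof -
    have "2 * c * (ln (real k) - ln (real l)) \<le> 2 * c * (ln (real n) - ln (real l))"
      using z k l by (intro mult_left_mono) auto
    moreover have "1 / real l \<le> 1" using l by simp
    moreover have "1 / real k \<ge> 0" by simp
    ultimately have "2 * c * (ln (real k) - ln (real l)) + 1 / real l - 1 / real k \<le> 2 * c * (ln (real n) - ln (real l)) + 2"
      by linarith
    then show ?thesis by simp
  qed
  also have "\<dots> = (exp 1 * (real n / real l) powr c)\<^sup>2"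
    using l by (simp add: powr_def ln_div power2_eq_square exp_add[symmetric] algebra_simps)
  finally show ?thesis by (rule power2_le_imp_le) auto
qed

text \<open>Up to scaling, the variance that frequency \<open>z\<close> has accumulated by time
  \<open>n\<close>: one squared backward weight for each choice made at a time
  \<open>l < n\<close>.\<close>

definition growth_sum :: "complex \<Rightarrow> nat \<Rightarrow> real" where
  "growth_sum z n = (\<Sum>l\<in>{1..<n}. (cmod (growth_prod z (Suc l) n))\<^sup>2)"

lemma growth_sum_nonneg: "growth_sum z n \<ge> 0"
  by (simp add: growth_sum_def sum_nonneg)

lemma growth_sum_Suc:
  assumes z: "cmod z = 1" and n: "n \<ge> 1"
  shows "growth_sum z (Suc n) = (1 + 2 * Re z / real n + 1 / (real n)\<^sup>2) * growth_sum z n + 1"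
proof -
  have "growth_sum z (Suc n) = (\<Sum>l\<in>{1..<n}. (cmod (growth_prod z (Suc l) (Suc n)))\<^sup>2) + 1"
    using n by (simp add: growth_sum_def)
  also have "(\<Sum>l\<in>{1..<n}. (cmod (growth_prod z (Suc l) (Suc n)))\<^sup>2)
     = (\<Sum>l\<in>{1..<n}. (1 + 2 * Re z / real n + 1 / (real n)\<^sup>2) * (cmod (growth_prod z (Suc l) n))\<^sup>2)"
    using norm_growth_factor[OF z n]
    by (intro sum.cong refl, subst growth_prod_Suc) (auto simp: norm_mult power_mult_distrib)
  finally show ?thesis by (simp add: growth_sum_def sum_distrib_left)
qed

lemma growth_sum_1 [simp]: "growth_sum z (Suc 0) = 0"
  by (simp add: growth_sum_def)

text \<open>Trying \<open>g * n\<close> in the recursion of \<open>growth_sum\<close> forces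
  \<open>g = 2 * c * g + 1\<close>. The relative distance to this line contracts, since products of
  the factors \<open>1 + 2 * c / n\<close> grow more slowly than \<open>n\<close> when
  \<open>c < 1/2\<close>.\<close>

lemma growth_sum_tendsto:
  assumes z: "cmod z = 1" and c: "Re z < 1/2"
  shows "(\<lambda>n. growth_sum z n / real n) \<longlonglongrightarrow> 1 / (1 - 2 * Re z)"
proof -
  define c where "c = Re z"
  define g where "g = 1 / (1 - 2 * c)"
  have cpos: "1 - 2 * c > 0" using assms by (simp add: c_def)
  have g: "2 * c * g + 1 - g = 0" using cpos by (simp add: g_def field_simps)
  have g0: "g > 0" using cpos by (simp add: g_def)
  define x where "x n = \<bar>growth_sum z n - g * real n\<bar> / real n" for n
  have "x \<longlonglongrightarrow> 0"
  \<comment> \<open>Half of the rate \<open>1 - 2 * c\<close> pays for the correction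
    \<open>1 / n\<close>, which is the purpose of the lower bound on \<open>n\<close>; half of the
    rest is lost when \<open>Suc n\<close> is replaced by \<open>2 * n\<close>. A quarter
    remains.\<close>
  proof (rule contraction_tendsto_0[where kap = "(1 - 2 * c) / 4" and e = "\<lambda>n. g / real (Suc n)" and N = "nat \<lceil>2 / (1 - 2 * c)\<rceil> + 1"])
    fix n assume n: "n \<ge> nat \<lceil>2 / (1 - 2 * c)\<rceil> + 1"
    then have n1: "n \<ge> 1" by simp
    have "real n \<ge> 2 / (1 - 2 * c)" using n by linarith
    then have n2: "real n * (1 - 2 * c) \<ge> 2" using cpos by (simp add: field_simps)
    show "x n \<ge> 0" by (simp add: x_def)
    define rho where "rho = 1 + 2 * c / real n + 1 / (real n)\<^sup>2"
    have rho0: "rho \<ge> 0"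
      using norm_growth_factor[OF z n1] zero_le_power2[of "cmod (1 + z / of_nat n)"] by (simp add: rho_def c_def)
    have "growth_sum z (Suc n) - g * real (Suc n) = rho * (growth_sum z n - g * real n) + g / real n + (2 * c * g + 1 - g)"
      using n1 by (simp add: growth_sum_Suc[OF z n1] rho_def c_def[symmetric] field_simps power2_eq_square)
    then have "growth_sum z (Suc n) - g * real (Suc n) = rho * (growth_sum z n - g * real n) + g / real n"
      using g by simp
    then have "\<bar>growth_sum z (Suc n) - g * real (Suc n)\<bar> \<le> rho * \<bar>growth_sum z n - g * real n\<bar> + g / real n"
      using abs_triangle_ineq[of "rho * (growth_sum z n - g * real n)" "g / real n"] rho0 g0 by (simp add: abs_mult)
    then have "x (Suc n) \<le> (rho * \<bar>growth_sum z n - g * real n\<bar> + g / real n) / real (Suc n)"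
      unfolding x_def by (intro divide_right_mono) auto
    also have "\<dots> = (rho * real n / real (Suc n)) * x n + g / real (Suc n) / real n"
      using n1 by (simp add: x_def add_divide_distrib)
    also have "\<dots> \<le> (1 - (1 - 2 * c) / 4 / real n) * x n + g / real (Suc n) / real n"
    proof -
      have "rho * real n / real (Suc n) = 1 - (1 - 2 * c - 1 / real n) / real (Suc n)"
      proof -
        have "rho * real n = real (Suc n) - (1 - 2 * c - 1 / real n)"
          using n1 by (simp add: rho_def field_simps power2_eq_square)
        then show ?thesis by (simp add: diff_divide_distrib del: of_nat_Suc)
      qed
      also have "(1 - 2 * c - 1 / real n) / real (Suc n) \<ge> ((1 - 2 * c) / 2) / real (2 * n)"
        using n1 n2 cpos by (intro frac_le) (auto simp: field_simps)
      then have "1 - (1 - 2 * c - 1 / real n) / real (Suc n) \<le> 1 - (1 - 2 * c) / 4 / real n" by simp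
      finally show ?thesis by (intro add_right_mono mult_right_mono) (auto simp: x_def)
    qed
    finally show "x (Suc n) \<le> (1 - (1 - 2 * c) / 4 / real n) * x n + g / real (Suc n) / real n" .
  next
    show "(\<lambda>n. g / real (Suc n)) \<longlonglongrightarrow> 0" by real_asymp
  qed (use cpos in auto)
  moreover have "eventually (\<lambda>n. \<bar>growth_sum z n / real n - g\<bar> = x n) sequentially"
    using eventually_gt_at_top[of 0]
  proof eventually_elim
    case (elim n)
    have "growth_sum z n / real n - g = (growth_sum z n - g * real n) / real n" using elim by (simp add: field_simps)
    then show ?case by (simp add: x_def)
  qed
  ultimately have "(\<lambda>n. \<bar>growth_sum z n / real n - g\<bar>) \<longlonglongrightarrow> 0"
    by (simp add: tendsto_cong)
  then have "(\<lambda>n. growth_sum z n / real n) \<longlonglongrightarrow> g"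
    by (simp add: tendsto_rabs_zero_iff LIM_zero_cancel)
  then show ?thesis by (simp add: g_def c_def)
qed

text \<open>Discrete, telescoping version of the antiderivative \<open>- (1 + ln x) / x\<close> of
  \<open>ln x / x\<^sup>2\<close>, with 2 in place of 1.\<close>

lemma ln_step: 
  assumes n: "n \<ge> 1"
  shows "ln (real n) / (real n * (real n + 1)) \<le> (2 + ln (real n)) / real n - (2 + ln (real n + 1)) / (real n + 1)"
proof -
  have "real n * (ln (real n + 1) - ln (real n)) \<le> real n * (1 / real n)"
    using one_over_le_ln_diff[OF n] by (intro mult_left_mono) auto
  then have "real n * (ln (real n + 1) - ln (real n)) \<le> 1" using n by simp
  then have "ln (real n) \<le> (2 + ln (real n)) * (real n + 1) - (2 + ln (real n + 1)) * real n"
    by (simp add: algebra_simps)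
  then have "ln (real n) / (real n * (real n + 1)) \<le> ((2 + ln (real n)) * (real n + 1) - (2 + ln (real n + 1)) * real n) / (real n * (real n + 1))"
    by (intro divide_right_mono) auto
  also have "\<dots> = (2 + ln (real n)) / real n - (2 + ln (real n + 1)) / (real n + 1)"
    using n by (simp add: diff_divide_distrib)
  finally show ?thesis .
qed

text \<open>For \<open>2 * Re z = 1\<close> the quotient \<open>v n = growth_sum z n / n\<close> has
  increments \<open>1 / (n + 1)\<close> plus \<open>v n / (n * (n + 1))\<close>. A crude bound of
  \<open>v n\<close> by a multiple of \<open>ln n\<close> makes the second part summable, so
  \<open>v n\<close> stays within a bounded distance of \<open>ln n\<close>.\<close>

lemma growth_sum_tendsto_half:
  assumes z: "cmod z = 1" and c: "Re z = 1/2"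
  shows "(\<lambda>n. growth_sum z n / (real n * ln (real n))) \<longlonglongrightarrow> 1"
proof -
  define v where "v n = growth_sum z n / real n" for n
  have c2: "2 * Re z = 1" using c by simp
  have v: "v (Suc n) = v n + v n / (real n * (real n + 1)) + 1 / (real n + 1)" if n: "n \<ge> 1" for n
  proof -
    have "((1 + 1 / x + 1 / x\<^sup>2) * g + 1) / (x + 1) = g / x + g / x / (x * (x + 1)) + 1 / (x + 1)" if "x > 0" for x g :: real
      using that by (simp add: divide_simps power2_eq_square) (simp add: algebra_simps)
    from this[of "real n" "growth_sum z n"] show ?thesis
      unfolding v_def growth_sum_Suc[OF z n] c2 using n by (simp add: add_ac)
  qed
  have v0: "v n \<ge> 0" for n by (simp add: v_def growth_sum_nonneg)
  have v1: "v (Suc 0) = 0" by (simp add: v_def)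
  \<comment> \<open>The factor \<open>1 + 1 / (n * (n + 1))\<close> is at most
    \<open>exp (1 / n - 1 / (n + 1))\<close>, which the weight \<open>exp (1 / n)\<close>
    absorbs.\<close>
  have s: "v n * exp (1 / real n) \<le> exp 1 * ln (real n)" if "n \<ge> 1" for n
    using that
  proof (induction n rule: dec_induct)
    case (step n)
    have n: "n \<ge> 1" using step by simp
    have "1 / real n - 1 / (real n + 1) = 1 / (real n * (real n + 1))" using n by (simp add: field_simps)
    then have e: "1 + 1 / (real n * (real n + 1)) \<le> exp (1 / real n - 1 / (real n + 1))"
      using exp_ge_add_one_self[of "1 / real n - 1 / (real n + 1)"] by simp
    have "v (Suc n) * exp (1 / real (Suc n)) = v n * (1 + 1 / (real n * (real n + 1))) * exp (1 / (real n + 1)) + 1 / (real n + 1) * exp (1 / (real n + 1))"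
      using v[OF n] by (simp add: algebra_simps)
    also have "\<dots> \<le> v n * exp (1 / real n - 1 / (real n + 1)) * exp (1 / (real n + 1)) + (ln (real n + 1) - ln (real n)) * exp 1"
      using e v0[of n] one_over_le_ln_diff[OF n] by (intro add_mono mult_mono mult_nonneg_nonneg) (use n in auto)
    also have "\<dots> = v n * exp (1 / real n) + (ln (real n + 1) - ln (real n)) * exp 1"
      by (simp add: exp_diff)
    also have "\<dots> \<le> exp 1 * ln (real (Suc n))"
      using step.IH by (simp add: algebra_simps)
    finally show ?case .
  qed (simp add: v1)
  have vb: "v n \<le> 3 * ln (real n)" if n: "n \<ge> 1" for n
  proof -
    have "v n * 1 \<le> v n * exp (1 / real n)" using v0[of n] by (intro mult_left_mono) auto
    also have "\<dots> \<le> exp 1 * ln (real n)" by (rule s[OF n])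
    also have "\<dots> \<le> 3 * ln (real n)" using n exp_le by (intro mult_right_mono) auto
    finally show ?thesis by simp
  qed
  \<comment> \<open>The subtracted terms telescope with the error bounds, and 7 = 3 * 2 + 1 makes
    the right-hand side 0 at \<open>n = 1\<close>, where \<open>v\<close> and \<open>ln\<close> both
    vanish.\<close>
  have r: "\<bar>v n - ln (real n)\<bar> \<le> 7 - 3 * ((2 + ln (real n)) / real n) - 1 / real n" if "n \<ge> 1" for n
    using that
  proof (induction n rule: dec_induct)
    case (step n)
    have n: "n \<ge> 1" using step by simp
    have "v n / (real n * (real n + 1)) \<le> 3 * ln (real n) / (real n * (real n + 1))"
      using vb[OF n] by (intro divide_right_mono) auto
    also have "\<dots> \<le> 3 * ((2 + ln (real n)) / real n - (2 + ln (real n + 1)) / (real n + 1))"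
      using mult_left_mono[OF ln_step[OF n], of 3] by (simp only: times_divide_eq_right zero_le_numeral)
    finally have 1: "v n / (real n * (real n + 1)) \<le> 3 * ((2 + ln (real n)) / real n - (2 + ln (real n + 1)) / (real n + 1))" .
    have 2: "v n / (real n * (real n + 1)) \<ge> 0" using v0[of n] by simp
    have "v (Suc n) - ln (real (Suc n)) = (v n - ln (real n)) + v n / (real n * (real n + 1)) + (1 / (real n + 1) - (ln (real n + 1) - ln (real n)))"
      using v[OF n] by (simp add: add_ac)
    then have "\<bar>v (Suc n) - ln (real (Suc n))\<bar> \<le> \<bar>v n - ln (real n)\<bar> + 3 * ((2 + ln (real n)) / real n - (2 + ln (real n + 1)) / (real n + 1)) + (1 / real n - 1 / (real n + 1))"
      using 1 2 one_over_le_ln_diff[OF n] by linarith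
    then show ?case using step.IH by (simp add: algebra_simps)
  qed (simp add: v1)
  have r7: "\<bar>v n - ln (real n)\<bar> \<le> 7" if n: "n \<ge> 1" for n
  proof -
    have "(2 + ln (real n)) / real n \<ge> 0" "1 / real n \<ge> 0" using n by auto
    then show ?thesis using r[OF n] by linarith
  qed
  have "(\<lambda>n. (v n - ln (real n)) / ln (real n)) \<longlonglongrightarrow> 0"
  proof (rule Lim_null_comparison)
    show "eventually (\<lambda>n. norm ((v n - ln (real n)) / ln (real n)) \<le> 7 / ln (real n)) sequentially"
      using eventually_ge_at_top[of 2]
      by eventually_elim (use r7 in \<open>auto simp: abs_divide intro!: divide_right_mono\<close>)
    show "(\<lambda>n. 7 / ln (real n)) \<longlonglongrightarrow> 0" by real_asymp
  qed
  then have "(\<lambda>n. (v n - ln (real n)) / ln (real n) + 1) \<longlonglongrightarrow> 0 + 1" by (intro tendsto_add) auto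
  moreover have "eventually (\<lambda>n. (v n - ln (real n)) / ln (real n) + 1 = growth_sum z n / (real n * ln (real n))) sequentially"
    using eventually_ge_at_top[of 2] by eventually_elim (auto simp: v_def diff_divide_distrib)
  ultimately show ?thesis by (simp add: tendsto_cong)
qed

text \<open>The line with slope \<open>K = 1 / (1 - 2 * d)\<close> is a supersolution because
  \<open>K = 2 * d * K + 1\<close>. The bound \<open>d\<close> is nonnegative even when
  \<open>c\<close> is not, which gives \<open>K \<ge> 1\<close> for the start.\<close>

lemma second_moment_recursion_linear:
  fixes a :: "nat \<Rightarrow> real"
  assumes a1: "a 1 = 1" and rec: "\<And>n. n \<ge> 1 \<Longrightarrow> a (Suc n) = (1 + 2 * c / real n) * a n + 1"
    and nonneg: "\<And>n. a n \<ge> 0" and c: "c \<le> d" "0 \<le> d" "d < 1/2" and n: "n \<ge> 1"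
  shows "a n \<le> 1 / (1 - 2 * d) * real n"
  using n
proof (induction n rule: dec_induct)
  case base
  then show ?case using a1 c by (simp add: field_simps)
next
  case (step n)
  define K where "K = 1 / (1 - 2 * d)"
  have K: "2 * d * K + 1 = K" using c by (simp add: K_def field_simps)
  have n: "n \<ge> 1" using step by simp
  have "a (Suc n) \<le> (1 + 2 * d / real n) * a n + 1"
    unfolding rec[OF n] using c nonneg[of n] by (intro add_right_mono mult_right_mono add_left_mono divide_right_mono) auto
  also have "\<dots> \<le> (1 + 2 * d / real n) * (K * real n) + 1"
    using step.IH c by (intro add_right_mono mult_left_mono) (auto simp: K_def)
  also have "\<dots> = K * real n + (2 * d * K + 1)" using n by (simp add: field_simps)
  also have "\<dots> = K * real (Suc n)" using K by (simp add: algebra_simps)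
  finally show ?case by (simp add: K_def)
qed

text \<open>Supersolution for the critical exponent, since
  \<open>ln (n + 1) - ln n \<ge> 1 / (n + 1)\<close> pays for the summand 1.\<close>

lemma second_moment_recursion_half:
  fixes a :: "nat \<Rightarrow> real"
  assumes a1: "a 1 = 1" and rec: "\<And>n. n \<ge> 1 \<Longrightarrow> a (Suc n) = (1 + 2 * c / real n) * a n + 1"
    and nonneg: "\<And>n. a n \<ge> 0" and c: "c \<le> 1/2" and n: "n \<ge> 1"
  shows "a n \<le> real n * (1 + ln (real n))"
  using n
proof (induction n rule: dec_induct)
  case base
  then show ?case using a1 by simp
next
  case (step n)
  have n: "n \<ge> 1" using step by simp
  have "2 * c / real n \<le> 1 / real n" using c by (intro divide_right_mono) auto
  then have "a (Suc n) \<le> (1 + 1 / real n) * a n + 1"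
    unfolding rec[OF n] using nonneg[of n] by (intro add_right_mono mult_right_mono) auto
  also have "\<dots> \<le> (1 + 1 / real n) * (real n * (1 + ln (real n))) + 1"
    using step.IH by (intro add_right_mono mult_left_mono) auto
  also have "\<dots> = (real n + 1) * (1 + ln (real n)) + 1" using n by (simp add: field_simps)
  also have "\<dots> \<le> (real n + 1) * (1 + ln (real n)) + (real n + 1) * (ln (real n + 1) - ln (real n))"
  proof -
    have "(real n + 1) * (1 / (real n + 1)) \<le> (real n + 1) * (ln (real n + 1) - ln (real n))"
      using one_over_le_ln_diff[OF n] by (intro mult_left_mono) auto
    then show ?thesis by simp
  qed
  also have "\<dots> = real (Suc n) * (1 + ln (real (Suc n)))" by (simp add: algebra_simps)
  finally show ?case .
qed

text \<open>Up to a shift this is Gauss' sequence for the reciprocal Gamma function: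
  \<open>growth_prod z 1 (Suc n) = pochhammer z (Suc n) / (z * fact n)\<close>.\<close>

lemma growth_prod_asymptotics:
  assumes "z \<noteq> 0"
  shows "(\<lambda>n. growth_prod z 1 n / exp (z * of_real (ln (real n)))) \<longlonglongrightarrow> rGamma z / z"
proof -
  have poch: "growth_prod z 1 (Suc n) = pochhammer z (Suc n) / (z * fact n)" for n
  proof (induction n)
    case 0
    then show ?case using assms by (simp add: growth_prod_def)
  next
    case (Suc n)
    have "growth_prod z 1 (Suc (Suc n)) = pochhammer z (Suc n) / (z * fact n) * (1 + z / of_nat (Suc n))"
      using Suc by (subst growth_prod_Suc) auto
    also have "1 + z / of_nat (Suc n) = (z + of_nat (Suc n)) / of_nat (Suc n)"
      by (simp add: add_divide_distrib del: of_nat_Suc)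
    also have "pochhammer z (Suc n) / (z * fact n) * \<dots> = pochhammer z (Suc (Suc n)) / (z * fact (Suc n))"
      by (subst (2) pochhammer_Suc) (simp del: of_nat_Suc add: mult_ac)
    finally show ?case .
  qed
  \<comment> \<open>\<open>rGamma_series z n\<close> contains the factor with index
    \<open>n\<close>, which \<open>growth_prod z 1 n\<close> does not; dividing by it leaves the
    limit unchanged.\<close>
  have "(\<lambda>n. rGamma_series z n / z / (1 + z / of_nat n)) \<longlonglongrightarrow> rGamma z / z / (1 + 0)"
    by (intro tendsto_intros rGamma_series_LIMSEQ assms tendsto_divide_0[OF tendsto_const] tendsto_of_nat) auto
  moreover have "eventually (\<lambda>n. rGamma_series z n / z / (1 + z / of_nat n) = growth_prod z 1 n / exp (z * of_real (ln (real n)))) sequentially"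
    using eventually_gt_at_top[of "nat \<lceil>cmod z\<rceil>"] eventually_ge_at_top[of 1]
  proof eventually_elim
    case (elim n)
    have "1 + z / of_nat n \<noteq> 0"
    proof
      assume "1 + z / of_nat n = 0"
      then have "z = - of_nat n" using elim by (simp add: field_simps add_eq_0_iff2)
      then have "cmod z = real n" by simp
      then show False using elim by simp
    qed
    then have "growth_prod z 1 n = growth_prod z 1 (Suc n) / (1 + z / of_nat n)"
      using elim by (subst growth_prod_Suc) auto
    then show ?case using assms by (simp only: poch) (simp add: rGamma_series_def field_simps)
  qed
  ultimately show ?thesis by (simp add: tendsto_cong)
qed

section \<open>Convergence in distribution through trigonometric polynomials\<close>

lemma continuous_map_restrict_vec:
  "continuous_map euclidean (vec_topology m) (\<lambda>x. \<lambda>j\<in>{..<m}. x j)"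
  by (auto simp: continuous_map_componentwise)

lemma continuous_on_vec:
  fixes f :: "(nat \<Rightarrow> real) \<Rightarrow> real"
  assumes "continuous_map (vec_topology m) euclideanreal f"
  shows "continuous_on UNIV (\<lambda>x. f (\<lambda>j\<in>{..<m}. x j))"
  using continuous_map_compose[OF continuous_map_restrict_vec assms]
  by (simp add: comp_def)

text \<open>Detour through all of \<open>nat \<Rightarrow> real\<close>, where the product sigma
  algebra is the Borel one. A vector lies in this space with the constant \<open>undefined\<close>
  in the coordinates from \<open>m\<close> on.\<close>

lemma borel_measurable_vec:
  fixes f :: "(nat \<Rightarrow> real) \<Rightarrow> real"
  assumes "continuous_map (vec_topology m) euclideanreal f"
  shows "f \<in> borel_measurable (vec_borel m)"
proof -
  have 1: "(\<lambda>x. f (\<lambda>j\<in>{..<m}. x j)) \<in> borel_measurable (Pi\<^sub>M UNIV (\<lambda>_. borel))"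
    using borel_measurable_continuous_onI[OF continuous_on_vec[OF assms]]
    by (simp add: measurable_def sets_PiM_equal_borel space_PiM)
  have 2: "(\<lambda>x. x) \<in> measurable (vec_borel m) (Pi\<^sub>M UNIV (\<lambda>_. borel :: real measure))"
  proof (rule measurable_PiM_single')
    fix i :: nat
    show "(\<lambda>x. x i) \<in> borel_measurable (vec_borel m)"
    proof (cases "i < m")
      case False
      then have "x i = undefined" if "x \<in> space (vec_borel m)" for x :: "nat \<Rightarrow> real"
        using that by (auto simp: space_PiM PiE_def extensional_def)
      then show ?thesis by (subst measurable_cong[where g = "\<lambda>_. undefined"]) auto
    qed (auto intro: measurable_component_singleton)
  qed auto
  have "(\<lambda>x. f (\<lambda>j\<in>{..<m}. x j)) \<in> borel_measurable (vec_borel m)"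
    using measurable_compose[OF 2 1] .
  moreover have "(\<lambda>j\<in>{..<m}. x j) = x" if "x \<in> space (vec_borel m)" for x :: "nat \<Rightarrow> real"
    using that by (auto simp: space_PiM)
  ultimately show ?thesis by (subst (asm) measurable_cong[where g = f]) auto
qed

text \<open>Phase \<open>- pi / 2\<close> gives sines, frequency 0 gives constants, and products
  stay in the class by the product-to-sum formula. So this is a real algebra, as Stone-Weierstrass
  requires, while the integral of each cosine is the real part of a rotated characteristic
  function.\<close>

inductive trig_poly :: "nat \<Rightarrow> ((nat \<Rightarrow> real) \<Rightarrow> real) \<Rightarrow> bool" for m where
  cos: "trig_poly m (\<lambda>x. c * cos ((\<Sum>j<m. t j * x j) + \<theta>))"
| add: "trig_poly m f \<Longrightarrow> trig_poly m g \<Longrightarrow> trig_poly m (\<lambda>x. f x + g x)"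

lemma trig_poly_mult:
  assumes "trig_poly m f" "trig_poly m g"
  shows "trig_poly m (\<lambda>x. f x * g x)"
  using assms(1)
proof (induction rule: trig_poly.induct)
  case (cos c t \<theta>)
  show ?case using assms(2)
  proof (induction rule: trig_poly.induct)
    case (cos c' t' \<theta>')
    have "(\<lambda>x. c * cos ((\<Sum>j<m. t j * x j) + \<theta>) * (c' * cos ((\<Sum>j<m. t' j * x j) + \<theta>')))
       = (\<lambda>x. c * c' / 2 * cos ((\<Sum>j<m. (t j - t' j) * x j) + (\<theta> - \<theta>'))
            + c * c' / 2 * cos ((\<Sum>j<m. (t j + t' j) * x j) + (\<theta> + \<theta>')))"
    proof
      fix x :: "nat \<Rightarrow> real"
      have "cos a * cos b = (cos (a - b) + cos (a + b)) / 2" for a b :: real by (rule cos_times_cos)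
      from this[of "(\<Sum>j<m. t j * x j) + \<theta>" "(\<Sum>j<m. t' j * x j) + \<theta>'"]
      have 1: "cos ((\<Sum>j<m. t j * x j) + \<theta>) * cos ((\<Sum>j<m. t' j * x j) + \<theta>')
         = (cos ((\<Sum>j<m. (t j - t' j) * x j) + (\<theta> - \<theta>')) + cos ((\<Sum>j<m. (t j + t' j) * x j) + (\<theta> + \<theta>'))) / 2"
        by (simp add: sum.distrib sum_subtractf distrib_right left_diff_distrib add_ac diff_add_eq diff_diff_eq2 algebra_simps)
      have "c * C * (c' * D) = c * c' * (C * D)" for C D :: real by simp
      then show "c * cos ((\<Sum>j<m. t j * x j) + \<theta>) * (c' * cos ((\<Sum>j<m. t' j * x j) + \<theta>'))
        = c * c' / 2 * cos ((\<Sum>j<m. (t j - t' j) * x j) + (\<theta> - \<theta>'))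
            + c * c' / 2 * cos ((\<Sum>j<m. (t j + t' j) * x j) + (\<theta> + \<theta>'))"
        unfolding 1 by (simp only: 1) (simp add: distrib_left)
    qed
    then show ?case by (simp only:) (intro trig_poly.intros)
  next
    case (add f g)
    then show ?case by (simp only: distrib_left) (intro trig_poly.intros)
  qed
next
  case (add f g)
  then show ?case by (simp only: distrib_right) (intro trig_poly.intros)
qed

lemma trig_poly_measurable: "trig_poly m f \<Longrightarrow> f \<in> borel_measurable (vec_borel m)"
  by (induction rule: trig_poly.induct) auto

lemma trig_poly_bounded: "trig_poly m f \<Longrightarrow> \<exists>B. \<forall>x. \<bar>f x\<bar> \<le> B"
proof (induction rule: trig_poly.induct)
  case (cos c t \<theta>)
  have "\<bar>c * cos ((\<Sum>j<m. t j * x j) + \<theta>)\<bar> \<le> \<bar>c\<bar>" for x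
    using mult_left_mono[OF abs_cos_le_one, of "\<bar>c\<bar>"] by (simp add: abs_mult)
  then show ?case by blast
next
  case (add f g)
  then obtain B C where "\<forall>x. \<bar>f x\<bar> \<le> B" "\<forall>x. \<bar>g x\<bar> \<le> C" by blast
  then have "\<forall>x. \<bar>f x + g x\<bar> \<le> B + C" by (meson abs_triangle_ineq add_mono order_trans)
  then show ?case by blast
qed

lemma trig_poly_integrable:
  assumes "prob_space \<mu>" "sets \<mu> = sets (vec_borel m)" "trig_poly m f"
  shows "integrable \<mu> f"
proof -
  interpret prob_space \<mu> by fact
  obtain B where "\<And>x. \<bar>f x\<bar> \<le> B" using trig_poly_bounded[OF assms(3)] by blast
  then show ?thesis
    using trig_poly_measurable[OF assms(3)] measurable_cong_sets[OF assms(2) refl]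
    by (intro integrable_const_bound[where B = B]) auto
qed

lemma trig_poly_tendsto:
  fixes \<mu> :: "nat \<Rightarrow> (nat \<Rightarrow> real) measure"
  assumes \<mu>: "\<And>n. prob_space (\<mu> n)" "\<And>n. sets (\<mu> n) = sets (vec_borel m)"
    and \<nu>: "prob_space \<nu>" "sets \<nu> = sets (vec_borel m)"
    and conv: "\<And>t \<theta>. (\<lambda>n. \<integral>x. cos ((\<Sum>j<m. t j * x j) + \<theta>) \<partial>\<mu> n) \<longlonglongrightarrow> (\<integral>x. cos ((\<Sum>j<m. t j * x j) + \<theta>) \<partial>\<nu>)"
    and f: "trig_poly m f"
  shows "(\<lambda>n. integral\<^sup>L (\<mu> n) f) \<longlonglongrightarrow> integral\<^sup>L \<nu> f"
  using f
proof (induction rule: trig_poly.induct)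
  case (cos c t \<theta>)
  show ?case using tendsto_mult[OF tendsto_const[of c] conv[of t \<theta>]] by simp
next
  case (add f g)
  then show ?case
    using trig_poly_integrable[OF \<mu>] trig_poly_integrable[OF \<nu>]
    by (simp add: tendsto_add)
qed

text \<open>
  On the cube \<open>\<bar>x\<^sub>j\<bar> \<le> L \<pi> / 2\<close> the substitution \<open>u\<^sub>j = sin (x\<^sub>j / L)\<close> is inverted by \<open>x\<^sub>j = L arcsin u\<^sub>j\<close>,
  and it turns polynomials in \<open>u\<close> into trigonometric polynomials in \<open>x\<close>; the approximation below is therefore
  globally bounded, which is what makes tightness enough to control the error off the cube.
\<close>
lemma trig_poly_approx:
  fixes f :: "(nat \<Rightarrow> real) \<Rightarrow> real"
  assumes f: "continuous_map (vec_topology m) euclideanreal f" and L: "L > 0" and e: "e > 0"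
  shows "\<exists>h. trig_poly m h \<and> (\<forall>x. \<bar>h x - f (\<lambda>j\<in>{..<m}. L * arcsin (sin (x j / L)))\<bar> < e)"
proof -
  \<comment> \<open>The coordinates from \<open>m\<close> on are pinned to 0, so that the first
    \<open>m\<close> coordinates separate the points of the compact set \<open>K\<close>.\<close>
  define K :: "(nat \<Rightarrow> real) set" where "K = PiE UNIV (\<lambda>i. if i < m then {-1..1} else {0})"
  have "compactin (product_topology (\<lambda>_. euclideanreal) UNIV) K"
    unfolding K_def by (subst compactin_PiE) auto
  then have K: "compact K" by (simp add: euclidean_product_topology)
  define s where "s x = (\<lambda>i. if i < m then sin (x i / L) else 0)" for x :: "nat \<Rightarrow> real"
  have sK: "s x \<in> K" for x by (auto simp: s_def K_def)
  define F where "F u = f (\<lambda>j\<in>{..<m}. L * arcsin (u j))" for u :: "nat \<Rightarrow> real"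
  have "continuous_map (top_of_set K) (vec_topology m) (\<lambda>u. \<lambda>j\<in>{..<m}. L * arcsin (u j))"
  proof (subst continuous_map_componentwise, intro conjI ballI)
    fix k assume k: "k \<in> {..<m}"
    have "continuous_on K (\<lambda>u. L * arcsin (u k))"
      using k by (intro continuous_intros continuous_on_arcsin continuous_on_subset[OF continuous_on_product_coordinates])
        (auto simp: K_def PiE_def Pi_def split: if_splits)
    then show "continuous_map (top_of_set K) euclideanreal (\<lambda>u. (\<lambda>j\<in>{..<m}. L * arcsin (u j)) k)"
      using k by simp
  qed auto
  from continuous_map_compose[OF this f] have F: "continuous_on K F"
    by (simp add: comp_def F_def)
  \<comment> \<open>The functions of \<open>u\<close> whose pull-back along \<open>s\<close> is a
    trigonometric polynomial in \<open>x\<close>; coordinate functions pull back to sines.\<close>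
  define P where "P g \<longleftrightarrow> continuous_on K g \<and> trig_poly m (\<lambda>x. g (s x))" for g :: "(nat \<Rightarrow> real) \<Rightarrow> real"
  have "\<exists>g. P g \<and> (\<forall>u\<in>K. \<bar>F u - g u\<bar> < e)"
  proof (rule Stone_Weierstrass_HOL[OF K])
    show "P (\<lambda>x. c)" for c
      using trig_poly.cos[of m c "\<lambda>_. 0" 0] by (simp add: P_def)
    show "P f \<Longrightarrow> continuous_on K f" for f by (simp add: P_def)
    show "P f \<and> P g \<Longrightarrow> P (\<lambda>x. f x + g x)" for f g
      by (auto simp: P_def intro: continuous_intros trig_poly.add)
    show "P f \<and> P g \<Longrightarrow> P (\<lambda>x. f x * g x)" for f g
      by (auto simp: P_def intro: continuous_intros trig_poly_mult)
    show "\<exists>f. P f \<and> f x \<noteq> f y" if xy: "x \<in> K \<and> y \<in> K \<and> x \<noteq> y" for x y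
    proof -
      from xy obtain i where i: "x i \<noteq> y i" by auto
      with xy have im: "i < m" by (auto simp: K_def PiE_def Pi_def split: if_splits) (metis singletonD)
      have "trig_poly m (\<lambda>x. 1 * cos ((\<Sum>j<m. (if j = i then 1 / L else 0) * x j) + (- pi / 2)))"
        by (rule trig_poly.cos)
      also have "(\<lambda>x. 1 * cos ((\<Sum>j<m. (if j = i then 1 / L else 0) * x j) + (- pi / 2))) = (\<lambda>x. s x i)"
      proof
        fix x :: "nat \<Rightarrow> real"
        have "(\<Sum>j<m. (if j = i then 1 / L else 0) * x j) = (\<Sum>j<m. if j = i then x j / L else 0)"
          by (intro sum.cong) auto
        also have "\<dots> = x i / L" using im by simp
        finally show "1 * cos ((\<Sum>j<m. (if j = i then 1 / L else 0) * x j) + (- pi / 2)) = s x i"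
          using im by (simp add: s_def cos_diff)
      qed
      finally have "P (\<lambda>u. u i)"
        by (auto simp: P_def intro: continuous_on_subset[OF continuous_on_product_coordinates])
      then show ?thesis using i by blast
    qed
  qed (use F e in auto)
  then obtain g where g: "P g" "\<And>u. u \<in> K \<Longrightarrow> \<bar>F u - g u\<bar> < e" by blast
  have "\<bar>g (s x) - f (\<lambda>j\<in>{..<m}. L * arcsin (sin (x j / L)))\<bar> < e" for x
  proof -
    have "F (s x) = f (\<lambda>j\<in>{..<m}. L * arcsin (sin (x j / L)))"
      unfolding F_def by (rule arg_cong[where f = f]) (auto simp: s_def)
    then show ?thesis using g(2)[OF sK[of x]] by (simp add: abs_minus_commute)
  qed
  then show ?thesis using g(1) by (auto simp: P_def intro!: exI[of _ "\<lambda>x. g (s x)"])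
qed

text \<open>Inside the cube \<open>\<bar>x j\<bar> \<le> L\<close> the map
  \<open>L * arcsin (sin (x j / L))\<close> is the identity, because \<open>1 \<le> pi / 2\<close>.
  Outside, the value of \<open>f\<close> changes by at most \<open>2 * B\<close> while the sum of
  the \<open>(x j)\<^sup>2\<close> is at least \<open>L\<^sup>2\<close>: Chebyshev's inequality,
  used pointwise.\<close>

lemma integral_trig_poly_error:
  fixes f h :: "(nat \<Rightarrow> real) \<Rightarrow> real"
  assumes \<mu>: "prob_space \<mu>" "sets \<mu> = sets (vec_borel m)"
    and sq: "\<And>j. j < m \<Longrightarrow> integrable \<mu> (\<lambda>x. (x j)\<^sup>2)" "\<And>j. j < m \<Longrightarrow> (\<integral>x. (x j)\<^sup>2 \<partial>\<mu>) \<le> C"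
    and f: "continuous_map (vec_topology m) euclideanreal f"
    and B: "\<And>x. x \<in> topspace (vec_topology m) \<Longrightarrow> \<bar>f x\<bar> \<le> B"
    and h: "trig_poly m h" "\<And>x. \<bar>h x - f (\<lambda>j\<in>{..<m}. L * arcsin (sin (x j / L)))\<bar> < e" and L: "L > 0"
  shows "\<bar>integral\<^sup>L \<mu> f - integral\<^sup>L \<mu> h\<bar> \<le> e + 2 * B * real m * C / L\<^sup>2"
proof -
  interpret prob_space \<mu> by fact
  have sp: "space \<mu> = topspace (vec_topology m)"
    using sets_eq_imp_space_eq[OF \<mu>(2)] by (simp add: space_PiM)
  have B0: "B \<ge> 0" using B[of "\<lambda>j\<in>{..<m}. 0"] by auto
  have fm: "f \<in> borel_measurable \<mu>"
    using borel_measurable_vec[OF f] measurable_cong_sets[OF \<mu>(2) refl] by blast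
  have fi: "integrable \<mu> f"
    using B fm by (intro integrable_const_bound[where B = B]) (auto simp: sp)
  have hi: "integrable \<mu> h" by (rule trig_poly_integrable[OF \<mu> h(1)])
  have pw: "\<bar>f x - h x\<bar> \<le> e + 2 * B * (\<Sum>j<m. (x j)\<^sup>2) / L\<^sup>2" if x: "x \<in> space \<mu>" for x
  proof -
    define y where "y = (\<lambda>j\<in>{..<m}. L * arcsin (sin (x j / L)))"
    have yt: "y \<in> topspace (vec_topology m)" by (simp add: y_def)
    have hy: "\<bar>h x - f y\<bar> < e" using h(2)[of x] by (simp add: y_def)
    have "\<bar>f x - f y\<bar> \<le> 2 * B * (\<Sum>j<m. (x j)\<^sup>2) / L\<^sup>2"
    proof (cases "\<forall>j<m. \<bar>x j\<bar> \<le> L")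
      case True
      have "L * arcsin (sin (x j / L)) = x j" if "j < m" for j
      proof -
        have "\<bar>x j / L\<bar> \<le> 1" using True that L by (simp add: abs_divide)
        then have "\<bar>x j / L\<bar> \<le> pi / 2" using pi_ge_two by linarith
        then have "- (pi / 2) \<le> x j / L" "x j / L \<le> pi / 2" by linarith+
        then show ?thesis using L by (simp add: arcsin_sin)
      qed
      then have "y = x" using x by (auto simp: y_def sp PiE_def extensional_def)
      then show ?thesis using B0 by (simp add: sum_nonneg)
    next
      case False
      then obtain j where j: "j < m" "\<bar>x j\<bar> > L" by (auto simp: not_le)
      then have "L\<^sup>2 \<le> (x j)\<^sup>2" using L by (metis abs_of_pos less_imp_le power2_abs power_mono)
      also have "(x j)\<^sup>2 \<le> (\<Sum>j<m. (x j)\<^sup>2)" using j by (intro member_le_sum) auto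
      finally have "1 \<le> (\<Sum>j<m. (x j)\<^sup>2) / L\<^sup>2" using L by simp
      then have "2 * B * 1 \<le> 2 * B * ((\<Sum>j<m. (x j)\<^sup>2) / L\<^sup>2)" using B0 by (intro mult_left_mono) auto
      then show ?thesis using B[of x] B[OF yt] x sp by auto
    qed
    then show ?thesis using hy by linarith
  qed
  have "\<bar>integral\<^sup>L \<mu> f - integral\<^sup>L \<mu> h\<bar> = \<bar>\<integral>x. f x - h x \<partial>\<mu>\<bar>"
    using fi hi by simp
  also have "\<dots> \<le> (\<integral>x. \<bar>f x - h x\<bar> \<partial>\<mu>)" by (rule integral_abs_bound)
  also have "\<dots> \<le> (\<integral>x. e + 2 * B * (\<Sum>j<m. (x j)\<^sup>2) / L\<^sup>2 \<partial>\<mu>)"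
    using fi hi pw
    by (intro integral_mono Bochner_Integration.integrable_add integrable_divide integrable_mult_right
        Bochner_Integration.integrable_sum sq(1)) auto
  also have "\<dots> = e + 2 * B * (\<integral>x. (\<Sum>j<m. (x j)\<^sup>2) \<partial>\<mu>) / L\<^sup>2"
  proof -
    have "integrable \<mu> (\<lambda>x. \<Sum>j<m. (x j)\<^sup>2)"
      using sq(1) by (intro Bochner_Integration.integrable_sum) auto
    then show ?thesis by (simp add: prob_space)
  qed
  also have "(\<integral>x. (\<Sum>j<m. (x j)\<^sup>2) \<partial>\<mu>) = (\<Sum>j<m. (\<integral>x. (x j)\<^sup>2 \<partial>\<mu>))"
    using sq(1) by (intro Bochner_Integration.integral_sum) auto
  also have "e + 2 * B * (\<Sum>j<m. (\<integral>x. (x j)\<^sup>2 \<partial>\<mu>)) / L\<^sup>2 \<le> e + 2 * B * (real m * C) / L\<^sup>2"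
  proof -
    have "(\<Sum>j<m. (\<integral>x. (x j)\<^sup>2 \<partial>\<mu>)) \<le> (\<Sum>j<m. C)" using sq(2) by (intro sum_mono) auto
    then show ?thesis using B0 by (intro add_left_mono divide_right_mono mult_left_mono) auto
  qed
  finally show ?thesis by (simp add: mult_ac)
qed

text \<open>With bounded second moments, convergence of characteristic functions is enough: the cube
  is chosen first, by tightness, then the trigonometric polynomial on it, and only then
  \<open>n\<close>. The bound is asked from \<open>N\<close> on because a normalisation such as
  \<open>sqrt (n * ln n)\<close> vanishes for small \<open>n\<close>.\<close>

lemma weak_conv_vecI:
  fixes \<mu> :: "nat \<Rightarrow> (nat \<Rightarrow> real) measure"
  assumes \<mu>: "\<And>n. prob_space (\<mu> n)" "\<And>n. sets (\<mu> n) = sets (vec_borel m)"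
    and \<nu>: "prob_space \<nu>" "sets \<nu> = sets (vec_borel m)"
    and sq: "\<And>n j. j < m \<Longrightarrow> integrable (\<mu> n) (\<lambda>x. (x j)\<^sup>2)"
        "\<And>n j. n \<ge> N \<Longrightarrow> j < m \<Longrightarrow> (\<integral>x. (x j)\<^sup>2 \<partial>\<mu> n) \<le> C"
    and sq': "\<And>j. j < m \<Longrightarrow> integrable \<nu> (\<lambda>x. (x j)\<^sup>2)" "\<And>j. j < m \<Longrightarrow> (\<integral>x. (x j)\<^sup>2 \<partial>\<nu>) \<le> C"
    and conv: "\<And>t \<theta>. (\<lambda>n. \<integral>x. cos ((\<Sum>j<m. t j * x j) + \<theta>) \<partial>\<mu> n) \<longlonglongrightarrow> (\<integral>x. cos ((\<Sum>j<m. t j * x j) + \<theta>) \<partial>\<nu>)"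
  shows "weak_conv_vec m \<mu> \<nu>"
  unfolding weak_conv_vec_def
proof (intro allI impI)
  fix f assume f: "continuous_map (vec_topology m) euclideanreal f \<and> bounded (f ` topspace (vec_topology m))"
  then have "bounded (f ` topspace (vec_topology m))" by blast
  then obtain B where B: "\<And>x. x \<in> topspace (vec_topology m) \<Longrightarrow> \<bar>f x\<bar> \<le> B"
    unfolding bounded_iff by auto
  show "(\<lambda>n. integral\<^sup>L (\<mu> n) f) \<longlonglongrightarrow> integral\<^sup>L \<nu> f"
  proof (rule LIMSEQ_I)
    fix r :: real assume r: "r > 0"
    have "((\<lambda>L. 2 * B * real m * C / L\<^sup>2) \<longlongrightarrow> 0) at_top" by real_asymp
    then have "eventually (\<lambda>L. 2 * B * real m * C / L\<^sup>2 < r / 6) at_top"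
      using r by (intro order_tendstoD(2)[where y = 0]) auto
    then obtain L where L: "2 * B * real m * C / L\<^sup>2 < r / 6" "L > 0"
      using eventually_happens[OF eventually_conj[OF _ eventually_gt_at_top[of 0]]] by force
    obtain h where h: "trig_poly m h" "\<And>x. \<bar>h x - f (\<lambda>j\<in>{..<m}. L * arcsin (sin (x j / L)))\<bar> < r / 6"
      using trig_poly_approx[of m f L "r / 6"] f L r by auto
    have 1: "\<bar>integral\<^sup>L (\<mu> n) f - integral\<^sup>L (\<mu> n) h\<bar> \<le> r / 6 + 2 * B * real m * C / L\<^sup>2" if "n \<ge> N" for n
      using f B h L sq that by (intro integral_trig_poly_error[OF \<mu>]) auto
    have 2: "\<bar>integral\<^sup>L \<nu> f - integral\<^sup>L \<nu> h\<bar> \<le> r / 6 + 2 * B * real m * C / L\<^sup>2"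
      using f B h L sq' by (intro integral_trig_poly_error[OF \<nu>]) auto
    have "(\<lambda>n. integral\<^sup>L (\<mu> n) h) \<longlonglongrightarrow> integral\<^sup>L \<nu> h"
      by (rule trig_poly_tendsto[OF \<mu> \<nu> conv h(1)])
    then obtain N' where N': "\<And>n. n \<ge> N' \<Longrightarrow> norm (integral\<^sup>L (\<mu> n) h - integral\<^sup>L \<nu> h) < r / 6"
      using LIMSEQ_D[of _ _ "r / 6"] r by force
    show "\<exists>no. \<forall>n\<ge>no. norm (integral\<^sup>L (\<mu> n) f - integral\<^sup>L \<nu> f) < r"
    proof (intro exI[of _ "max N N'"] allI impI)
      fix n assume "n \<ge> max N N'"
      then have n: "n \<ge> N" "n \<ge> N'" by auto
      show "norm (integral\<^sup>L (\<mu> n) f - integral\<^sup>L \<nu> f) < r"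
        using 1[OF n(1)] 2 N'[OF n(2)] L(1) unfolding real_norm_def by linarith
    qed
  qed
qed

section \<open>Gaussian vectors\<close>

text \<open>Scaling the standard normal covers \<sigma> = 0 as well, so that degenerate and proper
  normal laws share one characteristic function.\<close>

lemma normal_law_eq_distr:
  assumes "\<sigma> \<ge> 0"
  shows "normal_law 0 \<sigma> = distr std_normal_distribution borel (\<lambda>x. \<sigma> * x)"
proof -
  interpret N: prob_space std_normal_distribution
    by (rule real_distribution.axioms(1)[OF real_dist_normal_dist])
  show ?thesis
  proof (cases "\<sigma> = 0")
    case True
    have "distr std_normal_distribution borel (\<lambda>x. 0 :: real) = return borel 0"
      by (intro measure_eqI) (auto simp: emeasure_distr N.emeasure_space_1 indicator_def)
    then show ?thesis using True by (simp add: normal_law_def)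
  next
    case False
    have "distributed std_normal_distribution lborel (\<lambda>x. x) (normal_density 0 1)"
      by (auto simp: distributed_def emeasure_distr intro!: measure_eqI)
    from N.normal_density_affine[OF this, of \<sigma> 0] assms False
    have "distributed std_normal_distribution lborel (\<lambda>x. \<sigma> * x) (normal_density 0 \<sigma>)" by simp
    then have "distr std_normal_distribution lborel (\<lambda>x. \<sigma> * x) = density lborel (normal_density 0 \<sigma>)"
      by (simp add: distributed_def)
    then show ?thesis using False
      by (simp add: normal_law_def) (metis distr_cong sets_lborel)
  qed
qed

context
  fixes I :: "'i set"
  assumes I: "finite I"
begin

text \<open>The index type is left free because the limiting covariances are factorised over pairs
  of a frequency and a truth value.\<close>

definition std_gauss :: "('i \<Rightarrow> real) measure" where
  "std_gauss = Pi\<^sub>M I (\<lambda>_. std_normal_distribution)"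

lemma sets_std_gauss [measurable_cong]: "sets std_gauss = sets (Pi\<^sub>M I (\<lambda>_. borel))"
  unfolding std_gauss_def by (intro sets_PiM_cong) auto

lemma prob_space_std_gauss: "prob_space std_gauss"
  unfolding std_gauss_def
  by (intro prob_space_PiM real_distribution.axioms(1)[OF real_dist_normal_dist])

lemma product_sigma_finite_std_normal: "product_sigma_finite (\<lambda>_::'i. std_normal_distribution)"
  by (intro product_sigma_finite.intro prob_space_imp_sigma_finite real_distribution.axioms(1)[OF real_dist_normal_dist])

lemma char_std_gauss:
  "(\<integral>g. exp (\<i> * of_real (\<Sum>k\<in>I. a k * g k)) \<partial>std_gauss) = of_real (exp (- (\<Sum>k\<in>I. (a k)\<^sup>2) / 2))"
proof -
  interpret N: real_distribution std_normal_distribution by (rule real_dist_normal_dist)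
  have "(\<integral>g. exp (\<i> * of_real (\<Sum>k\<in>I. a k * g k)) \<partial>std_gauss)
     = (\<integral>g. (\<Prod>k\<in>I. iexp (a k * g k)) \<partial>std_gauss)"
    using I by (simp add: sum_distrib_left exp_sum)
  also have "\<dots> = (\<Prod>k\<in>I. (\<integral>x. iexp (a k * x) \<partial>std_normal_distribution))"
    unfolding std_gauss_def
  proof (rule product_sigma_finite.product_integral_prod[OF product_sigma_finite_std_normal I])
    show "complex_integrable std_normal_distribution (\<lambda>x. iexp (a i * x))" for i
      by (rule N.integrable_iexp) auto
  qed
  also have "\<dots> = (\<Prod>k\<in>I. of_real (exp (- (a k)\<^sup>2 / 2)))"
    using char_std_normal_distribution by (simp add: char_def fun_eq_iff)
  also have "\<dots> = of_real (exp (- (\<Sum>k\<in>I. (a k)\<^sup>2) / 2))"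
    using I by (simp add: exp_sum[symmetric] sum_negf sum_divide_distrib flip: of_real_prod)
  finally show ?thesis .
qed

lemma std_gauss_moments:
  assumes k: "k \<in> I" and l: "l \<in> I"
  shows "integrable std_gauss (\<lambda>g. g k)" "(\<integral>g. g k \<partial>std_gauss) = 0"
    and "integrable std_gauss (\<lambda>g. g k * g l)" "(\<integral>g. g k * g l \<partial>std_gauss) = (if k = l then 1 else 0)"
proof -
  have int: "integrable std_normal_distribution (\<lambda>x. x ^ j)" for j :: nat
    using integrable_std_normal_moment[of j] by (subst integrable_density) auto
  have m0: "(\<integral>x. x ^ 0 \<partial>std_normal_distribution) = (1 :: real)"
    using integral_std_normal_moment_even[of 0] by (subst integral_density) auto
  have m1: "(\<integral>x. x ^ 1 \<partial>std_normal_distribution) = (0 :: real)"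
    using integral_std_normal_moment_odd[of 0] by (subst integral_density) auto
  have m2: "(\<integral>x. x ^ 2 \<partial>std_normal_distribution) = (1 :: real)"
    using integral_std_normal_moment_even[of 1] by (subst integral_density) auto
  note P = product_sigma_finite.product_integral_prod[OF product_sigma_finite_std_normal I, of "\<lambda>i x. x ^ e i" for e]
    and Q = product_sigma_finite.product_integrable_prod[OF product_sigma_finite_std_normal I, of "\<lambda>i x. x ^ e i" for e]
  \<comment> \<open>One coordinate, and below a product of two, is written as a product over all of
    \<open>I\<close> with exponents 0, 1 or 2, the form for which the integral factorises.\<close>
  have 1: "(\<Prod>i\<in>I. g i ^ (of_bool (i = k) :: nat)) = g k" for g :: "'i \<Rightarrow> real"
  proof -
    have "(\<Prod>i\<in>I. g i ^ (of_bool (i = k) :: nat)) = (\<Prod>i\<in>I. if i = k then g i else 1)"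
      by (intro prod.cong) auto
    then show ?thesis using k I by simp
  qed
  have 2: "(\<Prod>i\<in>I. g i ^ (of_bool (i = k) + of_bool (i = l) :: nat)) = g k * g l" for g :: "'i \<Rightarrow> real"
  proof -
    have "(\<Prod>i\<in>I. g i ^ (of_bool (i = k) + of_bool (i = l) :: nat))
        = (\<Prod>i\<in>I. if i = k then g i else 1) * (\<Prod>i\<in>I. if i = l then g i else 1)"
      unfolding prod.distrib[symmetric] by (intro prod.cong) auto
    then show ?thesis using k l I by simp
  qed
  show "integrable std_gauss (\<lambda>g. g k)"
    using Q[OF int, of "\<lambda>i. of_bool (i = k)"] by (simp add: 1 std_gauss_def)
  show "integrable std_gauss (\<lambda>g. g k * g l)"
    using Q[OF int, of "\<lambda>i. of_bool (i = k) + of_bool (i = l)"] by (simp add: 2 std_gauss_def)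
  have "(\<integral>g. g k \<partial>std_gauss) = (\<Prod>i\<in>I. \<integral>x. x ^ (of_bool (i = k) :: nat) \<partial>std_normal_distribution)"
    using P[OF int, of "\<lambda>i. of_bool (i = k)"] by (simp add: 1 std_gauss_def)
  also have "\<dots> = 0" using k m1 I by (intro prod_zero bexI[of _ k]) auto
  finally show "(\<integral>g. g k \<partial>std_gauss) = 0" .
  have *: "(\<integral>g. g k * g l \<partial>std_gauss) = (\<Prod>i\<in>I. \<integral>x. x ^ (of_bool (i = k) + of_bool (i = l) :: nat) \<partial>std_normal_distribution)"
    using P[OF int, of "\<lambda>i. of_bool (i = k) + of_bool (i = l)"] by (simp add: 2 std_gauss_def)
  show "(\<integral>g. g k * g l \<partial>std_gauss) = (if k = l then 1 else 0)"
  proof (cases "k = l")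
    case True
    have "(\<integral>x. x ^ (of_bool (i = k) + of_bool (i = l) :: nat) \<partial>std_normal_distribution) = (1::real)" for i
      using True m0 m2 by (cases "i = k") (auto simp: numeral_2_eq_2)
    then show ?thesis unfolding * using True by simp
  next
    case False
    have "(\<Prod>i\<in>I. \<integral>x. x ^ (of_bool (i = k) + of_bool (i = l) :: nat) \<partial>std_normal_distribution) = (0::real)"
      using k m1 I False by (intro prod_zero bexI[of _ k]) auto
    then show ?thesis unfolding * using False by simp
  qed
qed

text \<open>A linear image of a standard Gaussian vector also covers singular covariances; those of
  the theorem are singular, as the counts add up to \<open>n\<close>.\<close>

definition gauss_vec :: "nat \<Rightarrow> (nat \<Rightarrow> 'i \<Rightarrow> real) \<Rightarrow> (nat \<Rightarrow> real) measure" where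
  "gauss_vec m A = distr std_gauss (vec_borel m) (\<lambda>g. \<lambda>j\<in>{..<m}. \<Sum>k\<in>I. A j k * g k)"

lemma gauss_vec_measurable:
  "(\<lambda>g. \<lambda>j\<in>{..<m}. \<Sum>k\<in>I. A j k * g k) \<in> measurable std_gauss (vec_borel m)"
  by (intro measurable_restrict) (auto intro!: borel_measurable_sum borel_measurable_times measurable_compose[OF measurable_component_singleton] simp: measurable_cong_sets[OF sets_std_gauss refl])

lemma sets_gauss_vec: "sets (gauss_vec m A) = sets (vec_borel m)"
  by (simp add: gauss_vec_def)

lemma prob_space_gauss_vec: "prob_space (gauss_vec m A)"
  unfolding gauss_vec_def by (intro prob_space.prob_space_distr prob_space_std_gauss gauss_vec_measurable)

lemma vec_linear_measurable: "(\<lambda>x. \<Sum>i<m. t i * x i) \<in> borel_measurable (vec_borel m)"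
  by (auto intro!: borel_measurable_sum borel_measurable_times measurable_component_singleton)

lemma gauss_vec_linear:
  fixes t :: "nat \<Rightarrow> real" and A :: "nat \<Rightarrow> 'i \<Rightarrow> real" and g :: "'i \<Rightarrow> real"
  shows "(\<Sum>i<m. t i * (\<lambda>j\<in>{..<m}. \<Sum>k\<in>I. A j k * g k) i) = (\<Sum>k\<in>I. (\<Sum>i<m. t i * A i k) * g k)"
proof -
  have 1: "t i * (\<Sum>k\<in>I. A i k * g k) = (\<Sum>k\<in>I. t i * A i k * g k)" for i
    by (subst sum_distrib_left) (simp only: mult.assoc)
  have "(\<Sum>i<m. t i * (\<lambda>j\<in>{..<m}. \<Sum>k\<in>I. A j k * g k) i) = (\<Sum>i<m. \<Sum>k\<in>I. t i * A i k * g k)"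
    by (intro sum.cong refl) (simp add: 1)
  also have "\<dots> = (\<Sum>k\<in>I. \<Sum>i<m. t i * A i k * g k)" by (rule sum.swap)
  finally show ?thesis by (simp add: sum_distrib_right)
qed

lemma char_gauss_vec:
  "(\<integral>x. exp (\<i> * of_real (\<Sum>i<m. t i * x i)) \<partial>gauss_vec m A) = of_real (exp (- (\<Sum>k\<in>I. (\<Sum>i<m. t i * A i k)\<^sup>2) / 2))"
proof -
  have "(\<lambda>x. exp (\<i> * of_real (\<Sum>i<m. t i * x i))) \<in> borel_measurable (vec_borel m)"
    using vec_linear_measurable[where m = m and t = t] by measurable
  then show ?thesis
    unfolding gauss_vec_def
    by (subst integral_distr[OF gauss_vec_measurable]) (simp_all only: gauss_vec_linear char_std_gauss)
qed

lemma distr_gauss_vec_linear: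
  "distr (gauss_vec m A) borel (\<lambda>x. \<Sum>i<m. t i * x i) = normal_law 0 (sqrt (\<Sum>k\<in>I. (\<Sum>i<m. t i * A i k)\<^sup>2))"
proof -
  define V where "V = (\<Sum>k\<in>I. (\<Sum>i<m. t i * A i k)\<^sup>2)"
  have V: "V \<ge> 0" by (simp add: V_def sum_nonneg)
  interpret G: prob_space "gauss_vec m A" by (rule prob_space_gauss_vec)
  interpret N: real_distribution std_normal_distribution by (rule real_dist_normal_dist)
  have lin: "(\<lambda>x. \<Sum>i<m. t i * x i) \<in> borel_measurable (gauss_vec m A)"
    using vec_linear_measurable measurable_cong_sets[OF sets_gauss_vec refl] by blast
  show ?thesis
    unfolding V_def[symmetric] normal_law_eq_distr[OF real_sqrt_ge_zero[OF V]]
  proof (rule Levy_uniqueness)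
    show "real_distribution (distr (gauss_vec m A) borel (\<lambda>x. \<Sum>i<m. t i * x i))"
      using lin by (rule G.real_distribution_distr)
    show "real_distribution (distr std_normal_distribution borel ((*) (sqrt V)))"
      by (rule N.real_distribution_distr) auto
    show "char (distr (gauss_vec m A) borel (\<lambda>x. \<Sum>i<m. t i * x i)) = char (distr std_normal_distribution borel ((*) (sqrt V)))"
    proof
      fix s
      have "char (distr (gauss_vec m A) borel (\<lambda>x. \<Sum>i<m. t i * x i)) s = (\<integral>x. exp (\<i> * of_real (\<Sum>i<m. (s * t i) * x i)) \<partial>gauss_vec m A)"
        unfolding char_def by (subst integral_distr[OF lin]) (auto simp: sum_distrib_left mult_ac)
      also have "\<dots> = of_real (exp (- (s\<^sup>2 * V) / 2))"
        unfolding char_gauss_vec V_def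
        by (simp add: sum_distrib_left[symmetric] mult.assoc power_mult_distrib)
      also have "\<dots> = char std_normal_distribution (s * sqrt V)"
        using V by (simp add: char_std_normal_distribution power_mult_distrib)
      also have "\<dots> = char (distr std_normal_distribution borel ((*) (sqrt V))) s"
        unfolding char_def by (subst integral_distr) (auto simp: mult_ac)
      finally show "char (distr (gauss_vec m A) borel (\<lambda>x. \<Sum>i<m. t i * x i)) s = char (distr std_normal_distribution borel ((*) (sqrt V))) s" .
    qed
  qed
qed

lemma gauss_vec_moments:
  assumes i: "i < m" and j: "j < m"
  shows "(\<integral>x. x i \<partial>gauss_vec m A) = 0"
    and "integrable (gauss_vec m A) (\<lambda>x. x i * x j)"
    and "(\<integral>x. x i * x j \<partial>gauss_vec m A) = (\<Sum>k\<in>I. A i k * A j k)"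
proof -
  have c: "(\<lambda>x. x i) \<in> borel_measurable (vec_borel m)" if "i < m" for i
    using that by (intro measurable_component_singleton) auto
  have "(\<integral>x. x i \<partial>gauss_vec m A) = (\<integral>g. (\<Sum>k\<in>I. A i k * g k) \<partial>std_gauss)"
    unfolding gauss_vec_def using i by (subst integral_distr[OF gauss_vec_measurable c[OF i]]) simp
  also have "\<dots> = 0" using std_gauss_moments(1,2) by (subst Bochner_Integration.integral_sum) auto
  finally show "(\<integral>x. x i \<partial>gauss_vec m A) = 0" .
  have e: "(\<Sum>k\<in>I. A i k * g k) * (\<Sum>l\<in>I. A j l * g l) = (\<Sum>k\<in>I. \<Sum>l\<in>I. A i k * A j l * (g k * g l))" for g
    by (simp add: sum_product mult_ac)
  have cc: "(\<lambda>x. x i * x j) \<in> borel_measurable (vec_borel m)" using c[OF i] c[OF j] by measurable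
  have int: "integrable std_gauss (\<lambda>g. \<Sum>k\<in>I. \<Sum>l\<in>I. A i k * A j l * (g k * g l))"
    using std_gauss_moments(3) by (intro Bochner_Integration.integrable_sum integrable_mult_right) auto
  show "integrable (gauss_vec m A) (\<lambda>x. x i * x j)"
    unfolding gauss_vec_def using i j int
    by (subst integrable_distr_eq[OF gauss_vec_measurable cc]) (simp add: e)
  have "(\<integral>x. x i * x j \<partial>gauss_vec m A) = (\<integral>g. (\<Sum>k\<in>I. \<Sum>l\<in>I. A i k * A j l * (g k * g l)) \<partial>std_gauss)"
    unfolding gauss_vec_def using i j by (subst integral_distr[OF gauss_vec_measurable cc]) (simp add: e)
  also have "\<dots> = (\<Sum>k\<in>I. \<Sum>l\<in>I. A i k * A j l * (if k = l then 1 else 0))"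
    using std_gauss_moments(3,4) by (simp add: Bochner_Integration.integral_sum integrable_mult_right Bochner_Integration.integrable_sum)
  also have "\<dots> = (\<Sum>k\<in>I. A i k * A j k)"
    using I by (intro sum.cong refl) (simp add: mult_if_delta if_distrib cong: if_cong)
  finally show "(\<integral>x. x i * x j \<partial>gauss_vec m A) = (\<Sum>k\<in>I. A i k * A j k)" .
qed

lemma mv_normal_gauss_vec:
  assumes "\<And>i j. i < m \<Longrightarrow> j < m \<Longrightarrow> S i j = (\<Sum>k\<in>I. A i k * A j k)"
  shows "mv_normal m (\<lambda>_. 0) S (gauss_vec m A)"
  unfolding mv_normal_def
proof (intro conjI allI impI)
  fix t :: "nat \<Rightarrow> real"
  show "\<exists>b. \<exists>\<sigma>\<ge>0. distr (gauss_vec m A) borel (\<lambda>x. \<Sum>i<m. t i * x i) = normal_law b \<sigma>"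
    by (intro exI[of _ 0] exI[of _ "sqrt (\<Sum>k\<in>I. (\<Sum>i<m. t i * A i k)\<^sup>2)"] conjI distr_gauss_vec_linear)
      (simp add: sum_nonneg)
qed (use assms in \<open>auto simp: prob_space_gauss_vec sets_gauss_vec gauss_vec_moments\<close>)

end

section \<open>Characteristic functions of weighted counts\<close>

lemma sum_level_periodic:
  fixes F :: "nat \<Rightarrow> real"
  assumes m: "m > 0" and F: "\<And>j. F j = F (j mod m)"
  shows "(\<Sum>v<l. F (level p v)) = (\<Sum>j<m. level_count m p l j * F j)"
proof -
  have "(\<Sum>j<m. level_count m p l j * F j) = (\<Sum>v<l. \<Sum>j<m. of_bool (level p v mod m = j) * F j)"
    unfolding level_count_def sum_distrib_right by (rule sum.swap)
  also have "\<dots> = (\<Sum>v<l. F (level p v))"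
  proof (intro sum.cong refl)
    fix v
    have "(\<Sum>j<m. of_bool (level p v mod m = j) * F j) = (\<Sum>j<m. if level p v mod m = j then F j else 0)"
      by (intro sum.cong) auto
    also have "\<dots> = F (level p v mod m)" using m by simp
    finally show "(\<Sum>j<m. of_bool (level p v mod m = j) * F j) = F (level p v)" using F by metis
  qed
  finally show ?thesis ..
qed

lemma sum_shift_periodic:
  fixes F :: "nat \<Rightarrow> real"
  assumes m: "m > 0" and F: "\<And>j. F j = F (j mod m)"
  shows "(\<Sum>j<m. F (Suc j)) = (\<Sum>j<m. F j)"
proof -
  have "(\<Sum>j<m. F (Suc j)) + F 0 = (\<Sum>j<Suc m. F j)"
    by (subst sum.lessThan_Suc_shift) simp
  also have "\<dots> = (\<Sum>j<m. F j) + F 0" using F[of m] by simp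
  finally show ?thesis by simp
qed

text \<open>The conditional moments of a step are averages of periodic functions of the level, so
  this quantity controls their distance from constants.\<close>

definition count_deviation :: "nat \<Rightarrow> (nat \<Rightarrow> nat) \<Rightarrow> nat \<Rightarrow> real" where
  "count_deviation m p l = (\<Sum>j<m. \<bar>level_count m p l j / real l - 1 / real m\<bar>)"

lemma past_count_deviation: "past n (\<lambda>p. count_deviation m p n)"
  unfolding count_deviation_def
proof (rule past_sum)
  fix j
  show "past n (\<lambda>p. \<bar>level_count m p n j / real n - 1 / real m\<bar>)"
    by (rule past_comp[where h = "\<lambda>x. \<bar>x / real n - 1 / real m\<bar>", OF past_level_count])
qed

lemma average_periodic_deviation:
  fixes F :: "nat \<Rightarrow> real"
  assumes m: "m > 0" and F: "\<And>j. F j = F (j mod m)" and B: "\<And>j. \<bar>F j\<bar> \<le> B"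
  shows "\<bar>(\<Sum>v<l. F (level p v)) / real l - (\<Sum>j<m. F j) / real m\<bar> \<le> B * count_deviation m p l"
proof -
  have "(\<Sum>v<l. F (level p v)) / real l - (\<Sum>j<m. F j) / real m
     = (\<Sum>j<m. (level_count m p l j / real l - 1 / real m) * F j)"
    unfolding sum_level_periodic[where F = F, OF m F]
    by (simp add: sum_divide_distrib sum_subtractf[symmetric] left_diff_distrib)
  also have "\<bar>\<dots>\<bar> \<le> (\<Sum>j<m. \<bar>(level_count m p l j / real l - 1 / real m) * F j\<bar>)" by (rule sum_abs)
  also have "\<dots> \<le> (\<Sum>j<m. B * \<bar>level_count m p l j / real l - 1 / real m\<bar>)"
    unfolding abs_mult using B by (intro sum_mono) (metis abs_ge_zero mult.commute mult_right_mono)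
  finally show ?thesis by (simp add: count_deviation_def sum_distrib_left)
qed

text \<open>Second order expansion of a step with mean zero. The Taylor remainder is
  \<open>(2 * b) ^ 3 / 6\<close>, the gap between \<open>1 - s / 2\<close> and
  \<open>exp (- s / 2)\<close> is at most \<open>b ^ 4 / 8\<close>, and \<open>e / 2\<close>
  accounts for the distance of the actual variance from \<open>s\<close>.\<close>

lemma exp_average_error:
  fixes d :: "nat \<Rightarrow> real"
  assumes l: "l \<ge> 1" and sum0: "(\<Sum>v<l. d v) = 0" and d: "\<And>v. v < l \<Longrightarrow> \<bar>d v\<bar> \<le> 2 * b"
    and q: "\<bar>(\<Sum>v<l. (d v)\<^sup>2) / real l - s\<bar> \<le> e" and s: "0 \<le> s" "s \<le> b\<^sup>2" and b: "b \<ge> 0"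
  shows "cmod ((\<Sum>v<l. iexp (d v)) / of_nat l - of_real (exp (- s / 2))) \<le> 4 / 3 * b ^ 3 + b ^ 4 / 8 + e / 2"
proof -
  define q where "q = (\<Sum>v<l. (d v)\<^sup>2) / real l"
  have tay: "cmod (iexp (d v) - (1 + \<i> * of_real (d v) - of_real ((d v)\<^sup>2) / 2)) \<le> 4 / 3 * b ^ 3" if v: "v < l" for v
  proof -
    have "cmod (iexp (d v) - (\<Sum>k\<le>2. (\<i> * of_real (d v)) ^ k / fact k)) \<le> \<bar>d v\<bar> ^ 3 / fact 3"
      using iexp_approx1[of "d v" 2] by (simp add: eval_nat_numeral)
    also have "(\<Sum>k\<le>2. (\<i> * of_real (d v)) ^ k / fact k) = 1 + \<i> * of_real (d v) - of_real ((d v)\<^sup>2) / 2"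
      by (simp add: numeral_2_eq_2 power2_eq_square algebra_simps)
    also have "\<bar>d v\<bar> ^ 3 / fact 3 \<le> (2 * b) ^ 3 / fact 3"
      using d[OF v] by (intro divide_right_mono power_mono) auto
    finally show ?thesis by (simp add: fact_numeral power_mult_distrib)
  qed
  have "(\<Sum>v<l. 1 + \<i> * of_real (d v) - of_real ((d v)\<^sup>2) / 2) = of_nat l + \<i> * of_real (\<Sum>v<l. d v) - of_real (\<Sum>v<l. (d v)\<^sup>2) / 2"
    by (simp add: sum.distrib sum_subtractf sum_distrib_left sum_divide_distrib)
  also have "\<dots> = of_nat l * of_real (1 - q / 2)"
    using sum0 l by (simp add: q_def algebra_simps)
  finally have sumt: "(\<Sum>v<l. 1 + \<i> * of_real (d v) - of_real ((d v)\<^sup>2) / 2) = of_nat l * of_real (1 - q / 2)" .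
  have "(\<Sum>v<l. iexp (d v)) / of_nat l - of_real (1 - q / 2)
     = (\<Sum>v<l. iexp (d v) - (1 + \<i> * of_real (d v) - of_real ((d v)\<^sup>2) / 2)) / of_nat l"
    unfolding sum_subtractf[of "\<lambda>v. iexp (d v)"] sumt using l by (simp add: diff_divide_distrib)
  also have "cmod \<dots> \<le> (\<Sum>v<l. 4 / 3 * b ^ 3) / real l"
    unfolding norm_divide norm_of_nat using tay by (intro divide_right_mono order_trans[OF norm_sum] sum_mono) auto
  also have "\<dots> = 4 / 3 * b ^ 3" using l by simp
  finally have 1: "cmod ((\<Sum>v<l. iexp (d v)) / of_nat l - of_real (1 - q / 2)) \<le> 4 / 3 * b ^ 3" .
  have 2: "cmod (of_real (1 - q / 2) - of_real (1 - s / 2)) \<le> e / 2"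
  proof -
    have "\<bar>(1 - q / 2) - (1 - s / 2)\<bar> \<le> e / 2" using q unfolding q_def[symmetric] by linarith
    then show ?thesis unfolding of_real_diff[symmetric] norm_of_real .
  qed
  have "\<bar>exp (- (s / 2)) - (1 - s / 2)\<bar> \<le> (s / 2)\<^sup>2 / 2"
  proof -
    have "exp (- x) \<le> 1 - x + x\<^sup>2 / 2" if x: "x \<ge> 0" for x :: real
    proof -
      have "(\<lambda>x. 1 - x + x\<^sup>2 / 2 - exp (- x)) 0 \<le> (\<lambda>x. 1 - x + x\<^sup>2 / 2 - exp (- x)) x"
      proof (rule DERIV_nonneg_imp_nondecreasing[OF x])
        fix y :: real assume "0 \<le> y"
        have "((\<lambda>x. 1 - x + x\<^sup>2 / 2 - exp (- x)) has_real_derivative (y - 1 + exp (- y))) (at y)"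
          by (auto intro!: derivative_eq_intros)
        moreover have "y - 1 + exp (- y) \<ge> 0" using exp_ge_add_one_self[of "- y"] by simp
        ultimately show "\<exists>z. ((\<lambda>x. 1 - x + x\<^sup>2 / 2 - exp (- x)) has_real_derivative z) (at y) \<and> 0 \<le> z" by blast
      qed
      then show ?thesis by simp
    qed
    from this[of "s / 2"] exp_ge_add_one_self[of "- (s / 2)"] s show ?thesis by (simp add: abs_le_iff)
  qed
  also have "(s / 2)\<^sup>2 / 2 = s\<^sup>2 / 8" by (simp add: power_divide)
  also have "s\<^sup>2 / 8 \<le> b ^ 4 / 8"
    using power_mono[OF s(2) s(1), of 2] by (simp add: power_mult[symmetric])
  finally have 3: "cmod (of_real (1 - s / 2) - of_real (exp (- s / 2))) \<le> b ^ 4 / 8"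
    unfolding of_real_diff[symmetric] norm_of_real by (simp add: abs_minus_commute)
  have "(\<Sum>v<l. iexp (d v)) / of_nat l - of_real (exp (- s / 2))
     = ((\<Sum>v<l. iexp (d v)) / of_nat l - of_real (1 - q / 2)) + (of_real (1 - q / 2) - of_real (1 - s / 2)) + (of_real (1 - s / 2) - of_real (exp (- s / 2)))"
    by simp
  also have "cmod \<dots> \<le> 4 / 3 * b ^ 3 + e / 2 + b ^ 4 / 8"
    by (intro norm_triangle_le add_mono 1 2 3)
  finally show ?thesis by simp
qed

definition weighted_sum :: "(nat \<Rightarrow> nat \<Rightarrow> real) \<Rightarrow> nat \<Rightarrow> (nat \<Rightarrow> nat) \<Rightarrow> real" where
  "weighted_sum w l p = (\<Sum>v<l. w l (level p v))"

lemma past_weighted_sum: "past l (weighted_sum w l)"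
  unfolding weighted_sum_def
proof (rule past_sum)
  fix v assume "v \<in> {..<l}"
  then show "past l (\<lambda>p. w l (level p v))"
    by (intro past_comp[where h = "w l", OF past_level]) simp
qed

section \<open>Step by step comparison with Gaussian characteristic functions\<close>

context random_recursive_tree
begin

text \<open>\<open>rec\<close> says exactly that \<open>weighted_sum w l\<close> is the conditional
  mean of \<open>weighted_sum w (Suc l)\<close>. The increment is the weight of the new vertex minus
  its mean \<open>a\<close>. Its variance is close to the mean \<open>s\<close> of the squared
  weights over a period, because the proportions are nearly uniform and \<open>mean\<close> makes
  \<open>a\<close> small.\<close>

lemma weighted_sum_char_step:
  fixes w :: "nat \<Rightarrow> nat \<Rightarrow> real"
  assumes m: "m > 0" and l: "l \<ge> 1"
    and rec: "\<And>j. w l j = w (Suc l) j + w (Suc l) (Suc j) / real l"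
    and per: "\<And>j. w (Suc l) j = w (Suc l) (j mod m)"
    and mean: "(\<Sum>j<m. w (Suc l) j) = 0"
    and bound: "\<And>j. \<bar>w (Suc l) j\<bar> \<le> b"
  shows "cmod ((\<integral>\<omega>. iexp (weighted_sum w (Suc l) (\<lambda>k. parent k \<omega>)) \<partial>M)
       - of_real (exp (- ((\<Sum>j<m. (w (Suc l) j)\<^sup>2) / real m) / 2)) * (\<integral>\<omega>. iexp (weighted_sum w l (\<lambda>k. parent k \<omega>)) \<partial>M))
     \<le> 4 / 3 * b ^ 3 + b ^ 4 / 8 + b\<^sup>2 * (\<integral>\<omega>. count_deviation m (\<lambda>k. parent k \<omega>) l \<partial>M)"
proof -
  let ?P = "\<lambda>\<omega> k. parent k \<omega>"
  \<comment> \<open>Weight of a child of a vertex at level \<open>j\<close>, hence the shift by one;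
    sums over a full period do not notice it.\<close>
  define F where "F j = w (Suc l) (Suc j)" for j
  define s where "s = (\<Sum>j<m. (w (Suc l) j)\<^sup>2) / real m"
  have b: "b \<ge> 0" using bound[of 0] by linarith
  have perF: "F j = F (j mod m)" for j
    unfolding F_def by (metis per mod_Suc_eq)
  have meanF: "(\<Sum>j<m. F j) = 0"
    unfolding F_def using sum_shift_periodic[OF m, of "w (Suc l)"] per mean by simp
  have sF: "(\<Sum>j<m. (F j)\<^sup>2) / real m = s"
    unfolding F_def s_def using sum_shift_periodic[OF m, of "\<lambda>j. (w (Suc l) j)\<^sup>2"] per by simp
  have Fb: "\<bar>F j\<bar> \<le> b" for j using bound by (simp add: F_def)
  have F2: "(F j)\<^sup>2 \<le> b\<^sup>2" for j using power_mono[OF Fb[of j], of 2] by simp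
  have "s \<le> (\<Sum>j<m. b\<^sup>2) / real m"
    unfolding sF[symmetric] using F2 by (intro divide_right_mono sum_mono) auto
  then have s: "0 \<le> s" "s \<le> b\<^sup>2" using m by (auto simp: s_def sum_nonneg)
  have pw: "cmod ((\<Sum>v<l. iexp (weighted_sum w (Suc l) (p(l := v)))) / of_nat l - of_real (exp (- s / 2)) * iexp (weighted_sum w l p))
      \<le> 4 / 3 * b ^ 3 + b ^ 4 / 8 + b\<^sup>2 * count_deviation m p l" for p
  proof -
    define a where "a = (\<Sum>v<l. F (level p v)) / real l"
    define d where "d v = F (level p v) - a" for v
    have "weighted_sum w (Suc l) (p(l := v)) = weighted_sum w l p + d v" if v: "v < l" for v
    proof -
      have "weighted_sum w (Suc l) (p(l := v)) = (\<Sum>u<l. w (Suc l) (level p u)) + F (level p v)"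
        using l v by (simp add: weighted_sum_def F_def level_upd level_upd_less)
      moreover have "weighted_sum w l p = (\<Sum>u<l. w (Suc l) (level p u)) + a"
        unfolding weighted_sum_def a_def F_def by (simp add: rec sum.distrib sum_divide_distrib)
      ultimately show ?thesis by (simp add: d_def)
    qed
    then have "(\<Sum>v<l. iexp (weighted_sum w (Suc l) (p(l := v)))) = iexp (weighted_sum w l p) * (\<Sum>v<l. iexp (d v))"
      by (simp add: sum_distrib_left exp_add distrib_left)
    then have "cmod ((\<Sum>v<l. iexp (weighted_sum w (Suc l) (p(l := v)))) / of_nat l - of_real (exp (- s / 2)) * iexp (weighted_sum w l p))
        = cmod (iexp (weighted_sum w l p) * ((\<Sum>v<l. iexp (d v)) / of_nat l - of_real (exp (- s / 2))))"
      by (simp add: algebra_simps)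
    also have "\<dots> = cmod ((\<Sum>v<l. iexp (d v)) / of_nat l - of_real (exp (- s / 2)))"
      by (simp add: norm_mult)
    \<comment> \<open>The factor 2 collects two equal contributions, the error in the mean of the
      squared weights and the square of \<open>a\<close>; each is at most
      \<open>b\<^sup>2 * count_deviation m p l\<close>.\<close>
    also have "\<dots> \<le> 4 / 3 * b ^ 3 + b ^ 4 / 8 + (2 * b\<^sup>2 * count_deviation m p l) / 2"
    proof (rule exp_average_error[OF l _ _ _ s b])
      show "(\<Sum>v<l. d v) = 0" using l by (simp add: d_def a_def sum_subtractf)
      have ab: "\<bar>a\<bar> \<le> b"
      proof -
        have "\<bar>a\<bar> \<le> (\<Sum>v<l. b) / real l"
          unfolding a_def abs_divide using Fb by (simp only: abs_of_nat) (intro divide_right_mono order_trans[OF sum_abs] sum_mono, auto)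
        then show ?thesis using l by simp
      qed
      then show "\<bar>d v\<bar> \<le> 2 * b" for v using Fb[of "level p v"] by (simp add: d_def)
      have "\<bar>a - 0\<bar> \<le> b * count_deviation m p l"
        using average_periodic_deviation[where F = F and p = p and l = l, OF m perF Fb] meanF by (simp add: a_def)
      then have "a\<^sup>2 \<le> b * (b * count_deviation m p l)"
        unfolding power2_eq_square using ab b by (metis abs_ge_zero abs_mult_self_eq diff_zero mult_mono)
      moreover have "\<bar>(\<Sum>v<l. (F (level p v))\<^sup>2) / real l - s\<bar> \<le> b\<^sup>2 * count_deviation m p l"
        unfolding sF[symmetric] using F2 perF
        by (intro average_periodic_deviation[OF m, of "\<lambda>j. (F j)\<^sup>2"]) auto
      moreover have "(\<Sum>v<l. (d v)\<^sup>2) / real l = (\<Sum>v<l. (F (level p v))\<^sup>2) / real l - a\<^sup>2"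
      proof -
        have "(\<Sum>v<l. (d v)\<^sup>2) = (\<Sum>v<l. (F (level p v))\<^sup>2) - 2 * a * (\<Sum>v<l. F (level p v)) + real l * a\<^sup>2"
          by (simp add: d_def power2_diff sum.distrib sum_subtractf sum_distrib_left mult_ac)
        also have "(\<Sum>v<l. F (level p v)) = real l * a" using l by (simp add: a_def)
        finally show ?thesis using l by (simp add: field_simps power2_eq_square)
      qed
      ultimately show "\<bar>(\<Sum>v<l. (d v)\<^sup>2) / real l - s\<bar> \<le> 2 * b\<^sup>2 * count_deviation m p l"
      proof -
        assume A: "a\<^sup>2 \<le> b * (b * count_deviation m p l)"
          "\<bar>(\<Sum>v<l. (F (level p v))\<^sup>2) / real l - s\<bar> \<le> b\<^sup>2 * count_deviation m p l"
          "(\<Sum>v<l. (d v)\<^sup>2) / real l = (\<Sum>v<l. (F (level p v))\<^sup>2) / real l - a\<^sup>2"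
        have "a\<^sup>2 \<le> b\<^sup>2 * count_deviation m p l" using A(1) by (simp add: power2_eq_square)
        then have "\<bar>(\<Sum>v<l. (F (level p v))\<^sup>2) / real l - a\<^sup>2 - s\<bar> \<le> 2 * (b\<^sup>2 * count_deviation m p l)"
          using A(2) zero_le_power2[of a] by linarith
        then show ?thesis unfolding A(3) by (simp only: mult.assoc)
      qed
    qed
    finally show ?thesis by simp
  qed
  have p1: "past n (\<lambda>p. iexp (weighted_sum w n p))" for n
    by (rule past_comp[where h = iexp, OF past_weighted_sum])
  have pl: "past l (\<lambda>p. (\<Sum>v<l. iexp (weighted_sum w (Suc l) (p(l := v)))) / of_nat l)"
  proof (rule past_comp[where h = "\<lambda>x. x / of_nat l", OF past_sum])
    fix v assume "v \<in> {..<l}"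
    show "past l (\<lambda>p. iexp (weighted_sum w (Suc l) (p(l := v))))"
    proof (rule pastI)
      fix p q :: "nat \<Rightarrow> nat" assume pq: "\<And>i. 1 \<le> i \<Longrightarrow> i < l \<Longrightarrow> p i = q i"
      show "iexp (weighted_sum w (Suc l) (p(l := v))) = iexp (weighted_sum w (Suc l) (q(l := v)))"
        by (rule pastD[OF p1]) (use pq in auto)
    qed
  qed
  note int = past_integrable[OF pl] past_integrable[OF p1, of l] past_integrable[OF past_count_deviation, of m l]
  have "cmod ((\<integral>\<omega>. G \<omega> \<partial>M) - c * (\<integral>\<omega>. H \<omega> \<partial>M)) \<le> e + r * (\<integral>\<omega>. C \<omega> \<partial>M)"
    if "integrable M G" "integrable M H" "integrable M C" "\<And>\<omega>. cmod (G \<omega> - c * H \<omega>) \<le> e + r * C \<omega>"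
    for G H :: "'a \<Rightarrow> complex" and C :: "'a \<Rightarrow> real" and c e r
  proof -
    have "(\<integral>\<omega>. G \<omega> \<partial>M) - c * (\<integral>\<omega>. H \<omega> \<partial>M) = (\<integral>\<omega>. G \<omega> - c * H \<omega> \<partial>M)"
      using that by simp
    also have "cmod \<dots> \<le> (\<integral>\<omega>. cmod (G \<omega> - c * H \<omega>) \<partial>M)" by (rule integral_norm_bound)
    also have "\<dots> \<le> (\<integral>\<omega>. e + r * C \<omega> \<partial>M)" using that by (intro integral_mono) auto
    also have "\<dots> = e + r * (\<integral>\<omega>. C \<omega> \<partial>M)" using that by (simp add: prob_space)
    finally show ?thesis .
  qed
  note this[OF int pw]
  then show ?thesis unfolding s_def expectation_step[OF l p1] .
qed

end

context random_recursive_tree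
begin

text \<open>Each step multiplies the characteristic function by a factor
  \<open>exp (- s l / 2)\<close>, up to an error. These factors are at most 1, so earlier errors are
  not amplified and the total is their plain sum. The initial weighted sum is the deterministic
  weight \<open>w 1 0\<close> of the root.\<close>

lemma weighted_sum_char:
  fixes w :: "nat \<Rightarrow> nat \<Rightarrow> real"
  assumes m: "m > 0" and n: "n \<ge> 1"
    and rec: "\<And>l j. 1 \<le> l \<Longrightarrow> l < n \<Longrightarrow> w l j = w (Suc l) j + w (Suc l) (Suc j) / real l"
    and per: "\<And>l j. w l j = w l (j mod m)"
    and mean: "\<And>l. (\<Sum>j<m. w l j) = 0"
    and bound: "\<And>l j. 1 \<le> l \<Longrightarrow> l < n \<Longrightarrow> \<bar>w (Suc l) j\<bar> \<le> b l"
  shows "cmod ((\<integral>\<omega>. iexp (weighted_sum w n (\<lambda>k. parent k \<omega>)) \<partial>M)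
       - of_real (exp (- (\<Sum>l\<in>{1..<n}. (\<Sum>j<m. (w (Suc l) j)\<^sup>2) / real m) / 2)) * iexp (w 1 0))
     \<le> (\<Sum>l\<in>{1..<n}. 4 / 3 * b l ^ 3 + b l ^ 4 / 8 + (b l)\<^sup>2 * (\<integral>\<omega>. count_deviation m (\<lambda>k. parent k \<omega>) l \<partial>M))"
proof -
  define \<phi> where "\<phi> l = (\<integral>\<omega>. iexp (weighted_sum w l (\<lambda>k. parent k \<omega>)) \<partial>M)" for l
  define s where "s l = (\<Sum>j<m. (w (Suc l) j)\<^sup>2) / real m" for l
  define e where "e l = 4 / 3 * b l ^ 3 + b l ^ 4 / 8 + (b l)\<^sup>2 * (\<integral>\<omega>. count_deviation m (\<lambda>k. parent k \<omega>) l \<partial>M)" for l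
  have "cmod (\<phi> k - of_real (exp (- (\<Sum>l\<in>{1..<k}. s l) / 2)) * iexp (w 1 0)) \<le> (\<Sum>l\<in>{1..<k}. e l)" if "1 \<le> k" "k \<le> n" for k
    using that
  proof (induction k rule: dec_induct)
    case base
    then show ?case by (simp add: \<phi>_def weighted_sum_def prob_space)
  next
    case (step k)
    have k: "1 \<le> k" "k < n" using step by auto
    have 1: "cmod (\<phi> (Suc k) - of_real (exp (- s k / 2)) * \<phi> k) \<le> e k"
      unfolding \<phi>_def s_def e_def by (rule weighted_sum_char_step[OF m k(1) rec[OF k] per mean bound[OF k]])
    have s0: "s k \<ge> 0" by (simp add: s_def sum_nonneg)
    have "\<phi> (Suc k) - of_real (exp (- (\<Sum>l\<in>{1..<Suc k}. s l) / 2)) * iexp (w 1 0)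
       = (\<phi> (Suc k) - of_real (exp (- s k / 2)) * \<phi> k) + of_real (exp (- s k / 2)) * (\<phi> k - of_real (exp (- (\<Sum>l\<in>{1..<k}. s l) / 2)) * iexp (w 1 0))"
      using k by (simp add: algebra_simps add_divide_distrib diff_divide_distrib exp_add[symmetric] flip: of_real_mult)
    also have "cmod \<dots> \<le> e k + 1 * (\<Sum>l\<in>{1..<k}. e l)"
    proof (intro norm_triangle_le add_mono 1)
      show "cmod (of_real (exp (- s k / 2)) * (\<phi> k - of_real (exp (- (\<Sum>l\<in>{1..<k}. s l) / 2)) * iexp (w 1 0))) \<le> 1 * (\<Sum>l\<in>{1..<k}. e l)"
        unfolding norm_mult norm_of_real using step s0 by (intro mult_mono) auto
    qed
    also have "\<dots> = (\<Sum>l\<in>{1..<Suc k}. e l)" using k by simp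
    finally show ?case .
  qed
  from this[OF n order_refl] show ?thesis by (simp only: \<phi>_def s_def e_def)
qed

text \<open>Cauchy-Schwarz over the \<open>m - 1\<close> nonzero frequencies; the factor
  \<open>1 / m\<close> of the Fourier inversion compensates for their number.\<close>

lemma count_second_moment:
  assumes m: "m > 0" and j: "j < m" and A: "\<And>k. k \<in> {1..<m} \<Longrightarrow> level_moment (unit_root m k) n \<le> A" and A0: "A \<ge> 0"
  shows "integrable M (\<lambda>\<omega>. (level_count m (\<lambda>k. parent k \<omega>) n j - real n / real m)\<^sup>2)"
    and "(\<integral>\<omega>. (level_count m (\<lambda>k. parent k \<omega>) n j - real n / real m)\<^sup>2 \<partial>M) \<le> A"
proof -
  let ?P = "\<lambda>\<omega> k. parent k \<omega>"
  show int: "integrable M (\<lambda>\<omega>. (level_count m (?P \<omega>) n j - real n / real m)\<^sup>2)"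
    by (rule past_integrable[OF past_comp[where h = "\<lambda>x. (x - real n / real m)\<^sup>2", OF past_level_count]])
  have zint: "integrable M (\<lambda>\<omega>. (cmod (level_sum z (?P \<omega>) n))\<^sup>2)" for z
    by (rule past_integrable[OF past_comp[where h = "\<lambda>x. (cmod x)\<^sup>2", OF past_level_sum]])
  have pw: "(level_count m p n j - real n / real m)\<^sup>2 \<le> (\<Sum>k\<in>{1..<m}. (cmod (level_sum (unit_root m k) p n))\<^sup>2) / real m" for p
  proof -
    have "\<bar>level_count m p n j - real n / real m\<bar> = cmod ((\<Sum>k\<in>{1..<m}. cnj (unit_root m k) ^ j * level_sum (unit_root m k) p n) / of_nat m)"
      unfolding level_count_fourier[OF m j, symmetric] norm_of_real ..
    also have "\<dots> \<le> (\<Sum>k\<in>{1..<m}. cmod (level_sum (unit_root m k) p n)) / real m"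
      unfolding norm_divide norm_of_nat
      by (intro divide_right_mono order_trans[OF norm_sum] sum_mono) (auto simp: norm_mult norm_power)
    finally have "\<bar>level_count m p n j - real n / real m\<bar>\<^sup>2 \<le> ((\<Sum>k\<in>{1..<m}. cmod (level_sum (unit_root m k) p n)) / real m)\<^sup>2"
      by (intro power_mono) auto
    also have "\<dots> \<le> (\<Sum>k\<in>{1..<m}. (cmod (level_sum (unit_root m k) p n))\<^sup>2) * real (m - 1) / (real m)\<^sup>2"
      unfolding power_divide using sum_squared_le_sum_of_squares[of "\<lambda>k. cmod (level_sum (unit_root m k) p n)" "{1..<m}"]
      by (intro divide_right_mono) auto
    also have "\<dots> \<le> (\<Sum>k\<in>{1..<m}. (cmod (level_sum (unit_root m k) p n))\<^sup>2) * real m / (real m)\<^sup>2"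
      by (intro divide_right_mono mult_left_mono sum_nonneg) auto
    finally show ?thesis using m by (simp add: power2_eq_square)
  qed
  have "(\<integral>\<omega>. (level_count m (?P \<omega>) n j - real n / real m)\<^sup>2 \<partial>M)
     \<le> (\<integral>\<omega>. (\<Sum>k\<in>{1..<m}. (cmod (level_sum (unit_root m k) (?P \<omega>) n))\<^sup>2) / real m \<partial>M)"
    by (intro integral_mono pw int integrable_divide Bochner_Integration.integrable_sum zint)
  also have "\<dots> = (\<Sum>k\<in>{1..<m}. level_moment (unit_root m k) n) / real m"
    using zint by (simp add: level_moment_def)
  also have "\<dots> \<le> (\<Sum>k\<in>{1..<m}. A) / real m"
    using A by (intro divide_right_mono sum_mono) auto
  also have "\<dots> \<le> real m * A / real m"
    using A0 by (intro divide_right_mono) (auto intro: mult_right_mono)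
  finally show "(\<integral>\<omega>. (level_count m (?P \<omega>) n j - real n / real m)\<^sup>2 \<partial>M) \<le> A" using m by simp
qed

text \<open>The exponent 3/2 is a crude common bound for moments of order \<open>l\<close> and
  \<open>l * ln l\<close>. It yields a power decay of the deviation, here with exponent 1/4, which
  is to be combined with the squared step bounds.\<close>

lemma expectation_count_deviation:
  assumes m: "m > 0" and l: "l \<ge> 1"
    and A: "\<And>k. k \<in> {1..<m} \<Longrightarrow> level_moment (unit_root m k) l \<le> 2 * real l powr (3/2)"
  shows "(\<integral>\<omega>. count_deviation m (\<lambda>k. parent k \<omega>) l \<partial>M) \<le> 3 / 2 * real m * real l powr (-1/4)"
proof -
  let ?P = "\<lambda>\<omega> k. parent k \<omega>"
  \<comment> \<open>\<open>s\<close> balances the inequality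
    \<open>2 * \<bar>x\<bar> \<le> s + x\<^sup>2 / s\<close>: its square is the order of the second
    moment.\<close>
  define s where "s = real l powr (3/4)"
  have s: "s > 0" using l by (simp add: s_def)
  have "(\<integral>\<omega>. \<bar>level_count m (?P \<omega>) l j / real l - 1 / real m\<bar> \<partial>M) \<le> 3 / 2 * real l powr (-1/4)" if j: "j < m" for j
  proof -
    note sm = count_second_moment[OF m j A]
    have "\<bar>x\<bar> \<le> (s + x\<^sup>2 / s) / 2" for x :: real
    proof -
      have "0 \<le> (s - \<bar>x\<bar>)\<^sup>2" by simp
      then have "2 * \<bar>x\<bar> * s \<le> s\<^sup>2 + x\<^sup>2" by (simp add: power2_diff mult_ac)
      then show ?thesis using s by (simp add: field_simps power2_eq_square)
    qed
    then have pw: "\<bar>level_count m p l j / real l - 1 / real m\<bar> \<le> (s + (level_count m p l j - real l / real m)\<^sup>2 / s) / 2 / real l" for p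
    proof -
      have "\<bar>level_count m p l j / real l - 1 / real m\<bar> = \<bar>level_count m p l j - real l / real m\<bar> / real l"
      proof -
        have "level_count m p l j / real l - 1 / real m = (level_count m p l j - real l / real m) / real l"
          using l m by (simp add: diff_divide_distrib)
        then show ?thesis by (simp add: abs_divide)
      qed
      also have "\<dots> \<le> (s + (level_count m p l j - real l / real m)\<^sup>2 / s) / 2 / real l"
        using \<open>\<And>x. \<bar>x\<bar> \<le> (s + x\<^sup>2 / s) / 2\<close> by (intro divide_right_mono) auto
      finally show ?thesis .
    qed
    have int: "integrable M (\<lambda>\<omega>. (level_count m (?P \<omega>) l j - real l / real m)\<^sup>2)" by (rule sm(1)) auto
    have "(\<integral>\<omega>. \<bar>level_count m (?P \<omega>) l j / real l - 1 / real m\<bar> \<partial>M)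
       \<le> (\<integral>\<omega>. (s + (level_count m (?P \<omega>) l j - real l / real m)\<^sup>2 / s) / 2 / real l \<partial>M)"
    proof (intro integral_mono pw)
      show "integrable M (\<lambda>\<omega>. \<bar>level_count m (?P \<omega>) l j / real l - 1 / real m\<bar>)"
        by (rule past_integrable[OF past_comp[where h = "\<lambda>x. \<bar>x / real l - 1 / real m\<bar>", OF past_level_count]])
    qed (intro integrable_divide Bochner_Integration.integrable_add integrable_const int)
    also have "\<dots> = (s + (\<integral>\<omega>. (level_count m (?P \<omega>) l j - real l / real m)\<^sup>2 \<partial>M) / s) / 2 / real l"
      using int by (simp add: prob_space)
    also have "\<dots> \<le> (s + 2 * real l powr (3/2) / s) / 2 / real l"
      using sm(2) s by (intro divide_right_mono add_left_mono) auto
    also have "real l powr (3/2) = s * s" by (simp add: s_def powr_add[symmetric])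
    also have "(s + 2 * (s * s) / s) / 2 / real l = 3 / 2 * (s / real l)" using s by simp
    also have "s / real l = real l powr (-1/4)"
      using l powr_diff[of "real l" "3/4" 1] by (simp add: s_def)
    finally show ?thesis .
  qed
  then have "(\<Sum>j<m. (\<integral>\<omega>. \<bar>level_count m (?P \<omega>) l j / real l - 1 / real m\<bar> \<partial>M)) \<le> (\<Sum>j<m. 3 / 2 * real l powr (-1/4))"
    by (intro sum_mono) auto
  moreover have "(\<integral>\<omega>. count_deviation m (?P \<omega>) l \<partial>M) = (\<Sum>j<m. (\<integral>\<omega>. \<bar>level_count m (?P \<omega>) l j / real l - 1 / real m\<bar> \<partial>M))"
    unfolding count_deviation_def
    by (intro Bochner_Integration.integral_sum past_integrable[OF past_comp[where h = "\<lambda>x. \<bar>x / real l - 1 / real m\<bar>", OF past_level_count]])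
  ultimately show ?thesis by (simp add: mult_ac)
qed

end

section \<open>Backward weights in Fourier coordinates\<close>

definition fourier_coeff :: "nat \<Rightarrow> (nat \<Rightarrow> real) \<Rightarrow> nat \<Rightarrow> complex" where
  "fourier_coeff m t k = (\<Sum>j<m. of_real (t j) * cnj (unit_root m k) ^ j) / of_nat m"

text \<open>The dual orthogonality relation, summing over residues; \<open>unit_root m k ^ j\<close>
  is symmetric in \<open>k\<close> and \<open>j\<close>.\<close>

lemma sum_unit_root':
  assumes "m > 0" "k < m" "k' < m"
  shows "(\<Sum>j<m. unit_root m k ^ j * cnj (unit_root m k') ^ j) = (if k = k' then of_nat m else 0)"
proof -
  have "cnj (unit_root m k') ^ j = cnj (unit_root m j) ^ k'" for j
    by (metis complex_cnj_power unit_root_power_swap)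
  then show ?thesis
    using sum_unit_root[OF assms] by (simp add: unit_root_power_swap[of m k])
qed

lemma fourier_inversion:
  assumes m: "m > 0" and j: "j < m"
  shows "(\<Sum>k<m. fourier_coeff m t k * unit_root m k ^ j) = of_real (t j)"
proof -
  have "(\<Sum>k<m. fourier_coeff m t k * unit_root m k ^ j)
      = (\<Sum>i<m. \<Sum>k<m. of_real (t i) * (unit_root m k ^ j * cnj (unit_root m k) ^ i)) / of_nat m"
    unfolding fourier_coeff_def times_divide_eq_left sum_divide_distrib[symmetric] sum_distrib_right
    by (subst sum.swap) (simp add: mult_ac)
  also have "\<dots> = (\<Sum>i<m. if j = i then of_real (t i) * of_nat m else 0) / of_nat m"
    unfolding sum_distrib_left[symmetric] using m j
    by (intro arg_cong2[where f = "(/)"] sum.cong refl, subst sum_unit_root) auto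
  also have "\<dots> = of_real (t j)" using m j by simp
  finally show ?thesis .
qed

lemma parseval:
  assumes m: "m > 0" and K: "K \<subseteq> {..<m}"
  shows "(\<Sum>j<m. (cmod (\<Sum>k\<in>K. x k * unit_root m k ^ j))\<^sup>2) = real m * (\<Sum>k\<in>K. (cmod (x k))\<^sup>2)"
proof -
  have fin: "finite K" using K finite_subset by blast
  have "complex_of_real (\<Sum>j<m. (cmod (\<Sum>k\<in>K. x k * unit_root m k ^ j))\<^sup>2)
    = (\<Sum>j<m. \<Sum>k\<in>K. \<Sum>k'\<in>K. x k * cnj (x k') * (unit_root m k ^ j * cnj (unit_root m k') ^ j))"
    unfolding of_real_sum complex_norm_square cnj_sum sum_product by (simp add: mult_ac)
  also have "\<dots> = (\<Sum>k\<in>K. \<Sum>k'\<in>K. \<Sum>j<m. x k * cnj (x k') * (unit_root m k ^ j * cnj (unit_root m k') ^ j))"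
    by (subst sum.swap) (intro sum.cong refl sum.swap)
  also have "\<dots> = (\<Sum>k\<in>K. \<Sum>k'\<in>K. if k = k' then x k * cnj (x k') * of_nat m else 0)"
    unfolding sum_distrib_left[symmetric] using K
    by (intro sum.cong refl, subst sum_unit_root'[OF m]) auto
  also have "\<dots> = (\<Sum>k\<in>K. x k * cnj (x k) * of_nat m)" using fin by simp
  also have "\<dots> = complex_of_real (real m * (\<Sum>k\<in>K. (cmod (x k))\<^sup>2))"
    by (simp add: complex_norm_square[symmetric] sum_distrib_left mult_ac flip: of_real_power)
  finally show ?thesis by (simp only: of_real_eq_iff)
qed

text \<open>The backward recursion is a convolution in the level, hence diagonal in Fourier
  coordinates: frequency \<open>k\<close> acquires the factor \<open>1 + unit_root m k / l\<close>.
  Frequency 0 is left out, since it would only count vertices; the final weights are therefore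
  \<open>t\<close> minus its mean.\<close>

definition fourier_weight :: "nat \<Rightarrow> (nat \<Rightarrow> real) \<Rightarrow> nat \<Rightarrow> nat \<Rightarrow> nat \<Rightarrow> complex" where
  "fourier_weight m t n l j =
     (\<Sum>k\<in>{1..<m}. fourier_coeff m t k * growth_prod (unit_root m k) l n * unit_root m k ^ j)"

lemma fourier_weight_rec:
  assumes "1 \<le> l" "l < n"
  shows "fourier_weight m t n l j = fourier_weight m t n (Suc l) j + fourier_weight m t n (Suc l) (Suc j) / of_nat l"
proof -
  have "fourier_weight m t n l j = (\<Sum>k\<in>{1..<m}. fourier_coeff m t k * growth_prod (unit_root m k) (Suc l) n * unit_root m k ^ j
     + fourier_coeff m t k * growth_prod (unit_root m k) (Suc l) n * unit_root m k ^ Suc j / of_nat l)"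
    unfolding fourier_weight_def using assms
    by (intro sum.cong refl, subst growth_prod_head) (auto simp: algebra_simps)
  then show ?thesis by (simp add: fourier_weight_def sum.distrib sum_divide_distrib)
qed

lemma fourier_weight_periodic:
  "m > 0 \<Longrightarrow> fourier_weight m t n l j = fourier_weight m t n l (j mod m)"
  by (simp add: fourier_weight_def unit_root_power_mod)

lemma fourier_weight_mean:
  assumes m: "m > 0"
  shows "(\<Sum>j<m. fourier_weight m t n l j) = 0"
proof -
  have "(\<Sum>j<m. fourier_weight m t n l j)
      = (\<Sum>k\<in>{1..<m}. fourier_coeff m t k * growth_prod (unit_root m k) l n * (\<Sum>j<m. unit_root m k ^ j))"
    unfolding fourier_weight_def sum_distrib_left by (rule sum.swap)
  also have "\<dots> = 0"
    using sum_unit_root'[OF m, of _ 0] m by (intro sum.neutral) auto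
  finally show ?thesis .
qed

lemma fourier_weight_final:
  assumes m: "m > 0" and j: "j < m"
  shows "fourier_weight m t n n j = of_real (t j - (\<Sum>i<m. t i) / real m)"
proof -
  have "{..<m} = insert 0 {1..<m}" using m by auto
  then have "(\<Sum>k<m. fourier_coeff m t k * unit_root m k ^ j) = fourier_coeff m t 0 + fourier_weight m t n n j"
    by (simp add: fourier_weight_def)
  moreover have "fourier_coeff m t 0 = of_real ((\<Sum>i<m. t i) / real m)"
    by (simp add: fourier_coeff_def)
  ultimately show ?thesis using fourier_inversion[OF m j, of t] by (simp add: algebra_simps)
qed

text \<open>Not visible in the formula, but the final weights are real and the backward recursion
  has real coefficients; hence the descending induction.\<close>

lemma fourier_weight_real:
  assumes m: "m > 0" and l: "1 \<le> l" "l \<le> n"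
  shows "Im (fourier_weight m t n l j) = 0"
  using l(2) l(1)
proof (induction l arbitrary: j rule: inc_induct)
  case base
  have "fourier_weight m t n n j = fourier_weight m t n n (j mod m)" by (rule fourier_weight_periodic[OF m])
  then show ?case using fourier_weight_final[OF m, of "j mod m" t n] m by simp
next
  case (step l)
  have "Im (fourier_weight m t n l j) = Im (fourier_weight m t n (Suc l) j) + Im (fourier_weight m t n (Suc l) (Suc j)) / real l"
    using step by (subst fourier_weight_rec) auto
  then show ?case using step by simp
qed

lemma fourier_weight_square_sum:
  assumes m: "m > 0" and l: "1 \<le> l" "l \<le> n"
  shows "(\<Sum>j<m. (Re (fourier_weight m t n l j))\<^sup>2) / real m
     = (\<Sum>k\<in>{1..<m}. (cmod (fourier_coeff m t k))\<^sup>2 * (cmod (growth_prod (unit_root m k) l n))\<^sup>2)"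
proof -
  have "(\<Sum>j<m. (Re (fourier_weight m t n l j))\<^sup>2) = (\<Sum>j<m. (cmod (fourier_weight m t n l j))\<^sup>2)"
    using fourier_weight_real[OF m l] by (simp add: cmod_power2)
  also have "\<dots> = real m * (\<Sum>k\<in>{1..<m}. (cmod (fourier_coeff m t k * growth_prod (unit_root m k) l n))\<^sup>2)"
    unfolding fourier_weight_def by (rule parseval[OF m]) auto
  finally show ?thesis using m by (simp add: norm_mult power_mult_distrib)
qed

lemma norm_fourier_weight_le:
  assumes "\<And>k. k \<in> {1..<m} \<Longrightarrow> cmod (growth_prod (unit_root m k) l n) \<le> B"
  shows "cmod (fourier_weight m t n l j) \<le> (\<Sum>k\<in>{1..<m}. cmod (fourier_coeff m t k)) * B"
  unfolding fourier_weight_def sum_distrib_right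
  using assms by (intro order_trans[OF norm_sum] sum_mono) (auto simp: norm_mult norm_power intro!: mult_left_mono)

lemma sum_level_count: "m > 0 \<Longrightarrow> (\<Sum>j<m. level_count m p n j) = real n"
  using sum_level_periodic[of m "\<lambda>_. 1" p n] by simp

text \<open>Since the counts add up to \<open>n\<close>, centring the coefficients \<open>t\<close>
  amounts to centring the counts.\<close>

lemma weighted_sum_fourier_weight:
  assumes m: "m > 0"
  shows "weighted_sum (\<lambda>l j. Re (fourier_weight m t n l j) / g) n p
     = (\<Sum>j<m. t j * ((level_count m p n j - real n / real m) / g))"
proof -
  define T where "T = (\<Sum>i<m. t i)"
  have "weighted_sum (\<lambda>l j. Re (fourier_weight m t n l j) / g) n p
     = (\<Sum>j<m. level_count m p n j * (Re (fourier_weight m t n n j) / g))"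
    unfolding weighted_sum_def using fourier_weight_periodic[OF m, of t n n]
    by (intro sum_level_periodic[OF m, of "\<lambda>j. Re (fourier_weight m t n n j) / g"]) simp
  also have "\<dots> = (\<Sum>j<m. t j * level_count m p n j / g - T / real m / g * level_count m p n j)"
  proof (intro sum.cong refl)
    fix j assume "j \<in> {..<m}"
    then have R: "Re (fourier_weight m t n n j) = t j - T / real m"
      by (simp only: fourier_weight_final[OF m] lessThan_iff T_def Re_complex_of_real)
    show "level_count m p n j * (Re (fourier_weight m t n n j) / g) = t j * level_count m p n j / g - T / real m / g * level_count m p n j"
      unfolding R by (simp add: algebra_simps diff_divide_distrib)
  qed
  also have "\<dots> = (\<Sum>j<m. t j * level_count m p n j / g) - T / real m / g * real n"
    by (simp only: sum_subtractf sum_distrib_left[symmetric] sum_level_count[OF m])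
  also have "T / real m / g * real n = (\<Sum>j<m. t j * (real n / real m) / g)"
    by (simp add: T_def sum_distrib_right sum_divide_distrib)
  also have "(\<Sum>j<m. t j * level_count m p n j / g) - \<dots> = (\<Sum>j<m. t j * ((level_count m p n j - real n / real m) / g))"
    by (simp add: sum_subtractf[symmetric] diff_divide_distrib right_diff_distrib)
  finally show ?thesis .
qed

section \<open>Limits of the characteristic functions\<close>

context random_recursive_tree
begin

text \<open>By \<open>gp\<close> the steps are bounded by
  \<open>B * \<eta> n * l powr (-2/5)\<close>. Cubes and fourth powers decay at least like
  \<open>l powr (-6/5)\<close>, and squares times the expected deviation like
  \<open>l powr (-4/5 - 1/4)\<close>. So all errors are dominated by the summable
  \<open>l powr (-21/20)\<close>, and the null factor \<eta> makes their total vanish. The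
  accumulated variances converge by \<open>var\<close> and Parseval.\<close>

lemma count_char_tendsto:
  fixes g \<eta> :: "nat \<Rightarrow> real" and t :: "nat \<Rightarrow> real"
  assumes m: "m > 0" and g: "\<And>n. n \<ge> 2 \<Longrightarrow> g n > 0"
    and var: "\<And>k. k \<in> {1..<m} \<Longrightarrow> (\<lambda>n. growth_sum (unit_root m k) n / (g n)\<^sup>2) \<longlonglongrightarrow> \<Lambda> k"
    and gp: "\<And>k l n. k \<in> {1..<m} \<Longrightarrow> 1 \<le> l \<Longrightarrow> l < n \<Longrightarrow>
        cmod (growth_prod (unit_root m k) (Suc l) n) \<le> g n * \<eta> n * real l powr (-2/5)"
    and \<eta>: "\<eta> \<longlonglongrightarrow> 0" "\<And>n. \<eta> n \<ge> 0"
    and mom: "\<And>k l. k \<in> {1..<m} \<Longrightarrow> 1 \<le> l \<Longrightarrow> level_moment (unit_root m k) l \<le> 2 * real l powr (3/2)"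
  shows "(\<lambda>n. \<integral>\<omega>. iexp (\<Sum>j<m. t j * ((level_count m (\<lambda>k. parent k \<omega>) n j - real n / real m) / g n)) \<partial>M)
     \<longlonglongrightarrow> of_real (exp (- (\<Sum>k\<in>{1..<m}. (cmod (fourier_coeff m t k))\<^sup>2 * \<Lambda> k) / 2))"
proof -
  define B where "B = (\<Sum>k\<in>{1..<m}. cmod (fourier_coeff m t k))"
  have B: "B \<ge> 0" by (simp add: B_def sum_nonneg)
  define w where "w n l j = Re (fourier_weight m t n l j) / g n" for n l j
  define b where "b n l = B * \<eta> n * real l powr (-2/5)" for n l
  define V where "V n = (\<Sum>l\<in>{1..<n}. (\<Sum>j<m. (w n (Suc l) j)\<^sup>2) / real m)" for n
  define S where "S = (\<Sum>l. real (Suc l) powr (-21/20))"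
  define E where "E n = (4 / 3 * (B * \<eta> n) ^ 3 + (B * \<eta> n) ^ 4 / 8 + (B * \<eta> n)\<^sup>2 * (3 / 2 * real m)) * S" for n
  have wb: "\<bar>w n (Suc l) j\<bar> \<le> b n l" if "1 \<le> l" "l < n" for n l j
  proof -
    have "\<bar>Re (fourier_weight m t n (Suc l) j)\<bar> \<le> B * (g n * \<eta> n * real l powr (-2/5))"
      unfolding B_def using gp that by (intro order_trans[OF abs_Re_le_cmod] norm_fourier_weight_le) auto
    then show ?thesis using g[of n] that by (simp add: w_def b_def abs_divide field_simps)
  qed
  have Vn: "V n = (\<Sum>k\<in>{1..<m}. (cmod (fourier_coeff m t k))\<^sup>2 * (growth_sum (unit_root m k) n / (g n)\<^sup>2))" for n
  proof -
    have "V n = (\<Sum>l\<in>{1..<n}. (\<Sum>k\<in>{1..<m}. (cmod (fourier_coeff m t k))\<^sup>2 * (cmod (growth_prod (unit_root m k) (Suc l) n))\<^sup>2) / (g n)\<^sup>2)"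
      unfolding V_def
    proof (intro sum.cong refl)
      fix l assume l: "l \<in> {1..<n}"
      have "(\<Sum>j<m. (w n (Suc l) j)\<^sup>2) / real m = ((\<Sum>j<m. (Re (fourier_weight m t n (Suc l) j))\<^sup>2) / real m) / (g n)\<^sup>2"
        by (simp add: w_def power_divide sum_divide_distrib[symmetric] mult.commute)
      then show "(\<Sum>j<m. (w n (Suc l) j)\<^sup>2) / real m = (\<Sum>k\<in>{1..<m}. (cmod (fourier_coeff m t k))\<^sup>2 * (cmod (growth_prod (unit_root m k) (Suc l) n))\<^sup>2) / (g n)\<^sup>2"
        using l by (subst (asm) fourier_weight_square_sum[OF m]) auto
    qed
    also have "\<dots> = (\<Sum>k\<in>{1..<m}. \<Sum>l\<in>{1..<n}. (cmod (fourier_coeff m t k))\<^sup>2 * (cmod (growth_prod (unit_root m k) (Suc l) n))\<^sup>2 / (g n)\<^sup>2)"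
      unfolding sum_divide_distrib by (rule sum.swap)
    also have "\<dots> = (\<Sum>k\<in>{1..<m}. (cmod (fourier_coeff m t k))\<^sup>2 * (growth_sum (unit_root m k) n / (g n)\<^sup>2))"
      by (simp add: growth_sum_def sum_distrib_left sum_divide_distrib)
    finally show ?thesis .
  qed
  have Vlim: "V \<longlonglongrightarrow> (\<Sum>k\<in>{1..<m}. (cmod (fourier_coeff m t k))\<^sup>2 * \<Lambda> k)"
    unfolding Vn by (intro tendsto_sum tendsto_mult tendsto_const var)
  have sums: "summable (\<lambda>l. real (Suc l) powr (-21/20))"
    using summable_real_powr_iff[of "-21/20"] by (subst summable_Suc_iff) simp
  have Ssum: "(\<Sum>l\<in>{1..<n}. real l powr (-21/20)) \<le> S" for n
  proof -
    have "(\<Sum>l\<in>{1..<n}. real l powr (-21/20)) = (\<Sum>l\<in>{0..<n - 1}. real (Suc l) powr (-21/20))"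
      by (cases n) (simp_all only: One_nat_def diff_Suc_Suc diff_zero sum.shift_bounds_Suc_ivl, simp_all)
    also have "\<dots> \<le> S" unfolding S_def by (intro sum_le_suminf sums) auto
    finally show ?thesis .
  qed
  have main: "cmod ((\<integral>\<omega>. iexp (weighted_sum (w n) n (\<lambda>k. parent k \<omega>)) \<partial>M) - of_real (exp (- V n / 2)) * iexp (w n 1 0)) \<le> E n"
    if n: "n \<ge> 2" for n
  proof -
    have "cmod ((\<integral>\<omega>. iexp (weighted_sum (w n) n (\<lambda>k. parent k \<omega>)) \<partial>M) - of_real (exp (- V n / 2)) * iexp (w n 1 0))
      \<le> (\<Sum>l\<in>{1..<n}. 4 / 3 * b n l ^ 3 + b n l ^ 4 / 8 + (b n l)\<^sup>2 * (\<integral>\<omega>. count_deviation m (\<lambda>k. parent k \<omega>) l \<partial>M))"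
      unfolding V_def
    proof (rule weighted_sum_char[OF m])
      show "w n l j = w n (Suc l) j + w n (Suc l) (Suc j) / real l" if "1 \<le> l" "l < n" for l j
        unfolding w_def fourier_weight_rec[OF that] using that by (simp add: add_divide_distrib)
      show "w n l j = w n l (j mod m)" for l j
        using fourier_weight_periodic[OF m, of t n l j] by (simp add: w_def)
      show "(\<Sum>j<m. w n l j) = 0" for l
        using arg_cong[OF fourier_weight_mean[OF m, of t n l], of Re] by (simp add: w_def sum_divide_distrib[symmetric])
    qed (use n wb in auto)
    also have "\<dots> \<le> (\<Sum>l\<in>{1..<n}. (4 / 3 * (B * \<eta> n) ^ 3 + (B * \<eta> n) ^ 4 / 8 + (B * \<eta> n)\<^sup>2 * (3 / 2 * real m)) * real l powr (-21/20))"
    proof (rule sum_mono)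
      fix l assume l: "l \<in> {1..<n}"
      have l1: "real l \<ge> 1" using l by simp
      have pw: "(real l powr (-2/5)) ^ k = real l powr (-2/5 * real k)" for k
      proof -
        have "(x powr a) ^ k = x powr (a * real k)" if "x \<ge> 1" for x a :: real
          by (induction k) (use that in \<open>simp_all add: powr_add[symmetric] distrib_left\<close>)
        then show ?thesis using l1 by blast
      qed
      have "(\<integral>\<omega>. count_deviation m (\<lambda>k. parent k \<omega>) l \<partial>M) \<le> 3 / 2 * real m * real l powr (-1/4)"
        using l mom by (intro expectation_count_deviation[OF m]) auto
      then have "(b n l)\<^sup>2 * (\<integral>\<omega>. count_deviation m (\<lambda>k. parent k \<omega>) l \<partial>M) \<le> (b n l)\<^sup>2 * (3 / 2 * real m * real l powr (-1/4))"
        by (intro mult_left_mono) auto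
      also have "\<dots> = (B * \<eta> n)\<^sup>2 * (3 / 2 * real m) * real l powr (-21/20)"
      proof -
        have q: "real l powr (-2/5 * real 2) * real l powr (-1/4) = real l powr (-21/20)"
          by (simp add: powr_add[symmetric])
        show ?thesis unfolding b_def power_mult_distrib[of "B * \<eta> n"] pw q[symmetric] by (simp only: mult_ac)
      qed
      finally have 1: "(b n l)\<^sup>2 * (\<integral>\<omega>. count_deviation m (\<lambda>k. parent k \<omega>) l \<partial>M) \<le> (B * \<eta> n)\<^sup>2 * (3 / 2 * real m) * real l powr (-21/20)" .
      have "b n l ^ 3 = (B * \<eta> n) ^ 3 * real l powr (-6/5)" unfolding b_def power_mult_distrib[of "B * \<eta> n"] pw by simp
      also have "\<dots> \<le> (B * \<eta> n) ^ 3 * real l powr (-21/20)"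
        using l1 B \<eta>(2)[of n] by (intro mult_left_mono powr_mono) auto
      finally have 2: "b n l ^ 3 \<le> (B * \<eta> n) ^ 3 * real l powr (-21/20)" .
      have "b n l ^ 4 = (B * \<eta> n) ^ 4 * real l powr (-8/5)" unfolding b_def power_mult_distrib[of "B * \<eta> n"] pw by simp
      also have "\<dots> \<le> (B * \<eta> n) ^ 4 * real l powr (-21/20)"
        using l1 B \<eta>(2)[of n] by (intro mult_left_mono powr_mono) auto
      finally have 3: "b n l ^ 4 \<le> (B * \<eta> n) ^ 4 * real l powr (-21/20)" .
      show "4 / 3 * b n l ^ 3 + b n l ^ 4 / 8 + (b n l)\<^sup>2 * (\<integral>\<omega>. count_deviation m (\<lambda>k. parent k \<omega>) l \<partial>M)
        \<le> (4 / 3 * (B * \<eta> n) ^ 3 + (B * \<eta> n) ^ 4 / 8 + (B * \<eta> n)\<^sup>2 * (3 / 2 * real m)) * real l powr (-21/20)"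
        using 1 2 3 by (simp add: distrib_right)
    qed
    also have "\<dots> \<le> E n"
      unfolding sum_distrib_left[symmetric] E_def using Ssum B \<eta>(2)[of n] by (intro mult_left_mono) auto
    finally show ?thesis .
  qed
  have E0: "E \<longlonglongrightarrow> 0"
  proof -
    have "E \<longlonglongrightarrow> (4 / 3 * (B * 0) ^ 3 + (B * 0) ^ 4 / 8 + (B * 0)\<^sup>2 * (3 / 2 * real m)) * S"
      unfolding E_def by (intro tendsto_intros \<eta>) auto
    then show ?thesis by simp
  qed
  have d0: "(\<lambda>n. (\<integral>\<omega>. iexp (weighted_sum (w n) n (\<lambda>k. parent k \<omega>)) \<partial>M) - of_real (exp (- V n / 2)) * iexp (w n 1 0)) \<longlonglongrightarrow> 0"
    by (rule Lim_null_comparison[OF _ E0]) (use main in \<open>auto simp: eventually_at_top_linorder\<close>)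
  \<comment> \<open>\<open>wb\<close> bounds the weights from time 2 on, so the weight at time 1 is
    reached through one step of the recursion.\<close>
  have w0: "(\<lambda>n. w n 1 0) \<longlonglongrightarrow> 0"
  proof (rule Lim_null_comparison)
    show "eventually (\<lambda>n. norm (w n 1 0) \<le> 2 * (B * \<eta> n)) sequentially"
      using eventually_ge_at_top[of 2]
    proof eventually_elim
      case (elim n)
      have "w n 1 0 = w n (Suc 1) 0 + w n (Suc 1) 1"
        using fourier_weight_rec[of 1 n m t 0] elim by (simp add: w_def add_divide_distrib)
      then show ?case using wb[of 1 n 0] wb[of 1 n 1] elim by (simp add: b_def)
    qed
    have "(\<lambda>n. 2 * (B * \<eta> n)) \<longlonglongrightarrow> 2 * (B * 0)" by (intro tendsto_intros \<eta>)
    then show "(\<lambda>n. 2 * (B * \<eta> n)) \<longlonglongrightarrow> 0" by simp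
  qed
  have "(\<lambda>n. of_real (exp (- V n / 2)) * iexp (w n 1 0))
     \<longlonglongrightarrow> of_real (exp (- (\<Sum>k\<in>{1..<m}. (cmod (fourier_coeff m t k))\<^sup>2 * \<Lambda> k) / 2)) * iexp 0"
    by (intro tendsto_intros Vlim w0) auto
  from tendsto_add[OF d0 this]
  have "(\<lambda>n. \<integral>\<omega>. iexp (weighted_sum (w n) n (\<lambda>k. parent k \<omega>)) \<partial>M)
     \<longlonglongrightarrow> of_real (exp (- (\<Sum>k\<in>{1..<m}. (cmod (fourier_coeff m t k))\<^sup>2 * \<Lambda> k) / 2))" by simp
  moreover have "weighted_sum (w n) n p = (\<Sum>j<m. t j * ((level_count m p n j - real n / real m) / g n))" for n p
    using weighted_sum_fourier_weight[OF m, of t n "g n" p] by (simp add: w_def[abs_def])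
  ultimately show ?thesis by simp
qed

end

section \<open>Gaussian limit vectors with circulant covariance\<close>

lemma vec_law_measurable:
  assumes "\<And>j. j < m \<Longrightarrow> (\<lambda>\<omega>. V \<omega> j) \<in> borel_measurable M"
  shows "(\<lambda>\<omega>. \<lambda>j\<in>{..<m}. V \<omega> j) \<in> measurable M (vec_borel m)"
  using assms by (intro measurable_restrict) auto

lemma vec_law_cong_AE:
  assumes V: "\<And>j. j < m \<Longrightarrow> (\<lambda>\<omega>. V \<omega> j) \<in> borel_measurable M"
    and W: "\<And>j. j < m \<Longrightarrow> (\<lambda>\<omega>. W \<omega> j) \<in> borel_measurable M"
    and eq: "AE \<omega> in M. \<forall>j<m. V \<omega> j = W \<omega> j"
  shows "vec_law m M V = vec_law m M W"
  unfolding vec_law_def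
proof (rule distr_cong_AE[OF refl refl _ vec_law_measurable[OF V] vec_law_measurable[OF W]])
  show "AE \<omega> in M. (\<lambda>j\<in>{..<m}. V \<omega> j) = (\<lambda>j\<in>{..<m}. W \<omega> j)"
    using eq by eventually_elim (auto simp: fun_eq_iff)
qed

lemma unit_root_cos_sin: "cnj (unit_root m k) ^ j = of_real (cos (2 * pi * real k * real j / real m)) - \<i> * of_real (sin (2 * pi * real k * real j / real m))"
  by (simp add: unit_root_def cis_cnj Complex.DeMoivre complex_eq_iff mult_ac)

text \<open>If \<open>\<Lambda> k = \<Lambda> (m - k)\<close>, this is the circulant matrix with
  eigenvalue \<open>\<Lambda> k / m\<close> on the Fourier vector of frequency \<open>k\<close> and
  0 on constants.\<close>

definition circulant_cov :: "nat \<Rightarrow> (nat \<Rightarrow> real) \<Rightarrow> nat \<Rightarrow> nat \<Rightarrow> real" where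
  "circulant_cov m \<Lambda> i j = (\<Sum>k\<in>{1..<m}. \<Lambda> k * cos (2 * pi * real k * (real i - real j) / real m)) / (real m)\<^sup>2"

text \<open>A real factor of that matrix: by the addition formula each frequency needs a cosine and
  a sine column, selected by the truth value.\<close>

definition circulant_root :: "nat \<Rightarrow> (nat \<Rightarrow> real) \<Rightarrow> nat \<Rightarrow> nat \<times> bool \<Rightarrow> real" where
  "circulant_root m \<Lambda> i = (\<lambda>(k, b). sqrt (\<Lambda> k) / real m *
     (if b then cos (2 * pi * real k * real i / real m) else sin (2 * pi * real k * real i / real m)))"

lemma circulant_root_square:
  assumes "\<And>k. k \<in> {1..<m} \<Longrightarrow> \<Lambda> k \<ge> 0"
  shows "circulant_cov m \<Lambda> i j = (\<Sum>x\<in>{1..<m} \<times> UNIV. circulant_root m \<Lambda> i x * circulant_root m \<Lambda> j x)"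
proof -
  have "(\<Sum>x\<in>{1..<m} \<times> UNIV. circulant_root m \<Lambda> i x * circulant_root m \<Lambda> j x)
    = (\<Sum>k\<in>{1..<m}. \<Lambda> k * cos (2 * pi * real k * (real i - real j) / real m) / (real m)\<^sup>2)"
    unfolding sum.cartesian_product'
  proof (intro sum.cong refl)
    fix k assume k: "k \<in> {1..<m}"
    have "cos (2 * pi * real k * (real i - real j) / real m)
      = cos (2 * pi * real k * real i / real m) * cos (2 * pi * real k * real j / real m) + sin (2 * pi * real k * real i / real m) * sin (2 * pi * real k * real j / real m)"
      by (simp add: cos_diff[symmetric] right_diff_distrib diff_divide_distrib)
    moreover have "s / M * c * (s / M * c') + s / M * d * (s / M * d') = (s * s) * (c * c' + d * d') / M\<^sup>2" for s M c c' d d' :: real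
      by (simp add: power2_eq_square add_divide_distrib distrib_left mult_ac)
    moreover have "(\<Sum>b\<in>UNIV. f b) = f True + f False" for f :: "bool \<Rightarrow> real"
      by (simp add: UNIV_bool)
    moreover have "sqrt (\<Lambda> k) * sqrt (\<Lambda> k) = \<Lambda> k" using assms[OF k] by simp
    ultimately show "(\<Sum>b\<in>UNIV. circulant_root m \<Lambda> i (k, b) * circulant_root m \<Lambda> j (k, b))
      = \<Lambda> k * cos (2 * pi * real k * (real i - real j) / real m) / (real m)\<^sup>2"
      by (simp only: circulant_root_def prod.case if_True if_False)
  qed
  then show ?thesis by (simp add: circulant_cov_def sum_divide_distrib)
qed

text \<open>The right-hand side is the exponent that \<open>count_char_tendsto\<close> produces, so
  the Gaussian vector built from \<open>circulant_root\<close> has the limiting characteristic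
  function.\<close>

lemma circulant_root_linear:
  assumes "\<And>k. k \<in> {1..<m} \<Longrightarrow> \<Lambda> k \<ge> 0"
  shows "(\<Sum>x\<in>{1..<m} \<times> UNIV. (\<Sum>i<m. t i * circulant_root m \<Lambda> i x)\<^sup>2)
    = (\<Sum>k\<in>{1..<m}. (cmod (fourier_coeff m t k))\<^sup>2 * \<Lambda> k)"
  unfolding sum.cartesian_product'
proof (intro sum.cong refl)
  fix k assume k: "k \<in> {1..<m}"
  define C where "C = (\<Sum>i<m. t i * cos (2 * pi * real k * real i / real m))"
  define D where "D = (\<Sum>i<m. t i * sin (2 * pi * real k * real i / real m))"
  have "(\<Sum>i<m. of_real (t i) * cnj (unit_root m k) ^ i) = of_real C - \<i> * of_real D"
    unfolding unit_root_cos_sin C_def D_def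
    by (simp add: right_diff_distrib sum_subtractf sum_distrib_left mult_ac)
  then have "fourier_coeff m t k = Complex (C / real m) (- (D / real m))"
    by (simp add: fourier_coeff_def complex_eq_iff)
  then have "(cmod (fourier_coeff m t k))\<^sup>2 = (C\<^sup>2 + D\<^sup>2) / (real m)\<^sup>2"
    by (simp add: cmod_power2 power_divide add_divide_distrib)
  moreover have "(\<Sum>i<m. t i * circulant_root m \<Lambda> i (k, True)) = sqrt (\<Lambda> k) / real m * C"
    "(\<Sum>i<m. t i * circulant_root m \<Lambda> i (k, False)) = sqrt (\<Lambda> k) / real m * D"
    by (simp_all add: circulant_root_def C_def D_def sum_distrib_left mult_ac)
  ultimately show "(\<Sum>b\<in>UNIV. (\<Sum>i<m. t i * circulant_root m \<Lambda> i (k, b))\<^sup>2) = (cmod (fourier_coeff m t k))\<^sup>2 * \<Lambda> k"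
    using assms[OF k] by (simp add: UNIV_bool power_mult_distrib power_divide add_divide_distrib distrib_left mult_ac)
qed

context random_recursive_tree
begin

text \<open>The hypothesis \<open>mom\<close> controls the proportions in the error terms, whereas
  \<open>mom'\<close> is the bound at the scale \<open>g\<close> that gives tightness.\<close>

lemma weak_conv_normal_counts:
  fixes g \<eta> \<Lambda> :: "nat \<Rightarrow> real" 
  assumes m: "m > 0" and g: "\<And>n. n \<ge> 2 \<Longrightarrow> g n > 0"
    and var: "\<And>k. k \<in> {1..<m} \<Longrightarrow> (\<lambda>n. growth_sum (unit_root m k) n / (g n)\<^sup>2) \<longlonglongrightarrow> \<Lambda> k"
    and gp: "\<And>k l n. k \<in> {1..<m} \<Longrightarrow> 1 \<le> l \<Longrightarrow> l < n \<Longrightarrow>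
        cmod (growth_prod (unit_root m k) (Suc l) n) \<le> g n * \<eta> n * real l powr (-2/5)"
    and \<eta>: "\<eta> \<longlonglongrightarrow> 0" "\<And>n. \<eta> n \<ge> 0"
    and mom: "\<And>k l. k \<in> {1..<m} \<Longrightarrow> 1 \<le> l \<Longrightarrow> level_moment (unit_root m k) l \<le> 2 * real l powr (3/2)"
    and mom': "\<And>k n. k \<in> {1..<m} \<Longrightarrow> 2 \<le> n \<Longrightarrow> level_moment (unit_root m k) n \<le> C * (g n)\<^sup>2"
    and C: "C \<ge> 0"
  shows "weak_conv_normal m (\<lambda>n. vec_law m M (\<lambda>\<omega> j. (level_count m (\<lambda>k. parent k \<omega>) n j - real n / real m) / g n))
      (\<lambda>_. 0) (circulant_cov m \<Lambda>)"
proof -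
  let ?P = "\<lambda>\<omega> k. parent k \<omega>"
  let ?I = "{1..<m} \<times> (UNIV :: bool set)"
  have finI: "finite ?I" by simp
  define Y where "Y n \<omega> j = (level_count m (?P \<omega>) n j - real n / real m) / g n" for n \<omega> j
  have \<Lambda>0: "\<Lambda> k \<ge> 0" if "k \<in> {1..<m}" for k
    using var[OF that] by (rule LIMSEQ_le_const) (auto simp: growth_sum_nonneg)
  define \<nu> where "\<nu> = gauss_vec ?I m (circulant_root m \<Lambda>)"
  have mv: "mv_normal m (\<lambda>_. 0) (circulant_cov m \<Lambda>) \<nu>"
    unfolding \<nu>_def by (rule mv_normal_gauss_vec[OF finI]) (rule circulant_root_square[OF \<Lambda>0])
  have Ym: "(\<lambda>\<omega>. Y n \<omega> j) \<in> borel_measurable M" for n j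
    unfolding Y_def
    by (rule past_measurable[OF past_comp[where h = "\<lambda>x. (x - real n / real m) / g n", OF past_level_count]])
  define \<mu> where "\<mu> n = vec_law m M (Y n)" for n
  note Vm = vec_law_measurable[of m, OF Ym]
  have \<mu>: "prob_space (\<mu> n)" "sets (\<mu> n) = sets (vec_borel m)" for n
    unfolding \<mu>_def vec_law_def by (intro prob_space_distr Vm) simp
  define C' where "C' = max C (Max (insert 0 ((\<lambda>j. circulant_cov m \<Lambda> j j) ` {..<m})))"
  have \<nu>: "prob_space \<nu>" "sets \<nu> = sets (vec_borel m)"
    unfolding \<nu>_def using prob_space_gauss_vec[OF finI] sets_gauss_vec[OF finI] by auto
  have comp: "(\<lambda>x. (x j)\<^sup>2) \<in> borel_measurable (vec_borel m)" if "j < m" for j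
    using that by (intro borel_measurable_power measurable_component_singleton) auto
  have cosm: "(\<lambda>x. cos ((\<Sum>j<m. t j * x j) + \<theta>)) \<in> borel_measurable (vec_borel m)" for t \<theta>
    using vec_linear_measurable[of "{}" t m] by measurable
  have "weak_conv_vec m \<mu> \<nu>"
  proof (rule weak_conv_vecI[where N = 2 and C = C', OF \<mu> \<nu>])
    fix j n assume j: "j < m"
    have i: "integrable M (\<lambda>\<omega>. (Y n \<omega> j)\<^sup>2)"
      unfolding Y_def
      by (rule past_integrable[OF past_comp[where h = "\<lambda>x. ((x - real n / real m) / g n)\<^sup>2", OF past_level_count]])
    show "integrable (\<mu> n) (\<lambda>x. (x j)\<^sup>2)"
      unfolding \<mu>_def vec_law_def using j i
      by (subst integrable_distr_eq[OF Vm comp[OF j]]) simp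
    assume n: "n \<ge> 2"
    have "(\<integral>x. (x j)\<^sup>2 \<partial>\<mu> n) = (\<integral>\<omega>. (level_count m (?P \<omega>) n j - real n / real m)\<^sup>2 \<partial>M) / (g n)\<^sup>2"
      unfolding \<mu>_def vec_law_def using j
      by (subst integral_distr[OF Vm comp[OF j]]) (simp add: Y_def power_divide)
    also have "\<dots> \<le> C * (g n)\<^sup>2 / (g n)\<^sup>2"
      using mom' n C by (intro divide_right_mono count_second_moment(2)[OF m j]) auto
    also have "\<dots> = C" using g[OF n] by simp
    finally show "(\<integral>x. (x j)\<^sup>2 \<partial>\<mu> n) \<le> C'" by (simp add: C'_def)
  next
    fix j assume j: "j < m"
    show "integrable \<nu> (\<lambda>x. (x j)\<^sup>2)"
      unfolding \<nu>_def power2_eq_square by (rule gauss_vec_moments(2)[OF finI j j])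
    have "(\<integral>x. (x j)\<^sup>2 \<partial>\<nu>) = circulant_cov m \<Lambda> j j"
      unfolding \<nu>_def power2_eq_square gauss_vec_moments(3)[OF finI j j] by (rule circulant_root_square[OF \<Lambda>0, symmetric])
    also have "\<dots> \<le> Max (insert 0 ((\<lambda>j. circulant_cov m \<Lambda> j j) ` {..<m}))"
      using j by (intro Max_ge) auto
    finally show "(\<integral>x. (x j)\<^sup>2 \<partial>\<nu>) \<le> C'" by (simp add: C'_def)
  next
    fix t :: "nat \<Rightarrow> real" and \<theta> :: real
    have cosRe: "cos (a + \<theta>) = Re (exp (\<i> * of_real \<theta>) * iexp a)" for a
      by (simp add: exp_add[symmetric] Re_exp distrib_left[symmetric] add.commute)
    have cm: "(\<lambda>\<omega>. iexp (\<Sum>j<m. t j * Y n \<omega> j)) \<in> borel_measurable M" for n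
      using Ym by measurable
    have ci: "integrable M (\<lambda>\<omega>. iexp (\<Sum>j<m. t j * Y n \<omega> j))" for n
      by (rule integrable_const_bound[where B = 1, OF _ cm]) auto
    have 1: "(\<integral>x. cos ((\<Sum>j<m. t j * x j) + \<theta>) \<partial>\<mu> n) = Re (exp (\<i> * of_real \<theta>) * (\<integral>\<omega>. iexp (\<Sum>j<m. t j * Y n \<omega> j) \<partial>M))" for n
    proof -
      have "(\<integral>x. cos ((\<Sum>j<m. t j * x j) + \<theta>) \<partial>\<mu> n) = (\<integral>\<omega>. cos ((\<Sum>j<m. t j * Y n \<omega> j) + \<theta>) \<partial>M)"
        unfolding \<mu>_def vec_law_def by (subst integral_distr[OF Vm cosm]) simp
      also have "\<dots> = (\<integral>\<omega>. Re (exp (\<i> * of_real \<theta>) * iexp (\<Sum>j<m. t j * Y n \<omega> j)) \<partial>M)" by (simp only: cosRe)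
      also have "\<dots> = Re (\<integral>\<omega>. exp (\<i> * of_real \<theta>) * iexp (\<Sum>j<m. t j * Y n \<omega> j) \<partial>M)"
        by (rule integral_Re[OF integrable_mult_right[OF ci]])
      also have "(\<integral>\<omega>. exp (\<i> * of_real \<theta>) * iexp (\<Sum>j<m. t j * Y n \<omega> j) \<partial>M) = exp (\<i> * of_real \<theta>) * (\<integral>\<omega>. iexp (\<Sum>j<m. t j * Y n \<omega> j) \<partial>M)"
        by simp
      finally show ?thesis .
    qed
    have 2: "(\<integral>x. cos ((\<Sum>j<m. t j * x j) + \<theta>) \<partial>\<nu>)
       = Re (exp (\<i> * of_real \<theta>) * of_real (exp (- (\<Sum>k\<in>{1..<m}. (cmod (fourier_coeff m t k))\<^sup>2 * \<Lambda> k) / 2)))"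
    proof -
      interpret nu: prob_space \<nu> by (rule \<nu>)
      have "(\<lambda>x. iexp (\<Sum>j<m. t j * x j)) \<in> borel_measurable (vec_borel m)"
        using vec_linear_measurable[of "{}" t m] by measurable
      then have "(\<lambda>x. iexp (\<Sum>j<m. t j * x j)) \<in> borel_measurable \<nu>"
        using measurable_cong_sets[OF \<nu>(2) refl] by blast
      then have ci': "integrable \<nu> (\<lambda>x. iexp (\<Sum>j<m. t j * x j))"
        by (intro nu.integrable_const_bound[where B = 1]) auto
      have "(\<integral>x. cos ((\<Sum>j<m. t j * x j) + \<theta>) \<partial>\<nu>) = (\<integral>x. Re (exp (\<i> * of_real \<theta>) * iexp (\<Sum>j<m. t j * x j)) \<partial>\<nu>)"
        by (simp only: cosRe)
      also have "\<dots> = Re (\<integral>x. exp (\<i> * of_real \<theta>) * iexp (\<Sum>j<m. t j * x j) \<partial>\<nu>)"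
        by (rule integral_Re[OF integrable_mult_right[OF ci']])
      also have "(\<integral>x. exp (\<i> * of_real \<theta>) * iexp (\<Sum>j<m. t j * x j) \<partial>\<nu>) = exp (\<i> * of_real \<theta>) * (\<integral>x. iexp (\<Sum>j<m. t j * x j) \<partial>\<nu>)"
        by simp
      also have "(\<integral>x. iexp (\<Sum>j<m. t j * x j) \<partial>\<nu>) = of_real (exp (- (\<Sum>k\<in>{1..<m}. (cmod (fourier_coeff m t k))\<^sup>2 * \<Lambda> k) / 2))"
      proof -
        have "(\<Sum>x\<in>?I. (\<Sum>i<m. t i * circulant_root m \<Lambda> i x)\<^sup>2) = (\<Sum>k\<in>{1..<m}. (cmod (fourier_coeff m t k))\<^sup>2 * \<Lambda> k)"
          by (rule circulant_root_linear[OF \<Lambda>0])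
        then show ?thesis unfolding \<nu>_def char_gauss_vec[OF finI] by (rule arg_cong)
      qed
      finally show ?thesis .
    qed
    show "(\<lambda>n. \<integral>x. cos ((\<Sum>j<m. t j * x j) + \<theta>) \<partial>\<mu> n) \<longlonglongrightarrow> (\<integral>x. cos ((\<Sum>j<m. t j * x j) + \<theta>) \<partial>\<nu>)"
      unfolding 1 2 Y_def
      by (intro tendsto_Re tendsto_mult tendsto_const count_char_tendsto[where \<eta> = \<eta>] m g var gp \<eta> mom)
  qed
  then show ?thesis using mv unfolding weak_conv_normal_def \<mu>_def Y_def by blast
qed

end

section \<open>The limiting covariance matrices\<close>

definition root_cos :: "nat \<Rightarrow> nat \<Rightarrow> real" where
  "root_cos m r = cos (2 * pi * real r / real m)"

lemma Re_unit_root: "Re (unit_root m k) = root_cos m k"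
  by (simp add: unit_root_def root_cos_def)

lemma root_cos_mod: "m > 0 \<Longrightarrow> root_cos m (r mod m) = root_cos m r"
proof -
  assume m: "m > 0"
  have "root_cos m r = Re (unit_root m 1 ^ r)" for r
    by (simp add: unit_root_def root_cos_def Complex.DeMoivre mult_ac)
  then show ?thesis using unit_root_power_mod[OF m, of 1 r] by simp
qed

lemma root_cos_minus: "m > 0 \<Longrightarrow> k \<le> m \<Longrightarrow> root_cos m (m - k) = root_cos m k"
proof -
  assume "m > 0" "k \<le> m"
  then have "2 * pi * real (m - k) / real m = 2 * pi - 2 * pi * real k / real m"
    by (simp add: of_nat_diff diff_divide_distrib right_diff_distrib)
  then show ?thesis unfolding root_cos_def by (simp only: cos_2pi_minus)
qed

text \<open>The cosine decreases on \<open>[0, pi]\<close>, and indices above \<open>m / 2\<close>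
  are reflected to \<open>m - k\<close>.\<close>

lemma root_cos_le:
  assumes a: "a \<le> k" "k \<le> m - a" "2 * a \<le> m" and m: "m > 0"
  shows "root_cos m k \<le> root_cos m a"
proof -
  have *: "root_cos m k \<le> root_cos m a" if k: "a \<le> k" "2 * k \<le> m" for k
  proof -
    have "2 * pi * real k / real m \<le> pi"
    proof -
      have "real (2 * k) \<le> real m" using k(2) by (simp only: of_nat_le_iff)
      then have "pi * (2 * real k) \<le> pi * real m" by (intro mult_left_mono) auto
      then show ?thesis using m by (simp add: divide_le_eq mult_ac)
    qed
    moreover have "2 * pi * real a / real m \<le> 2 * pi * real k / real m"
      using k m by (intro divide_right_mono mult_left_mono) auto
    ultimately show ?thesis unfolding root_cos_def by (intro cos_monotone_0_pi_le) auto
  qed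
  show ?thesis
  proof (cases "2 * k \<le> m")
    case False
    then have "root_cos m (m - k) \<le> root_cos m a" using a by (intro *) auto
    then show ?thesis using root_cos_minus[of m k] a m by simp
  qed (use * a in auto)
qed

text \<open>\<open>i + (m - j)\<close> stands for \<open>i - j\<close> in natural numbers; reduced
  modulo \<open>m\<close>, each entry becomes a combination of finitely many tabulated
  cosines.\<close>

lemma circulant_cov_root_cos:
  assumes m: "m > 0" and j: "j < m"
  shows "circulant_cov m \<Lambda> i j = (\<Sum>k\<in>{1..<m}. \<Lambda> k * root_cos m ((k * (i + (m - j))) mod m)) / (real m)\<^sup>2"
proof -
  have "cos (2 * pi * real k * (real i - real j) / real m) = root_cos m ((k * (i + (m - j))) mod m)" for k
  proof -
    have "2 * pi * real (k * (i + (m - j))) / real m = 2 * pi * real k * (real i - real j) / real m + 2 * real k * pi"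
      using m j by (simp add: of_nat_diff field_simps)
    then have "cos (2 * pi * real (k * (i + (m - j))) / real m) = cos (2 * pi * real k * (real i - real j) / real m)"
      by (simp only: cos_add cos_2npi sin_2npi mult_1_right mult_zero_right diff_zero)
    then show ?thesis using root_cos_mod[OF m, of "k * (i + (m - j))"] by (simp add: root_cos_def)
  qed
  then show ?thesis by (simp add: circulant_cov_def)
qed

lemma root_cos_0 [simp]: "root_cos m 0 = 1"
  by (simp add: root_cos_def)

lemma root_cos_2: "root_cos 2 (Suc 0) = -1"
  by (simp add: root_cos_def)

lemma root_cos_3: "root_cos 3 (Suc 0) = -1/2" "root_cos 3 2 = -1/2"
proof -
  show 1: "root_cos 3 (Suc 0) = -1/2" by (simp add: root_cos_def cos_120)
  show "root_cos 3 2 = -1/2" using root_cos_minus[of 3 "Suc 0"] 1 by simp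
qed

lemma root_cos_4: "root_cos 4 (Suc 0) = 0" "root_cos 4 2 = -1" "root_cos 4 3 = 0"
proof -
  have "2 * pi * real (Suc 0) / real 4 = pi / 2" by simp
  then show 1: "root_cos 4 (Suc 0) = 0" unfolding root_cos_def by (simp only: cos_pi_half)
  show "root_cos 4 2 = -1" by (simp add: root_cos_def)
  show "root_cos 4 3 = 0" using root_cos_minus[of 4 "Suc 0"] 1 by simp
qed

text \<open>The angles 4 pi / 5 and 6 pi / 5 have equal cosines; equating the double and triple
  angle formulas and cancelling \<open>c - 1\<close> gives a quadratic equation. Keeping
  \<open>c\<close> as its positive root avoids radicals, and 2/5 is a convenient rational bound
  below 1/2.\<close>

lemma root_cos_5:
  obtains c where "root_cos 5 (Suc 0) = c" "root_cos 5 4 = c" "root_cos 5 2 = -1/2 - c" "root_cos 5 3 = -1/2 - c"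
    "c * c = (1 - 2 * c) / 4" "0 < c" "c \<le> 2 / 5"
proof -
  define c where "c = root_cos 5 1"
  have ce: "c = cos (2 * pi / 5)" by (simp add: c_def root_cos_def)
  have c0: "c > 0" unfolding ce using pi_gt_zero by (intro cos_gt_zero) auto
  have c1: "c < 1"
    unfolding ce using cos_monotone_0_pi[of 0 "2 * pi / 5"] by simp
  have r2: "root_cos 5 2 = 2 * c\<^sup>2 - 1"
    using cos_double_cos[of "2 * pi / 5"] by (simp add: ce root_cos_def)
  have r3: "root_cos 5 3 = 4 * c ^ 3 - 3 * c"
    using cos_treble_cos[of "2 * pi / 5"] by (simp add: ce root_cos_def)
  have "root_cos 5 3 = root_cos 5 2" using root_cos_minus[of 5 2] by simp
  then have "(c - 1) * (4 * c\<^sup>2 + 2 * c - 1) = 0" using r2 r3 by (simp add: algebra_simps power2_eq_square power3_eq_cube)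
  then have q: "4 * c\<^sup>2 + 2 * c - 1 = 0" using c1 by simp
  have le: "c \<le> 2 / 5"
  proof (rule ccontr)
    assume "\<not> c \<le> 2 / 5"
    then have "c\<^sup>2 > (2 / 5)\<^sup>2" by (intro power_strict_mono) auto
    then show False using q \<open>\<not> c \<le> 2 / 5\<close> by (simp add: power2_eq_square)
  qed
  show ?thesis
  proof (rule that[of c])
    show "root_cos 5 (Suc 0) = c" by (simp add: c_def)
    show "root_cos 5 4 = c" using root_cos_minus[of 5 1] by (simp add: c_def)
    show "root_cos 5 2 = -1/2 - c" using r2 q by simp
    then show "root_cos 5 3 = -1/2 - c" using \<open>root_cos 5 3 = root_cos 5 2\<close> by simp
    show "c * c = (1 - 2 * c) / 4" using q by (simp add: power2_eq_square)
  qed (use c0 le in auto)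
qed

lemma root_cos_6: "root_cos 6 (Suc 0) = 1/2" "root_cos 6 5 = 1/2" "root_cos 6 2 = -1/2" "root_cos 6 4 = -1/2" "root_cos 6 3 = -1"
proof -
  show 1: "root_cos 6 (Suc 0) = 1/2" by (simp add: root_cos_def cos_60)
  show "root_cos 6 5 = 1/2" using root_cos_minus[of 6 1] 1 by simp
  show 2: "root_cos 6 2 = -1/2" using root_cos_3(1) by (simp add: root_cos_def)
  show "root_cos 6 4 = -1/2" using root_cos_minus[of 6 2] 2 by simp
  show "root_cos 6 3 = -1" by (simp add: root_cos_def)
qed

lemma circulant_cov_Sigma2:
  assumes "i < 2" "j < 2"
  shows "circulant_cov 2 (\<lambda>k. 1 / (1 - 2 * root_cos 2 k)) i j = Sigma2 i j"
proof -
  have S: "{Suc 0..<2} = {Suc 0}" by auto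
  have "i \<in> {0, 1}" "j \<in> {0, 1}" using assms by auto
  then show ?thesis using assms
    by (auto simp: circulant_cov_root_cos S root_cos_2 Sigma2_def scaled_matrix_def)
qed

lemma circulant_cov_Sigma3:
  assumes "i < 3" "j < 3"
  shows "circulant_cov 3 (\<lambda>k. 1 / (1 - 2 * root_cos 3 k)) i j = Sigma3 i j"
proof -
  have S: "{Suc 0..<3} = {Suc 0, 2}" by auto
  have "i \<in> {0, 1, 2}" "j \<in> {0, 1, 2}" using assms by auto
  then show ?thesis using assms
    by (auto simp: circulant_cov_root_cos S root_cos_3 Sigma3_def scaled_matrix_def)
qed

lemma circulant_cov_Sigma4:
  assumes "i < 4" "j < 4"
  shows "circulant_cov 4 (\<lambda>k. 1 / (1 - 2 * root_cos 4 k)) i j = Sigma4 i j"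
proof -
  have S: "{Suc 0..<4} = {Suc 0, 2, 3}" by auto
  have "i \<in> {0, 1, 2, 3}" "j \<in> {0, 1, 2, 3}" using assms by auto
  then show ?thesis using assms
    by (auto simp: circulant_cov_root_cos S root_cos_4 Sigma4_def scaled_matrix_def)
qed

text \<open>Calculation modulo the quadratic relation: \<open>1 / (1 - 2 * c)\<close> equals
  \<open>2 + 2 * c\<close>, so all products reduce to linear terms in \<open>c\<close>, and these
  cancel in every entry.\<close>

lemma circulant_cov_Sigma5:
  assumes "i < 5" "j < 5"
  shows "circulant_cov 5 (\<lambda>k. 1 / (1 - 2 * root_cos 5 k)) i j = Sigma5 i j"
proof -
  obtain c where c: "root_cos 5 (Suc 0) = c" "root_cos 5 4 = c" "root_cos 5 2 = -1/2 - c" "root_cos 5 3 = -1/2 - c"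
    and q: "c * c = (1 - 2 * c) / 4" and c0: "0 < c" "c \<le> 2 / 5"
    by (rule root_cos_5)
  have "(1 - 2 * c) * (2 + 2 * c) = 1" using q by (simp add: algebra_simps)
  then have L1: "1 / (1 - 2 * c) = 2 + 2 * c" using c0 by (simp add: field_simps)
  have "(1 - 2 * (-1/2 - c)) * (1 - 2 * c) = 1" using q by (simp add: algebra_simps)
  then have L2: "1 / (1 - 2 * (-1/2 - c)) = 1 - 2 * c" using c0 by (simp add: field_simps)
  have S: "{Suc 0..<5} = {Suc 0, 2, 3, 4}" by auto
  define \<Lambda> where "\<Lambda> k = 1 / (1 - 2 * root_cos 5 k)" for k
  have L: "\<Lambda> (Suc 0) = 2 + 2 * c" "\<Lambda> 4 = 2 + 2 * c" "\<Lambda> 2 = 1 - 2 * c" "\<Lambda> 3 = 1 - 2 * c"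
    unfolding \<Lambda>_def c L1 L2 by (rule refl)+
  have A: "(2 + 2 * c) * c = 2 * c + 2 * (c * c)" "(2 + 2 * c) * (-1/2 - c) = -1 - 3 * c - 2 * (c * c)"
    "(1 - 2 * c) * c = c - 2 * (c * c)" "(1 - 2 * c) * (-1/2 - c) = -1/2 + 2 * (c * c)"
    by (simp_all add: algebra_simps)
  have F1: "(2 + 2 * c) * c = 1/2 + c" unfolding A(1) q by (simp add: field_split_simps)
  have F2: "(2 + 2 * c) * (-1/2 - c) = -3/2 - 2 * c" unfolding A(2) q by (simp add: field_split_simps)
  have F3: "(1 - 2 * c) * c = -1/2 + 2 * c" unfolding A(3) q by (simp add: field_split_simps)
  have F4: "(1 - 2 * c) * (-1/2 - c) = - c" unfolding A(4) q by (simp add: field_split_simps)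
  note F = F1 F2 F3 F4
  have P: "\<Lambda> (Suc 0) * root_cos 5 (Suc 0) = 1/2 + c" "\<Lambda> (Suc 0) * root_cos 5 4 = 1/2 + c"
    "\<Lambda> (Suc 0) * root_cos 5 2 = -3/2 - 2 * c" "\<Lambda> (Suc 0) * root_cos 5 3 = -3/2 - 2 * c"
    "\<Lambda> 4 * root_cos 5 (Suc 0) = 1/2 + c" "\<Lambda> 4 * root_cos 5 4 = 1/2 + c"
    "\<Lambda> 4 * root_cos 5 2 = -3/2 - 2 * c" "\<Lambda> 4 * root_cos 5 3 = -3/2 - 2 * c"
    "\<Lambda> 2 * root_cos 5 (Suc 0) = -1/2 + 2 * c" "\<Lambda> 2 * root_cos 5 4 = -1/2 + 2 * c"
    "\<Lambda> 2 * root_cos 5 2 = - c" "\<Lambda> 2 * root_cos 5 3 = - c"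
    "\<Lambda> 3 * root_cos 5 (Suc 0) = -1/2 + 2 * c" "\<Lambda> 3 * root_cos 5 4 = -1/2 + 2 * c"
    "\<Lambda> 3 * root_cos 5 2 = - c" "\<Lambda> 3 * root_cos 5 3 = - c"
    unfolding c L F by (rule refl)+
  have "i \<in> {0, 1, 2, 3, 4}" "j \<in> {0, 1, 2, 3, 4}" using assms by auto
  then have "circulant_cov 5 \<Lambda> i j = Sigma5 i j" using assms
    by (auto simp: circulant_cov_root_cos S P Sigma5_def scaled_matrix_def) (simp_all add: L)
  then show ?thesis by (simp add: \<Lambda>_def[abs_def])
qed

lemma circulant_cov_Sigma6:
  assumes "i < 6" "j < 6"
  shows "circulant_cov 6 (\<lambda>k. if k = 1 \<or> k = 5 then 1 else 0) i j = Sigma6 i j"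
proof -
  have S: "{Suc 0..<6} = {Suc 0, 2, 3, 4, 5}" by auto
  have "i \<in> {0, 1, 2, 3, 4, 5}" "j \<in> {0, 1, 2, 3, 4, 5}" using assms by auto
  then show ?thesis using assms
    by (auto simp: circulant_cov_root_cos S root_cos_6 Sigma6_def scaled_matrix_def)
qed

section \<open>Normal limits for m at most 6\<close>

lemma weak_conv_normal_cong:
  assumes "weak_conv_normal m \<mu> a S" "\<And>i j. i < m \<Longrightarrow> j < m \<Longrightarrow> S i j = S' i j"
  shows "weak_conv_normal m \<mu> a S'"
proof -
  obtain \<nu> where \<nu>: "mv_normal m a S \<nu>" "weak_conv_vec m \<mu> \<nu>"
    using assms(1) unfolding weak_conv_normal_def by blast
  have "mv_normal m a S' \<nu>" using \<nu>(1) assms(2) unfolding mv_normal_def by simp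
  then show ?thesis using \<nu>(2) unfolding weak_conv_normal_def by blast
qed

lemma linear_log_le:
  assumes "n \<ge> 1"
  shows "real n * (1 + ln (real n)) \<le> 2 * real n powr (3/2)"
proof -
  have n: "real n > 0" using assms by simp
  have "ln (sqrt (real n)) \<le> sqrt (real n) - 1" using n by (intro ln_le_minus_one) auto
  moreover have "ln (sqrt (real n)) = ln (real n) / 2" using n by (simp add: ln_sqrt)
  ultimately have "1 + ln (real n) \<le> 2 * sqrt (real n)" by simp
  then have "real n * (1 + ln (real n)) \<le> real n * (2 * sqrt (real n))" by (intro mult_left_mono) auto
  also have "\<dots> = 2 * real n powr (3/2)"
    using n powr_add[of "real n" 1 "1/2"] by (simp add: powr_half_sqrt)
  finally show ?thesis .
qed

context random_recursive_tree
begin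

lemma level_moment_le_half:
  assumes "cmod z = 1" "Re z \<le> 1/2" "n \<ge> 1"
  shows "level_moment z n \<le> real n * (1 + ln (real n))"
proof (rule second_moment_recursion_half[where c = "Re z"])
  show "level_moment z 1 = 1" using level_moment_1 by simp
qed (use assms level_moment_Suc level_moment_nonneg in auto)

text \<open>Since \<open>(n / l) powr (2/5)\<close> is
  \<open>sqrt n * n powr (-1/10) * l powr (-2/5)\<close>, a cosine of at most 2/5 leaves the null
  factor \<open>n powr (-1/10)\<close>. The constant 5 is \<open>1 / (1 - 4/5)\<close>.\<close>

lemma weak_conv_normal_small:
  assumes m: "m > 0" and c: "\<And>k. k \<in> {1..<m} \<Longrightarrow> root_cos m k \<le> 2 / 5"
  shows "weak_conv_normal m (\<lambda>n. vec_law m M (\<lambda>\<omega> j. (level_count m (\<lambda>k. parent k \<omega>) n j - real n / real m) / sqrt (real n)))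
      (\<lambda>_. 0) (circulant_cov m (\<lambda>k. 1 / (1 - 2 * root_cos m k)))"
proof (rule weak_conv_normal_counts[OF m, where g = "\<lambda>n. sqrt (real n)" and \<eta> = "\<lambda>n. exp 1 * real n powr (-1/10)" and C = 5])
  fix k assume k: "k \<in> {1..<m}"
  show "(\<lambda>n. growth_sum (unit_root m k) n / (sqrt (real n))\<^sup>2) \<longlonglongrightarrow> 1 / (1 - 2 * root_cos m k)"
    using growth_sum_tendsto[of "unit_root m k"] c[OF k] by (simp add: Re_unit_root)
  show "level_moment (unit_root m k) l \<le> 2 * real l powr (3/2)" if "1 \<le> l" for l
    using level_moment_le_half[of "unit_root m k" l] linear_log_le[OF that] c[OF k] that by (simp add: Re_unit_root)
  show "level_moment (unit_root m k) n \<le> 5 * (sqrt (real n))\<^sup>2" if "2 \<le> n" for n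
    using second_moment_recursion_linear[of "level_moment (unit_root m k)" "root_cos m k" "2/5" n]
      level_moment_1 level_moment_nonneg level_moment_Suc[of "unit_root m k"] c[OF k] that by (simp add: Re_unit_root)
  fix l n :: nat assume l: "1 \<le> l" "l < n"
  have "cmod (growth_prod (unit_root m k) (Suc l) n) \<le> exp 1 * (real n / real l) powr (2/5)"
    using c[OF k] l by (intro norm_growth_prod_le) (auto simp: Re_unit_root)
  also have "(real n / real l) powr (2/5) = real n powr (2/5) * real l powr (-2/5)"
    using l by (simp add: powr_divide powr_minus_divide)
  also have "real n powr (2/5) = sqrt (real n) * real n powr (-1/10)"
    using powr_add[of "real n" "1/2" "-1/10"] by (simp add: powr_half_sqrt)
  finally show "cmod (growth_prod (unit_root m k) (Suc l) n) \<le> sqrt (real n) * (exp 1 * real n powr (-1/10)) * real l powr (-2/5)"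
    by (simp add: mult_ac)
next
  show "(\<lambda>n. exp 1 * real n powr (-1/10)) \<longlonglongrightarrow> 0" by real_asymp
qed auto

lemma weak_conv_normal_6:
  "weak_conv_normal 6 (\<lambda>n. vec_law 6 M (\<lambda>\<omega> j. (level_count 6 (\<lambda>k. parent k \<omega>) n j - real n / real 6) / sqrt (real n * ln (real n))))
      (\<lambda>_. 0) (circulant_cov 6 (\<lambda>k. if k = 1 \<or> k = 5 then 1 else 0))"
\<comment> \<open>Here the null factor comes from the logarithm in the normalisation, and
  \<open>1 + 1 / ln 2\<close> absorbs the summand 1 of \<open>1 + ln n\<close> for
  \<open>n \<ge> 2\<close>. Frequencies 2, 3 and 4 have variance of order \<open>n\<close> and
  disappear at this scale.\<close>
proof (rule weak_conv_normal_counts[where g = "\<lambda>n. sqrt (real n * ln (real n))" and \<eta> = "\<lambda>n. exp 1 / sqrt (ln (real n))" and C = "1 + 1 / ln 2"])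
  fix k :: nat assume k: "k \<in> {1..<6}"
  have c: "root_cos 6 k \<le> 1/2" using root_cos_le[of 1 k 6] root_cos_6(1) k by simp
  have sq: "(sqrt (real n * ln (real n)))\<^sup>2 = real n * ln (real n)" for n
    by (cases "n = 0") auto
  show "(\<lambda>n. growth_sum (unit_root 6 k) n / (sqrt (real n * ln (real n)))\<^sup>2) \<longlonglongrightarrow> (if k = 1 \<or> k = 5 then 1 else 0)"
  proof (cases "k = 1 \<or> k = 5")
    case True
    then have "root_cos 6 k = 1/2" using root_cos_6 by auto
    then show ?thesis using growth_sum_tendsto_half[of "unit_root 6 k"] True unfolding sq by (simp add: Re_unit_root)
  next
    case False
    then have "k = 2 \<or> k = 3 \<or> k = 4" using k by auto
    then have "root_cos 6 k < 1/2" using root_cos_6 by auto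
    then have "(\<lambda>n. growth_sum (unit_root 6 k) n / real n) \<longlonglongrightarrow> 1 / (1 - 2 * root_cos 6 k)"
      using growth_sum_tendsto[of "unit_root 6 k"] by (simp add: Re_unit_root)
    moreover have "(\<lambda>n. 1 / ln (real n)) \<longlonglongrightarrow> 0" by real_asymp
    ultimately have "(\<lambda>n. growth_sum (unit_root 6 k) n / real n * (1 / ln (real n))) \<longlonglongrightarrow> 1 / (1 - 2 * root_cos 6 k) * 0"
      by (rule tendsto_mult)
    then show ?thesis using False unfolding sq by simp
  qed
  show "level_moment (unit_root 6 k) l \<le> 2 * real l powr (3/2)" if "1 \<le> l" for l
    using level_moment_le_half[of "unit_root 6 k" l] linear_log_le[OF that] c that by (simp add: Re_unit_root)
  show "level_moment (unit_root 6 k) n \<le> (1 + 1 / ln 2) * (sqrt (real n * ln (real n)))\<^sup>2" if n: "2 \<le> n" for n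
  proof -
    have "level_moment (unit_root 6 k) n \<le> real n * (1 + ln (real n))"
      using level_moment_le_half[of "unit_root 6 k" n] c n by (simp add: Re_unit_root)
    also have "1 + ln (real n) \<le> (1 + 1 / ln 2) * ln (real n)"
    proof -
      have "ln 2 \<le> ln (real n)" using n by simp
      then have "1 \<le> ln (real n) / ln 2" by simp
      then show ?thesis by (simp add: distrib_right)
    qed
    finally show ?thesis unfolding sq by (simp add: mult_left_mono mult.left_commute)
  qed
  fix l n :: nat assume l: "1 \<le> l" "l < n"
  then have n: "n \<ge> 2" by simp
  have ln: "ln (real n) > 0" using n by simp
  have "cmod (growth_prod (unit_root 6 k) (Suc l) n) \<le> exp 1 * (real n / real l) powr (1/2)"
    using c l by (intro norm_growth_prod_le) (auto simp: Re_unit_root)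
  also have "(real n / real l) powr (1/2) = sqrt (real n) * real l powr (-1/2)"
    using l by (simp add: powr_divide powr_minus_divide powr_half_sqrt)
  also have "real l powr (-1/2) \<le> real l powr (-2/5)" using l by (intro powr_mono) auto
  also have "exp 1 * (sqrt (real n) * real l powr (-2/5)) = sqrt (real n * ln (real n)) * (exp 1 / sqrt (ln (real n))) * real l powr (-2/5)"
    using ln by (simp add: real_sqrt_mult)
  finally show "cmod (growth_prod (unit_root 6 k) (Suc l) n) \<le> sqrt (real n * ln (real n)) * (exp 1 / sqrt (ln (real n))) * real l powr (-2/5)"
    by (simp add: mult_left_mono)
next
  show "(\<lambda>n. exp 1 / sqrt (ln (real n))) \<longlonglongrightarrow> 0" by real_asymp
  show "exp 1 / sqrt (ln (real n)) \<ge> 0" for n by (cases "n = 0") auto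
qed auto

end

section \<open>The almost sure regime\<close>

definition noise :: "complex \<Rightarrow> nat \<Rightarrow> (nat \<Rightarrow> nat) \<Rightarrow> complex" where
  "noise z l p = z ^ level p l - z * level_sum z p l / of_nat l"

lemma level_sum_Suc: "l \<ge> 1 \<Longrightarrow> level_sum z p (Suc l) = (1 + z / of_nat l) * level_sum z p l + noise z l p"
  by (simp add: level_sum_def noise_def algebra_simps)

lemma past_noise: "past (Suc l) (noise z l)"
proof -
  have 1: "past (Suc l) (\<lambda>p. level_sum z p l)" by (rule past_mono[OF past_level_sum]) simp
  have 2: "past (Suc l) (\<lambda>p. level p l)" by (rule past_level) simp
  show ?thesis
    unfolding noise_def[abs_def] by (rule past_comp2[where h = "\<lambda>x y. z ^ x - z * y / of_nat l", OF 2 1])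
qed

lemma norm_noise_le:
  assumes z: "cmod z = 1"
  shows "cmod (noise z l p) \<le> 2"
proof -
  have "cmod (level_sum z p l) \<le> (\<Sum>v<l. 1)"
    unfolding level_sum_def by (rule order_trans[OF norm_sum]) (simp add: norm_power z)
  then have "cmod (level_sum z p l) / real l \<le> 1" by (simp add: divide_le_eq)
  then have "cmod (z ^ level p l) + cmod (z * level_sum z p l / of_nat l) \<le> 2"
    by (simp add: norm_power norm_mult norm_divide z)
  then show ?thesis unfolding noise_def by (rule order_trans[OF norm_triangle_ineq4])
qed

lemma sum_noise_eq_0:
  assumes l: "l \<ge> 1"
  shows "(\<Sum>v<l. noise z l (p(l := v))) = 0"
proof -
  have "level_sum z (p(l := v)) l = level_sum z p l" for v
    by (rule past_upd[OF past_level_sum]) simp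
  then have "(\<Sum>v<l. noise z l (p(l := v))) = (\<Sum>v<l. z * z ^ level p v - z * level_sum z p l / of_nat l)"
    using l by (intro sum.cong refl) (simp add: noise_def level_upd)
  also have "\<dots> = z * level_sum z p l - of_nat l * (z * level_sum z p l / of_nat l)"
    by (simp add: sum_subtractf level_sum_def[of z p l] sum_distrib_left)
  also have "\<dots> = 0" using l by simp
  finally show ?thesis by simp
qed

text \<open>Variation of constants for \<open>level_sum_Suc\<close>; dividing by
  \<open>growth_prod z 1 n\<close> leaves the martingale of the overview.\<close>

lemma level_sum_eq_growth_prod:
  assumes nz: "\<And>n. growth_prod z 1 n \<noteq> 0" and n: "n \<ge> 1"
  shows "level_sum z p n = growth_prod z 1 n * (1 + (\<Sum>l\<in>{1..<n}. inverse (growth_prod z 1 (Suc l)) * noise z l p))"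
  using n
proof (induction n rule: dec_induct)
  case base
  then show ?case by (simp add: level_sum_def)
next
  case (step n)
  define S where "S = (\<Sum>l\<in>{1..<n}. inverse (growth_prod z 1 (Suc l)) * noise z l p)"
  have "growth_prod z 1 (Suc n) = growth_prod z 1 n * (1 + z / of_nat n)"
    using step by (intro growth_prod_Suc) auto
  then have "level_sum z p (Suc n) = growth_prod z 1 (Suc n) * (1 + S) + noise z n p"
    using level_sum_Suc[of n z p] step by (simp add: S_def)
  also have "\<dots> = growth_prod z 1 (Suc n) * (1 + (S + inverse (growth_prod z 1 (Suc n)) * noise z n p))"
    using nz[of "Suc n"] by (simp add: distrib_left mult.assoc[symmetric])
  finally show ?case using step by (simp add: S_def)
qed

lemma norm_growth_factor_le:
  assumes z: "cmod z = 1" "Re z \<le> c" "0 \<le> c" and n: "n \<ge> 1"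
  shows "cmod (1 + z / of_nat n) \<le> 1 + c / real n + 1 / (2 * (real n)\<^sup>2)"
proof (rule power2_le_imp_le)
  define u where "u = c / real n + 1 / (2 * (real n)\<^sup>2)"
  have "(cmod (1 + z / of_nat n))\<^sup>2 \<le> 1 + 2 * c / real n + 1 / (real n)\<^sup>2"
    unfolding norm_growth_factor[OF z(1) n] using z n by (simp add: divide_right_mono)
  also have "\<dots> = 1 + 2 * u" by (simp add: u_def)
  also have "\<dots> \<le> (1 + u)\<^sup>2" by (simp add: power2_sum)
  finally show "(cmod (1 + z / of_nat n))\<^sup>2 \<le> (1 + c / real n + 1 / (2 * (real n)\<^sup>2))\<^sup>2"
    by (simp add: u_def add.assoc)
qed (use z in simp)

text \<open>
  With \<open>T\<^sub>n = (\<Sum>l<n. l powr -\<alpha> * \<xi>\<^sub>l)\<close> convergent, the difference of \<open>n powr -\<alpha> * Z\<^sub>n\<close> and \<open>T\<^sub>n - lim T\<close> obeys a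
  recursion with contraction factor \<open>1 - (\<alpha> - c) / n\<close> and an error \<open>o(1/n)\<close>, so no Kronecker lemma is needed.
\<close>
lemma perturbed_growth_tendsto_0:
  fixes Z \<xi> :: "nat \<Rightarrow> complex"
  assumes rec: "\<And>n. n \<ge> 1 \<Longrightarrow> Z (Suc n) = (1 + z / of_nat n) * Z n + \<xi> n"
    and z: "cmod z = 1" "Re z \<le> c" "0 \<le> c" and \<alpha>: "c < \<alpha>" "\<alpha> \<le> 1"
    and conv: "convergent (\<lambda>n. \<Sum>l\<in>{1..<n}. of_real (real l powr (-\<alpha>)) * \<xi> l)"
  shows "(\<lambda>n. of_real (real n powr (-\<alpha>)) * Z n) \<longlonglongrightarrow> 0"
proof -
  define T where "T n = (\<Sum>l\<in>{1..<n}. of_real (real l powr (-\<alpha>)) * \<xi> l)" for n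
  obtain T0 where T0: "T \<longlonglongrightarrow> T0" using conv by (auto simp: convergent_def T_def[abs_def])
  define R where "R n = T n - T0" for n
  have R0: "R \<longlonglongrightarrow> 0" using T0 unfolding R_def by (simp add: LIM_zero_iff)
  define y where "y n = of_real (real n powr (-\<alpha>)) * Z n" for n
  define x where "x n = cmod (y n - R n)" for n
  define r where "r n = (real n / real (Suc n)) powr \<alpha>" for n
  \<comment> \<open>Half of the gap: the combined factor of a step is 1 - (\<alpha> - c) / n + o(1 /
    n), so half of the rate holds eventually.\<close>
  define \<kappa> where "\<kappa> = (\<alpha> - c) / 2"
  have "(\<lambda>n. real n * (1 - (real n / (real n + 1)) powr \<alpha> * (1 + c / real n + 1 / (2 * (real n)\<^sup>2)))) \<longlonglongrightarrow> \<alpha> - c"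
    using \<alpha> z by real_asymp
  then have "eventually (\<lambda>n. real n * (1 - (real n / (real n + 1)) powr \<alpha> * (1 + c / real n + 1 / (2 * (real n)\<^sup>2))) > \<kappa>) sequentially"
    using \<alpha> by (intro order_tendstoD(1)) (auto simp: \<kappa>_def)
  then obtain N where N: "\<And>n. n \<ge> N \<Longrightarrow> real n * (1 - (real n / (real n + 1)) powr \<alpha> * (1 + c / real n + 1 / (2 * (real n)\<^sup>2))) > \<kappa>"
    by (auto simp: eventually_sequentially)
  have "x \<longlonglongrightarrow> 0"
  proof (rule contraction_tendsto_0[where kap = \<kappa> and N = "max 1 N" and e = "\<lambda>n. cmod (R n) + cmod (R (Suc n))"])
    fix n assume n: "n \<ge> max 1 N"
    then have n1: "n \<ge> 1" by simp
    have r1: "0 \<le> r n" "r n \<le> 1" using \<alpha> z by (auto simp: r_def intro!: powr_le1)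
    have "real n / real (Suc n) = (real n / real (Suc n)) powr 1" using n1 by simp
    also have "\<dots> \<le> r n"
    proof -
      have "0 < real n / real (Suc n)" "real n / real (Suc n) \<le> 1" using n1 by auto
      then show ?thesis unfolding r_def using \<alpha> powr_mono'[of \<alpha> 1 "real n / real (Suc n)"] by simp
    qed
    finally have "1 - r n \<le> 1 - real n / real (Suc n)" by simp
    also have "\<dots> = 1 / real (Suc n)" by (simp add: field_simps)
    also have "\<dots> \<le> 1 / real n" using n1 by (intro divide_left_mono) auto
    finally have r2: "1 - r n \<le> 1 / real n" .
    have fac: "r n * (1 + c / real n + 1 / (2 * (real n)\<^sup>2)) \<le> 1 - \<kappa> / real n"
      using N[of n] n n1 by (simp add: r_def field_simps)
    have pr: "real (Suc n) powr (-\<alpha>) = r n * real n powr (-\<alpha>)"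
      using n1 by (simp add: r_def powr_divide powr_minus field_simps del: of_nat_Suc)
    have inv: "real n powr (-\<alpha>) * real n powr \<alpha> = 1" using n1 by (simp add: powr_add[symmetric])
    have "T (Suc n) = T n + of_real (real n powr (-\<alpha>)) * \<xi> n" using n1 by (simp add: T_def)
    then have dR: "of_real (real n powr (-\<alpha>)) * \<xi> n = R (Suc n) - R n" by (simp add: R_def)
    have yS: "y (Suc n) = of_real (r n) * ((1 + z / of_nat n) * y n + (R (Suc n) - R n))"
      unfolding y_def rec[OF n1] pr dR[symmetric] by (simp add: algebra_simps)
    \<comment> \<open>The scaled noise is the increment of \<open>R\<close>, so subtracting
      \<open>R\<close> removes it; what is left are multiples of \<open>R n\<close> and
      \<open>R (Suc n)\<close> with coefficients of order \<open>1 / n\<close>.\<close>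
    have "y (Suc n) - R (Suc n) = of_real (r n) * (1 + z / of_nat n) * (y n - R n) + (of_real (r n) * (z / of_nat n) * R n + of_real (r n - 1) * R (Suc n))"
    proof -
      have "rr * ((1 + q) * Y + (R1 - R0)) - R1 = rr * (1 + q) * (Y - R0) + (rr * q * R0 + (rr - 1) * R1)"
        for rr q Y R0 R1 :: complex by (simp add: algebra_simps)
      then show ?thesis unfolding yS of_real_diff of_real_1 .
    qed
    then have "x (Suc n) \<le> cmod (of_real (r n) * (1 + z / of_nat n) * (y n - R n)) + (cmod (of_real (r n) * (z / of_nat n) * R n) + cmod (of_real (r n - 1) * R (Suc n)))"
      unfolding x_def by (metis norm_triangle_ineq norm_triangle_le add_left_mono order_trans)
    also have "cmod (of_real (r n) * (1 + z / of_nat n) * (y n - R n)) \<le> (1 - \<kappa> / real n) * x n"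
    proof -
      have "r n * cmod (1 + z / of_nat n) \<le> r n * (1 + c / real n + 1 / (2 * (real n)\<^sup>2))"
        using r1 norm_growth_factor_le[OF z n1] by (intro mult_left_mono) auto
      then have "r n * cmod (1 + z / of_nat n) \<le> 1 - \<kappa> / real n" using fac by linarith
      then show ?thesis using r1 by (simp add: x_def norm_mult mult_right_mono)
    qed
    also have "cmod (of_real (r n) * (z / of_nat n) * R n) \<le> cmod (R n) / real n"
      using r1 z n1 by (simp add: norm_mult norm_divide mult_left_le_one_le divide_right_mono)
    also have "cmod (of_real (r n - 1) * R (Suc n)) \<le> cmod (R (Suc n)) / real n"
      unfolding norm_mult norm_of_real using r1 r2 mult_right_mono[of "\<bar>r n - 1\<bar>" "1 / real n" "cmod (R (Suc n))"] by simp
    finally show "x (Suc n) \<le> (1 - \<kappa> / real n) * x n + (cmod (R n) + cmod (R (Suc n))) / real n"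
      by (simp add: add_divide_distrib)
  next
    have "(\<lambda>n. cmod (R n) + cmod (R (Suc n))) \<longlonglongrightarrow> cmod 0 + cmod 0"
      by (intro tendsto_intros R0 LIMSEQ_Suc)
    then show "(\<lambda>n. cmod (R n) + cmod (R (Suc n))) \<longlonglongrightarrow> 0" by simp
  qed (use \<alpha> in \<open>auto simp: x_def \<kappa>_def\<close>)
  then have "(\<lambda>n. y n - R n) \<longlonglongrightarrow> 0" unfolding x_def by (rule tendsto_norm_zero_cancel)
  from tendsto_add[OF this R0] show ?thesis by (simp add: y_def)
qed

context random_recursive_tree
begin

lemma AE_convergent_noise:
  assumes z: "cmod z = 1" and a: "\<And>l. l \<ge> 1 \<Longrightarrow> cmod (a l) \<le> K * real l powr (-\<alpha>)" and \<alpha>: "\<alpha> > 1/2"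
  shows "AE \<omega> in M. convergent (\<lambda>n. \<Sum>l\<in>{1..<n}. a l * noise z l (\<lambda>k. parent k \<omega>))"
proof (rule AE_convergent_martingale[where D = "\<lambda>l p. a l * noise z l p" and d = "\<lambda>l. 2 * K * real l powr (-\<alpha>)"])
  fix l :: nat and p :: "nat \<Rightarrow> nat" assume l: "l \<ge> 1"
  show "past (Suc l) (\<lambda>p. a l * noise z l p)" by (rule past_comp[OF past_noise])
  show "(\<Sum>v<l. a l * noise z l (p(l := v))) = 0" using sum_noise_eq_0[OF l] by (simp add: sum_distrib_left[symmetric])
  have "cmod (a l * noise z l p) \<le> (K * real l powr (-\<alpha>)) * 2"
    unfolding norm_mult using a[OF l] norm_noise_le[OF z] by (intro mult_mono order_trans[OF norm_ge_zero a[OF l]]) auto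
  then show "cmod (a l * noise z l p) \<le> 2 * K * real l powr (-\<alpha>)" by (simp add: mult_ac)
next
  have "(2 * K * real l powr (-\<alpha>))\<^sup>2 = (2 * K)\<^sup>2 * real l powr (-2 * \<alpha>)" for l
    by (simp add: power_mult_distrib power2_eq_square powr_add[symmetric])
  then show "summable (\<lambda>l. (2 * K * real l powr (-\<alpha>))\<^sup>2)"
    using \<alpha> summable_real_powr_iff[of "-2 * \<alpha>"] by (simp add: summable_mult)
qed

lemma AE_level_sum_small:
  assumes z: "cmod z = 1" "Re z < \<alpha>" and \<alpha>: "1/2 < \<alpha>" "\<alpha> \<le> 1"
  shows "AE \<omega> in M. (\<lambda>n. of_real (real n powr (-\<alpha>)) * level_sum z (\<lambda>k. parent k \<omega>) n) \<longlonglongrightarrow> 0"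
proof -
  have "AE \<omega> in M. convergent (\<lambda>n. \<Sum>l\<in>{1..<n}. of_real (real l powr (-\<alpha>)) * noise z l (\<lambda>k. parent k \<omega>))"
    using z \<alpha> by (intro AE_convergent_noise[where K = 1 and \<alpha> = \<alpha>]) auto
  then show ?thesis
  proof eventually_elim
    case (elim \<omega>)
    \<comment> \<open>The contraction asks for a nonnegative \<open>c\<close>, while
      \<open>Re z\<close> may be negative.\<close>
    show ?case
      by (rule perturbed_growth_tendsto_0[where z = z and c = "max 0 (Re z)" and \<xi> = "\<lambda>l. noise z l (\<lambda>k. parent k \<omega>)"])
        (use elim z \<alpha> level_sum_Suc in auto)
  qed
qed

text \<open>The product divided by its exponential form has the nonzero limit
  \<open>rGamma z / z\<close>: \<open>Re z > 0\<close> keeps \<open>z\<close> off the poles of Gamma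
  and the factors off 0. Hence the inverse products are of order \<open>l powr (-\<alpha>)\<close>,
  and \<open>2 * \<alpha> > 1\<close> makes the squared noise terms summable.\<close>

lemma AE_level_sum_convergent:
  assumes z: "cmod z = 1" "Re z = \<alpha>" and \<alpha>: "1/2 < \<alpha>"
  shows "AE \<omega> in M. convergent (\<lambda>n. level_sum z (\<lambda>k. parent k \<omega>) n / exp (z * of_real (ln (real n))))"
proof -
  have z0: "z \<noteq> 0" using z by auto
  have nz: "growth_prod z 1 n \<noteq> 0" for n
  proof -
    have "1 + z / of_nat i \<noteq> 0" if "i \<ge> 1" for i
    proof -
      have "Re (1 + z / of_nat i) > 0" using z \<alpha> by (simp add: add_pos_nonneg)
      then show ?thesis by (metis less_irrefl zero_complex.sel(1))
    qed
    then show ?thesis by (simp add: growth_prod_def)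
  qed
  have g: "(\<lambda>n. growth_prod z 1 n / exp (z * of_real (ln (real n)))) \<longlonglongrightarrow> rGamma z / z"
    by (rule growth_prod_asymptotics[OF z0])
  have rG: "rGamma z / z \<noteq> 0"
  proof -
    have "z \<notin> \<int>\<^sub>\<le>\<^sub>0" using z \<alpha> by (auto elim!: nonpos_Ints_cases)
    then show ?thesis using z0 by (simp add: rGamma_eq_zero_iff)
  qed
  have "convergent (\<lambda>n. inverse (growth_prod z 1 n / exp (z * of_real (ln (real n)))))"
    using tendsto_inverse[OF g rG] by (auto simp: convergent_def)
  then have "Bseq (\<lambda>n. inverse (growth_prod z 1 n / exp (z * of_real (ln (real n)))))"
    by (rule convergent_imp_Bseq)
  then obtain K where K: "K > 0" "\<And>n. cmod (inverse (growth_prod z 1 n / exp (z * of_real (ln (real n))))) \<le> K"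
    by (auto elim: BseqE)
  have a: "cmod (inverse (growth_prod z 1 (Suc l))) \<le> K * real l powr (-\<alpha>)" if l: "l \<ge> 1" for l
  proof -
    have e: "cmod (exp (z * of_real (ln (real (Suc l))))) = real (Suc l) powr \<alpha>"
      by (simp add: z powr_def mult_ac)
    have "cmod (inverse (growth_prod z 1 (Suc l))) * real (Suc l) powr \<alpha> \<le> K"
      using K(2)[of "Suc l"] unfolding inverse_divide norm_divide e by (simp add: norm_inverse divide_inverse mult.commute)
    then have "cmod (inverse (growth_prod z 1 (Suc l))) \<le> K * real (Suc l) powr (-\<alpha>)"
      by (simp add: powr_minus field_simps)
    also have "\<dots> \<le> K * real l powr (-\<alpha>)"
      using K(1) l \<alpha> by (intro mult_left_mono powr_mono2') auto
    finally show ?thesis .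
  qed
  have "AE \<omega> in M. convergent (\<lambda>n. \<Sum>l\<in>{1..<n}. inverse (growth_prod z 1 (Suc l)) * noise z l (\<lambda>k. parent k \<omega>))"
    by (rule AE_convergent_noise[OF z(1) a \<alpha>])
  then show ?thesis
  proof eventually_elim
    case (elim \<omega>)
    then obtain S where S: "(\<lambda>n. \<Sum>l\<in>{1..<n}. inverse (growth_prod z 1 (Suc l)) * noise z l (\<lambda>k. parent k \<omega>)) \<longlonglongrightarrow> S"
      by (auto simp: convergent_def)
    have "(\<lambda>n. growth_prod z 1 n / exp (z * of_real (ln (real n))) * (1 + (\<Sum>l\<in>{1..<n}. inverse (growth_prod z 1 (Suc l)) * noise z l (\<lambda>k. parent k \<omega>))))
       \<longlonglongrightarrow> rGamma z / z * (1 + S)"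
      by (intro tendsto_intros g S)
    moreover have "eventually (\<lambda>n. growth_prod z 1 n / exp (z * of_real (ln (real n))) * (1 + (\<Sum>l\<in>{1..<n}. inverse (growth_prod z 1 (Suc l)) * noise z l (\<lambda>k. parent k \<omega>)))
       = level_sum z (\<lambda>k. parent k \<omega>) n / exp (z * of_real (ln (real n)))) sequentially"
      using eventually_ge_at_top[of 1] by eventually_elim (simp add: level_sum_eq_growth_prod[OF nz])
    ultimately have "(\<lambda>n. level_sum z (\<lambda>k. parent k \<omega>) n / exp (z * of_real (ln (real n)))) \<longlonglongrightarrow> rGamma z / z * (1 + S)"
      by (rule Lim_transform_eventually)
    then show ?case by (auto simp: convergent_def)
  qed
qed

end

section \<open>Dominant frequency and passage to convergence in distribution\<close>

lemma weak_conv_vec_AE: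
  fixes V :: "nat \<Rightarrow> 'a \<Rightarrow> nat \<Rightarrow> real"
  assumes M: "prob_space M"
    and V: "\<And>n j. j < m \<Longrightarrow> (\<lambda>\<omega>. V n \<omega> j) \<in> borel_measurable M"
    and V': "\<And>j. j < m \<Longrightarrow> (\<lambda>\<omega>. V' \<omega> j) \<in> borel_measurable M"
    and lim: "AE \<omega> in M. \<forall>j<m. (\<lambda>n. V n \<omega> j) \<longlonglongrightarrow> V' \<omega> j"
  shows "weak_conv_vec m (\<lambda>n. vec_law m M (V n)) (vec_law m M V')"
  unfolding weak_conv_vec_def
proof (intro allI impI)
  interpret prob_space M by fact
  fix f assume f: "continuous_map (vec_topology m) euclideanreal f \<and> bounded (f ` topspace (vec_topology m))"
  then have "bounded (f ` topspace (vec_topology m))" by blast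
  then obtain B where B: "\<And>x. x \<in> topspace (vec_topology m) \<Longrightarrow> \<bar>f x\<bar> \<le> B"
    unfolding bounded_iff by auto
  have fm: "f \<in> borel_measurable (vec_borel m)" using f by (intro borel_measurable_vec) simp
  note Vm = vec_law_measurable[of m, OF V] and V'm = vec_law_measurable[of m, OF V']
  have "(\<lambda>n. \<integral>\<omega>. f (\<lambda>j\<in>{..<m}. V n \<omega> j) \<partial>M) \<longlonglongrightarrow> (\<integral>\<omega>. f (\<lambda>j\<in>{..<m}. V' \<omega> j) \<partial>M)"
  proof (rule integral_dominated_convergence[where w = "\<lambda>_. B"])
    show "(\<lambda>\<omega>. f (\<lambda>j\<in>{..<m}. V' \<omega> j)) \<in> borel_measurable M" by (rule measurable_compose[OF V'm fm])
    show "(\<lambda>\<omega>. f (\<lambda>j\<in>{..<m}. V n \<omega> j)) \<in> borel_measurable M" for n by (rule measurable_compose[OF Vm fm])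
    show "AE \<omega> in M. (\<lambda>n. f (\<lambda>j\<in>{..<m}. V n \<omega> j)) \<longlonglongrightarrow> f (\<lambda>j\<in>{..<m}. V' \<omega> j)"
      using lim
    proof eventually_elim
      case (elim \<omega>)
      have "limitin (vec_topology m) (\<lambda>n. \<lambda>j\<in>{..<m}. V n \<omega> j) (\<lambda>j\<in>{..<m}. V' \<omega> j) sequentially"
        using elim by (auto simp: limitin_componentwise)
      from continuous_map_limit[OF conjunct1[OF f] this]
      show ?case by (simp add: comp_def)
    qed
    show "AE \<omega> in M. norm (f (\<lambda>j\<in>{..<m}. V n \<omega> j)) \<le> B" for n
      using B by auto
  qed simp
  then show "(\<lambda>n. integral\<^sup>L (vec_law m M (V n)) f) \<longlonglongrightarrow> integral\<^sup>L (vec_law m M V') f"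
    unfolding vec_law_def by (simp only: integral_distr[OF Vm fm] integral_distr[OF V'm fm])
qed

lemma cis_rmod: "cis (x rmod (2 * pi)) = cis x"
proof -
  have "cis (x rmod (2 * pi)) = cis (x - 2 * pi * of_int \<lfloor>x / (2 * pi)\<rfloor>)"
    by (simp add: rmod_def mult_ac)
  also have "\<dots> = cis x / cis (2 * pi * of_int \<lfloor>x / (2 * pi)\<rfloor>)" by (rule cis_divide[symmetric])
  also have "cis (2 * pi * of_int \<lfloor>x / (2 * pi)\<rfloor>) = 1" by (rule cis_multiple_2pi) simp
  finally show ?thesis by simp
qed

text \<open>For measurability: the counts of the theorem are functions of finitely many parents
  everywhere, while their agreement with \<open>level_count\<close> is known only almost
  surely.\<close>

lemma residue_count_past: "past n (\<lambda>p. residue_count m p n j)"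
proof (rule pastI)
  fix p q :: "nat \<Rightarrow> nat" assume pq: "\<And>i. 1 \<le> i \<Longrightarrow> i < n \<Longrightarrow> p i = q i"
  have "tree_edges p n = tree_edges q n"
    unfolding tree_edges_def by (intro SUP_cong refl) (simp add: pq)
  then have "depth p n v = depth q n v" for v by (simp add: depth_def)
  then show "residue_count m p n j = residue_count m q n j" by (simp add: residue_count_def)
qed

lemma level_sum_cnj: "level_sum (cnj z) p n = cnj (level_sum z p n)"
  by (simp add: level_sum_def)

lemma unit_root_minus: "k \<le> m \<Longrightarrow> 0 < m \<Longrightarrow> unit_root m (m - k) = cnj (unit_root m k)"
proof -
  assume "k \<le> m" "0 < m"
  then have "2 * pi * real (m - k) / real m = 2 * pi * 1 - 2 * pi * real k / real m"
    by (simp add: of_nat_diff diff_divide_distrib right_diff_distrib)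
  then show ?thesis unfolding unit_root_def by (simp only: cis_divide[symmetric] cis_multiple_2pi Ints_1 cis_cnj cis_inverse[symmetric] inverse_eq_divide)
qed

text \<open>The frequencies 1 and \<open>m - 1\<close> are conjugate and together give twice a real
  part; they have the largest cosine and will dominate the others,
  \<open>2, ..., m - 2\<close>.\<close>

lemma level_count_split:
  assumes m: "m \<ge> 7" and j: "j < m"
  shows "level_count m p n j - real n / real m
    = (2 * Re (cnj (unit_root m 1) ^ j * level_sum (unit_root m 1) p n)
       + Re (\<Sum>k\<in>{2..<m - 1}. cnj (unit_root m k) ^ j * level_sum (unit_root m k) p n)) / real m"
proof -
  have S: "{1..<m} = insert 1 (insert (m - 1) {2..<m - 1})" using m by auto
  have u: "unit_root m (m - 1) = cnj (unit_root m 1)" using m by (intro unit_root_minus) auto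
  have "level_count m p n j - real n / real m = Re (complex_of_real (level_count m p n j - real n / real m))" by simp
  also have "\<dots> = Re (\<Sum>k\<in>{1..<m}. cnj (unit_root m k) ^ j * level_sum (unit_root m k) p n) / real m"
    using m j by (subst level_count_fourier) auto
  also have "(\<Sum>k\<in>{1..<m}. cnj (unit_root m k) ^ j * level_sum (unit_root m k) p n)
    = cnj (unit_root m 1) ^ j * level_sum (unit_root m 1) p n
      + (cnj (cnj (unit_root m 1) ^ j * level_sum (unit_root m 1) p n)
      + (\<Sum>k\<in>{2..<m - 1}. cnj (unit_root m k) ^ j * level_sum (unit_root m k) p n))"
    unfolding S using m by (subst sum.insert; simp)+ (simp add: u[simplified] level_sum_cnj)
  moreover have "Re (x + (cnj x + s)) = 2 * Re x + Re s" for x s by simp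
  ultimately show ?thesis by (simp only:)
qed

context random_recursive_tree
begin

lemma AE_level_count_large:
  fixes m :: nat
  assumes m: "m \<ge> 7"
  defines "\<alpha> \<equiv> cos (2 * pi / real m)" and "\<beta> \<equiv> sin (2 * pi / real m)"
  shows "\<alpha> > 1/2"
    and "\<exists>Z :: 'a \<Rightarrow> complex. Z \<in> borel_measurable M \<and>
      (AE \<omega> in M. \<forall>j<m. (\<lambda>n. real n powr (-\<alpha>) * (level_count m (\<lambda>k. parent k \<omega>) n j - real n / real m)
          - Re (cis (\<beta> * ln (real n)) * (Z \<omega> * cnj (unit_root m 1) ^ j))) \<longlonglongrightarrow> 0)"
proof -
  let ?P = "\<lambda>\<omega> k. parent k \<omega>"
  have m7: "real m \<ge> 7" using m by simp
  \<comment> \<open>\<open>2 * pi / m < pi / 3\<close> means \<open>m > 6\<close>, the origin of the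
    bound 7.\<close>
  have "cos (pi / 3) < cos (2 * pi / real m)"
    using m7 pi_gt_zero by (intro cos_monotone_0_pi) (auto simp: field_simps)
  then show \<alpha>: "\<alpha> > 1/2" by (simp add: cos_60 \<alpha>_def)
  have \<alpha>1: "\<alpha> \<le> 1" by (simp add: \<alpha>_def)
  define z where "z = unit_root m 1"
  have z: "cmod z = 1" "Re z = \<alpha>" "Im z = \<beta>" by (simp_all add: z_def unit_root_def \<alpha>_def \<beta>_def)
  have small: "Re (unit_root m k) < \<alpha>" if k: "k \<in> {2..<m - 1}" for k
  proof -
    have "root_cos m k \<le> root_cos m 2" using k m by (intro root_cos_le) auto
    also have "root_cos m 2 < \<alpha>"
      unfolding \<alpha>_def root_cos_def using m7 pi_gt_zero by (intro cos_monotone_0_pi) (auto simp: field_simps)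
    finally show ?thesis by (simp add: Re_unit_root)
  qed
  define A where "A n \<omega> = level_sum z (?P \<omega>) n / exp (z * of_real (ln (real n)))" for n \<omega>
  define L where "L \<omega> = lim (\<lambda>n. A n \<omega>)" for \<omega>
  \<comment> \<open>The factor 2 comes from the conjugate pair of frequencies, \<open>1 / m\<close>
    from Fourier inversion. Through \<open>lim\<close> the variable is defined and measurable also
    where there is no convergence.\<close>
  define Z where "Z \<omega> = of_real (2 / real m) * L \<omega>" for \<omega>
  have "A n \<in> borel_measurable M" for n
    unfolding A_def[abs_def]
    by (rule past_measurable[OF past_comp[where h = "\<lambda>x. x / exp (z * of_real (ln (real n)))", OF past_level_sum]])
  then have "L \<in> borel_measurable M" unfolding L_def[abs_def] by (rule borel_measurable_lim_metric)
  then have Zm: "Z \<in> borel_measurable M" unfolding Z_def[abs_def] by measurable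
  have "AE \<omega> in M. convergent (\<lambda>n. A n \<omega>)"
    unfolding A_def by (rule AE_level_sum_convergent[OF z(1,2) \<alpha>])
  moreover have "AE \<omega> in M. \<forall>k\<in>{2..<m - 1}. (\<lambda>n. of_real (real n powr (-\<alpha>)) * level_sum (unit_root m k) (?P \<omega>) n) \<longlonglongrightarrow> 0"
    by (subst AE_ball_countable) (use AE_level_sum_small[OF norm_unit_root small \<alpha> \<alpha>1] in auto)
  ultimately have "AE \<omega> in M. \<forall>j<m. (\<lambda>n. real n powr (-\<alpha>) * (level_count m (?P \<omega>) n j - real n / real m)
          - Re (cis (\<beta> * ln (real n)) * (Z \<omega> * cnj (unit_root m 1) ^ j))) \<longlonglongrightarrow> 0"
  proof eventually_elim
    case (elim \<omega>)
    have A: "(\<lambda>n. A n \<omega>) \<longlonglongrightarrow> L \<omega>" using elim(1) by (simp add: L_def convergent_LIMSEQ_iff)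
    show ?case
    proof (intro allI impI)
      fix j assume j: "j < m"
      define q where "q = cnj z ^ j"
      have q: "cmod q = 1" by (simp add: q_def z norm_power)
      define E where "E n = (\<Sum>k\<in>{2..<m - 1}. cnj (unit_root m k) ^ j * (of_real (real n powr (-\<alpha>)) * level_sum (unit_root m k) (?P \<omega>) n))" for n
      have "E \<longlonglongrightarrow> (\<Sum>k\<in>{2..<m - 1}. cnj (unit_root m k) ^ j * 0)"
        unfolding E_def using elim(2) by (intro tendsto_sum tendsto_mult tendsto_const) auto
      then have E0: "E \<longlonglongrightarrow> 0" by simp
      \<comment> \<open>\<open>exp (z * ln n)\<close> is \<open>n powr \<alpha>\<close> times a
        rotation, so scaling by \<open>n powr (-\<alpha>)\<close> keeps only the rotation. On the
        left remain the rotated error \<open>A n - L\<close> and the other frequencies.\<close>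
      have EV: "eventually (\<lambda>n. (2 * Re (q * (cis (\<beta> * ln (real n)) * (A n \<omega> - L \<omega>))) + Re (E n)) / real m
        = real n powr (-\<alpha>) * (level_count m (?P \<omega>) n j - real n / real m)
          - Re (cis (\<beta> * ln (real n)) * (Z \<omega> * cnj (unit_root m 1) ^ j))) sequentially"
        using eventually_ge_at_top[of 1]
      proof eventually_elim
        case (elim n)
        have "z * of_real (ln (real n)) = of_real (\<alpha> * ln (real n)) + \<i> * of_real (\<beta> * ln (real n))"
          by (simp add: complex_eq_iff z)
        then have "exp (z * of_real (ln (real n))) = of_real (real n powr \<alpha>) * cis (\<beta> * ln (real n))"
          using elim by (simp add: exp_add cis_conv_exp powr_def exp_of_real del: of_real_mult)
        then have "level_sum z (?P \<omega>) n = A n \<omega> * (of_real (real n powr \<alpha>) * cis (\<beta> * ln (real n)))"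
          using elim by (simp add: A_def)
        then have Z1: "of_real (real n powr (-\<alpha>)) * level_sum z (?P \<omega>) n = cis (\<beta> * ln (real n)) * A n \<omega>"
          using elim by (simp add: powr_minus field_simps)
        have "real n powr (-\<alpha>) * (level_count m (?P \<omega>) n j - real n / real m)
          = (2 * Re (q * (of_real (real n powr (-\<alpha>)) * level_sum z (?P \<omega>) n)) + Re (E n)) / real m"
        proof -
          have r: "r * ((2 * Re x + Re y) / M) = (2 * Re (of_real r * x) + Re (of_real r * y)) / M" for r M x y
            by (simp add: algebra_simps add_divide_distrib)
          have "E n = of_real (real n powr (-\<alpha>)) * (\<Sum>k\<in>{2..<m - 1}. cnj (unit_root m k) ^ j * level_sum (unit_root m k) (?P \<omega>) n)"
            by (simp add: E_def sum_distrib_left mult_ac)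
          then show ?thesis
            unfolding level_count_split[OF m j] r z_def[symmetric] q_def by (simp add: mult_ac)
        qed
        also have "\<dots> = (2 * Re (q * (cis (\<beta> * ln (real n)) * A n \<omega>)) + Re (E n)) / real m" unfolding Z1 ..
        finally have 1: "real n powr (-\<alpha>) * (level_count m (?P \<omega>) n j - real n / real m) = (2 * Re (q * (cis (\<beta> * ln (real n)) * A n \<omega>)) + Re (E n)) / real m" .
        have "cis (\<beta> * ln (real n)) * (Z \<omega> * cnj (unit_root m 1) ^ j) = of_real (2 / real m) * (q * (cis (\<beta> * ln (real n)) * L \<omega>))"
          unfolding Z_def q_def z_def by (simp only: mult_ac)
        then have "Re (cis (\<beta> * ln (real n)) * (Z \<omega> * cnj (unit_root m 1) ^ j)) = 2 / real m * Re (q * (cis (\<beta> * ln (real n)) * L \<omega>))"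
          by (metis Re_complex_of_real Im_complex_of_real diff_zero mult_zero_left times_complex.sel(1))
        then show ?case
          unfolding 1 by (simp only: right_diff_distrib minus_complex.sel) (simp add: diff_divide_distrib add_divide_distrib)
      qed
      have LM: "(\<lambda>n. (2 * Re (q * (cis (\<beta> * ln (real n)) * (A n \<omega> - L \<omega>))) + Re (E n)) / real m) \<longlonglongrightarrow> 0"
      proof -
        have "(\<lambda>n. q * (cis (\<beta> * ln (real n)) * (A n \<omega> - L \<omega>))) \<longlonglongrightarrow> 0"
        proof (rule Lim_null_comparison[where g = "\<lambda>n. cmod (A n \<omega> - L \<omega>)"])
          show "(\<lambda>n. cmod (A n \<omega> - L \<omega>)) \<longlonglongrightarrow> 0" using A by (simp add: LIM_zero tendsto_norm_zero)
        qed (simp add: norm_mult q)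
        then have "(\<lambda>n. (2 * Re (q * (cis (\<beta> * ln (real n)) * (A n \<omega> - L \<omega>))) + Re (E n)) / real m) \<longlonglongrightarrow> (2 * Re 0 + Re 0) / real m"
          using m E0 by (intro tendsto_intros) auto
        then show ?thesis by simp
      qed
      from LM EV show "(\<lambda>n. real n powr (-\<alpha>) * (level_count m (?P \<omega>) n j - real n / real m)
          - Re (cis (\<beta> * ln (real n)) * (Z \<omega> * cnj (unit_root m 1) ^ j))) \<longlonglongrightarrow> 0"
        by (rule Lim_transform_eventually)
    qed
  qed
  with Zm show "\<exists>Z :: 'a \<Rightarrow> complex. Z \<in> borel_measurable M \<and>
      (AE \<omega> in M. \<forall>j<m. (\<lambda>n. real n powr (-\<alpha>) * (level_count m (\<lambda>k. parent k \<omega>) n j - real n / real m)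
          - Re (cis (\<beta> * ln (real n)) * (Z \<omega> * cnj (unit_root m 1) ^ j))) \<longlonglongrightarrow> 0)" by blast
qed

end

text \<open>At \<open>x = 0\<close> both sides vanish by the conventions for \<open>powr\<close> and
  division, so \<open>n = 0\<close>, and \<open>n = 1\<close> in the critical case, are
  included.\<close>

lemma powr_minus_half: "x \<ge> 0 \<Longrightarrow> x powr (-1/2) * y = y / sqrt (x :: real)"
  using powr_minus_divide[of x "1/2"] by (simp add: powr_half_sqrt)

lemma root_cos_le_two_fifths:
  assumes m: "2 \<le> m" "m \<le> 5" and k: "k \<in> {1..<m}"
  shows "root_cos m k \<le> 2 / 5"
proof -
  have "root_cos m k \<le> root_cos m (Suc 0)" using m k by (intro root_cos_le) auto
  also have "root_cos m (Suc 0) \<le> 2 / 5"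
  proof -
    have "root_cos 5 (Suc 0) \<le> 2 / 5" by (rule root_cos_5) simp
    moreover have "m = 2 \<or> m = 3 \<or> m = 4 \<or> m = 5" using m by auto
    ultimately show ?thesis using root_cos_2 root_cos_3 root_cos_4 by auto
  qed
  finally show ?thesis .
qed

section \<open>Transfer to the residue counts and assembly\<close>

context random_recursive_tree
begin

lemma residue_count_measurable: "(\<lambda>\<omega>. real (residue_count m (\<lambda>k. parent k \<omega>) n j)) \<in> borel_measurable M"
  by (rule past_measurable[OF past_comp[where h = real, OF residue_count_past]])

lemma AE_residue_count:
  "AE \<omega> in M. \<forall>n j. real (residue_count m (\<lambda>k. parent k \<omega>) n j) = level_count m (\<lambda>k. parent k \<omega>) n j"
  using AE_parent_less by eventually_elim (intro allI residue_count_eq, auto)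

lemma vec_law_residue_count:
  fixes a b :: real
  shows "vec_law m M (\<lambda>\<omega> j. a * (real (residue_count m (\<lambda>k. parent k \<omega>) n j) - b))
    = vec_law m M (\<lambda>\<omega> j. a * (level_count m (\<lambda>k. parent k \<omega>) n j - b))"
proof (rule vec_law_cong_AE)
  fix j
  show "(\<lambda>\<omega>. a * (real (residue_count m (\<lambda>k. parent k \<omega>) n j) - b)) \<in> borel_measurable M"
    using residue_count_measurable by measurable
  have "(\<lambda>\<omega>. level_count m (\<lambda>k. parent k \<omega>) n j) \<in> borel_measurable M"
    by (rule past_measurable[OF past_level_count])
  then show "(\<lambda>\<omega>. a * (level_count m (\<lambda>k. parent k \<omega>) n j - b)) \<in> borel_measurable M" by measurable
  show "AE \<omega> in M. \<forall>j<m. a * (real (residue_count m (\<lambda>k. parent k \<omega>) n j) - b) = a * (level_count m (\<lambda>k. parent k \<omega>) n j - b)"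
    using AE_residue_count[of m] by eventually_elim simp
qed

end

theorem theorem2p1:
  fixes M :: "'a measure" and parent :: "nat \<Rightarrow> 'a \<Rightarrow> nat" and m :: nat
    and X :: "nat \<Rightarrow> 'a \<Rightarrow> nat \<Rightarrow> real" and \<alpha> \<beta> :: real
  assumes rrt: "random_recursive_tree M parent"
    and m: "m \<ge> 2"
    and X: "X = (\<lambda>n \<omega> j. real (residue_count m (\<lambda>k. parent k \<omega>) n j))"
    and \<alpha>: "\<alpha> = cos (2 * pi / real m)"
    and \<beta>: "\<beta> = sin (2 * pi / real m)"
  shows
    "(m \<le> 5 \<longrightarrow>
        weak_conv_normal m
          (\<lambda>n. vec_law m M (\<lambda>\<omega> j. real n powr (-1/2) * (X n \<omega> j - real n / real m)))
          (\<lambda>_. 0)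
          (if m = 2 then Sigma2 else if m = 3 then Sigma3 else if m = 4 then Sigma4 else Sigma5))
     \<and>
     (m = 6 \<longrightarrow>
        weak_conv_normal m
          (\<lambda>n. vec_law m M (\<lambda>\<omega> j. (real n * ln (real n)) powr (-1/2) * (X n \<omega> j - real n / 6)))
          (\<lambda>_. 0) Sigma6)
     \<and>
     (m \<ge> 7 \<longrightarrow>
        \<alpha> > 1/2 \<and>
        (\<exists>Z :: 'a \<Rightarrow> complex. Z \<in> borel_measurable M \<and>
           (\<exists>W :: 'a \<Rightarrow> nat \<Rightarrow> complex.
              (\<forall>\<omega>. \<forall>j<m. W \<omega> j = Z \<omega> * exp (- (2 * of_real pi * of_nat j * \<i> / of_nat m))) \<and>
              (AE \<omega> in M. \<forall>j<m.
                 (\<lambda>n. real n powr (-\<alpha>) * (X n \<omega> j - real n / real m)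
                        - Re (of_nat n powr (\<i> * of_real \<beta>) * W \<omega> j)) \<longlonglongrightarrow> 0)) \<and>
           (\<forall>s \<gamma>. strict_mono (s :: nat \<Rightarrow> nat) \<and> \<gamma> \<in> {0..2 * pi} \<and>
              (\<lambda>k. (\<beta> * ln (real (s k))) rmod (2 * pi)) \<longlonglongrightarrow> \<gamma> \<longrightarrow>
              weak_conv_vec m
                (\<lambda>k. vec_law m M
                   (\<lambda>\<omega> j. real (s k) powr (-\<alpha>) * (X (s k) \<omega> j - real (s k) / real m)))
                (vec_law m M
                   (\<lambda>\<omega> j. Re (exp (\<i> * of_real (\<gamma> - 2 * pi * real j / real m)) * Z \<omega>))))))"
proof (intro conjI impI)
  interpret random_recursive_tree M parent by fact
  let ?P = "\<lambda>\<omega> k. parent k \<omega>"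
  {
    assume m5: "m \<le> 5"
    have "weak_conv_normal m (\<lambda>n. vec_law m M (\<lambda>\<omega> j. (level_count m (?P \<omega>) n j - real n / real m) / sqrt (real n)))
        (\<lambda>_. 0) (circulant_cov m (\<lambda>k. 1 / (1 - 2 * root_cos m k)))"
      using m root_cos_le_two_fifths[OF m m5] by (intro weak_conv_normal_small) auto
    then have "weak_conv_normal m (\<lambda>n. vec_law m M (\<lambda>\<omega> j. (level_count m (?P \<omega>) n j - real n / real m) / sqrt (real n)))
        (\<lambda>_. 0) (if m = 2 then Sigma2 else if m = 3 then Sigma3 else if m = 4 then Sigma4 else Sigma5)"
    proof (rule weak_conv_normal_cong)
      fix i j assume ij: "i < m" "j < m"
      consider "m = 2" | "m = 3" | "m = 4" | "m = 5" using m m5 by linarith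
      then show "circulant_cov m (\<lambda>k. 1 / (1 - 2 * root_cos m k)) i j
          = (if m = 2 then Sigma2 else if m = 3 then Sigma3 else if m = 4 then Sigma4 else Sigma5) i j"
        using ij circulant_cov_Sigma2 circulant_cov_Sigma3 circulant_cov_Sigma4 circulant_cov_Sigma5 by cases auto
    qed
    then show "weak_conv_normal m
          (\<lambda>n. vec_law m M (\<lambda>\<omega> j. real n powr (-1/2) * (X n \<omega> j - real n / real m)))
          (\<lambda>_. 0)
          (if m = 2 then Sigma2 else if m = 3 then Sigma3 else if m = 4 then Sigma4 else Sigma5)"
      unfolding X vec_law_residue_count unfolding powr_minus_half[OF of_nat_0_le_iff] .
  }
  {
    assume m6: "m = 6"
    have "weak_conv_normal 6 (\<lambda>n. vec_law 6 M (\<lambda>\<omega> j. (level_count 6 (?P \<omega>) n j - real n / real 6) / sqrt (real n * ln (real n))))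
        (\<lambda>_. 0) Sigma6"
      by (rule weak_conv_normal_cong[OF weak_conv_normal_6 circulant_cov_Sigma6])
    moreover have "(real n * ln (real n)) powr (-1/2) * y = y / sqrt (real n * ln (real n))" for n y
      by (rule powr_minus_half) (cases "n = 0", auto)
    ultimately show "weak_conv_normal m
          (\<lambda>n. vec_law m M (\<lambda>\<omega> j. (real n * ln (real n)) powr (-1/2) * (X n \<omega> j - real n / 6)))
          (\<lambda>_. 0) Sigma6"
      unfolding X vec_law_residue_count unfolding m6 by simp
  }
  {
    assume m7: "m \<ge> 7"
    show "\<alpha> > 1/2" unfolding \<alpha> by (rule AE_level_count_large(1)[OF m7])
    obtain Z :: "'a \<Rightarrow> complex" where Z: "Z \<in> borel_measurable M"
      and lim: "AE \<omega> in M. \<forall>j<m. (\<lambda>n. real n powr (-\<alpha>) * (level_count m (?P \<omega>) n j - real n / real m)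
          - Re (cis (\<beta> * ln (real n)) * (Z \<omega> * cnj (unit_root m 1) ^ j))) \<longlonglongrightarrow> 0"
      using AE_level_count_large(2)[OF m7] unfolding \<alpha> \<beta> by blast
    have e: "exp (- (2 * of_real pi * of_nat j * \<i> / of_nat m)) = cnj (unit_root m 1) ^ j" for j
    proof -
      have "- (2 * of_real pi * of_nat j * \<i> / of_nat m) = \<i> * of_real (real j * (- (2 * pi / real m)))"
        by (simp add: mult_ac)
      then show ?thesis
        by (simp only: cis_conv_exp[symmetric] Complex.DeMoivre[symmetric]) (simp add: unit_root_def cis_cnj)
    qed
    have limX: "AE \<omega> in M. \<forall>j<m. (\<lambda>n. real n powr (-\<alpha>) * (X n \<omega> j - real n / real m)
          - Re (cis (\<beta> * ln (real n)) * (Z \<omega> * cnj (unit_root m 1) ^ j))) \<longlonglongrightarrow> 0"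
      using lim AE_residue_count[of m] by eventually_elim (simp add: X)
    \<comment> \<open>For \<open>n = 0\<close> the left side is 0 by convention and the right side
      is 1, so the identity can enter the limits only from \<open>n = 1\<close> on.\<close>
    have powr_cis: "of_nat n powr (\<i> * of_real \<beta>) = cis (\<beta> * ln (real n))" if "n \<ge> 1" for n
      using that by (simp add: powr_def cis_conv_exp Ln_of_nat mult_ac)
    show "\<exists>Z :: 'a \<Rightarrow> complex. Z \<in> borel_measurable M \<and>
           (\<exists>W :: 'a \<Rightarrow> nat \<Rightarrow> complex.
              (\<forall>\<omega>. \<forall>j<m. W \<omega> j = Z \<omega> * exp (- (2 * of_real pi * of_nat j * \<i> / of_nat m))) \<and>
              (AE \<omega> in M. \<forall>j<m.
                 (\<lambda>n. real n powr (-\<alpha>) * (X n \<omega> j - real n / real m)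
                        - Re (of_nat n powr (\<i> * of_real \<beta>) * W \<omega> j)) \<longlonglongrightarrow> 0)) \<and>
           (\<forall>s \<gamma>. strict_mono (s :: nat \<Rightarrow> nat) \<and> \<gamma> \<in> {0..2 * pi} \<and>
              (\<lambda>k. (\<beta> * ln (real (s k))) rmod (2 * pi)) \<longlonglongrightarrow> \<gamma> \<longrightarrow>
              weak_conv_vec m
                (\<lambda>k. vec_law m M
                   (\<lambda>\<omega> j. real (s k) powr (-\<alpha>) * (X (s k) \<omega> j - real (s k) / real m)))
                (vec_law m M
                   (\<lambda>\<omega> j. Re (exp (\<i> * of_real (\<gamma> - 2 * pi * real j / real m)) * Z \<omega>))))"
    proof (intro exI[of _ Z] conjI Z exI[of _ "\<lambda>\<omega> j. Z \<omega> * exp (- (2 * of_real pi * of_nat j * \<i> / of_nat m))"] allI impI refl)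
      show "AE \<omega> in M. \<forall>j<m. (\<lambda>n. real n powr (-\<alpha>) * (X n \<omega> j - real n / real m)
          - Re (of_nat n powr (\<i> * of_real \<beta>) * (Z \<omega> * exp (- (2 * of_real pi * of_nat j * \<i> / of_nat m))))) \<longlonglongrightarrow> 0"
        using limX
      proof eventually_elim
        case (elim \<omega>)
        show ?case
        proof (intro allI impI)
          fix j assume "j < m"
          then have "(\<lambda>n. real n powr (-\<alpha>) * (X n \<omega> j - real n / real m)
            - Re (cis (\<beta> * ln (real n)) * (Z \<omega> * cnj (unit_root m 1) ^ j))) \<longlonglongrightarrow> 0"
            using elim by blast
          then show "(\<lambda>n. real n powr (-\<alpha>) * (X n \<omega> j - real n / real m)
            - Re (of_nat n powr (\<i> * of_real \<beta>) * (Z \<omega> * exp (- (2 * of_real pi * of_nat j * \<i> / of_nat m))))) \<longlonglongrightarrow> 0"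
            by (rule Lim_transform_eventually)
              (use eventually_ge_at_top[of 1] in eventually_elim, simp only: powr_cis e)
        qed
      qed
    next
      fix s :: "nat \<Rightarrow> nat" and \<gamma>
      assume s: "strict_mono s \<and> \<gamma> \<in> {0..2 * pi} \<and> (\<lambda>k. (\<beta> * ln (real (s k))) rmod (2 * pi)) \<longlonglongrightarrow> \<gamma>"
      \<comment> \<open>\<open>cis\<close> forgets multiples of \<open>2 * pi\<close>, so
        convergence of the reduced angles gives convergence of the rotations, also at the ends of
        \<open>{0..2 * pi}\<close>.\<close>
      have cis_lim: "(\<lambda>k. cis (\<beta> * ln (real (s k)))) \<longlonglongrightarrow> cis \<gamma>"
      proof -
        have "(\<lambda>k. cis ((\<beta> * ln (real (s k))) rmod (2 * pi))) \<longlonglongrightarrow> cis \<gamma>"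
          using s unfolding cis_conv_exp by (intro tendsto_intros) auto
        then show ?thesis by (simp only: cis_rmod)
      qed
      have rot: "exp (\<i> * of_real (\<gamma> - 2 * pi * real j / real m)) = cis \<gamma> * cnj (unit_root m 1) ^ j" for j
        unfolding cis_conv_exp[symmetric] by (simp add: unit_root_def cis_cnj Complex.DeMoivre cis_mult mult_ac)
      show "weak_conv_vec m
                (\<lambda>k. vec_law m M
                   (\<lambda>\<omega> j. real (s k) powr (-\<alpha>) * (X (s k) \<omega> j - real (s k) / real m)))
                (vec_law m M
                   (\<lambda>\<omega> j. Re (exp (\<i> * of_real (\<gamma> - 2 * pi * real j / real m)) * Z \<omega>)))"
      \<comment> \<open>Along the subsequence the rotation converges, so the scaled counts even
        converge almost surely.\<close>
      proof (rule weak_conv_vec_AE)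
        show "prob_space M" by unfold_locales
        show "(\<lambda>\<omega>. real (s k) powr (-\<alpha>) * (X (s k) \<omega> j - real (s k) / real m)) \<in> borel_measurable M" for k j
          unfolding X using residue_count_measurable by measurable
        show "(\<lambda>\<omega>. Re (exp (\<i> * of_real (\<gamma> - 2 * pi * real j / real m)) * Z \<omega>)) \<in> borel_measurable M" for j
          using Z by measurable
        show "AE \<omega> in M. \<forall>j<m. (\<lambda>k. real (s k) powr (-\<alpha>) * (X (s k) \<omega> j - real (s k) / real m))
            \<longlonglongrightarrow> Re (exp (\<i> * of_real (\<gamma> - 2 * pi * real j / real m)) * Z \<omega>)"
          using limX
        proof eventually_elim
          case (elim \<omega>)
          show ?case
          proof (intro allI impI)
            fix j assume "j < m"
            then have "(\<lambda>n. real n powr (-\<alpha>) * (X n \<omega> j - real n / real m)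
              - Re (cis (\<beta> * ln (real n)) * (Z \<omega> * cnj (unit_root m 1) ^ j))) \<longlonglongrightarrow> 0"
              using elim by blast
            from LIMSEQ_subseq_LIMSEQ[OF this conjunct1[OF s]]
            have 1: "(\<lambda>k. real (s k) powr (-\<alpha>) * (X (s k) \<omega> j - real (s k) / real m)
              - Re (cis (\<beta> * ln (real (s k))) * (Z \<omega> * cnj (unit_root m 1) ^ j))) \<longlonglongrightarrow> 0"
              by (simp only: comp_def)
            have 2: "(\<lambda>k. Re (cis (\<beta> * ln (real (s k))) * (Z \<omega> * cnj (unit_root m 1) ^ j))) \<longlonglongrightarrow> Re (cis \<gamma> * (Z \<omega> * cnj (unit_root m 1) ^ j))"
              by (intro tendsto_Re tendsto_mult tendsto_const cis_lim)
            have "(\<lambda>k. real (s k) powr (-\<alpha>) * (X (s k) \<omega> j - real (s k) / real m)) \<longlonglongrightarrow> Re (cis \<gamma> * (Z \<omega> * cnj (unit_root m 1) ^ j))"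
              using tendsto_add[OF 1 2] by (simp only: diff_add_cancel add_0_left)
            then show "(\<lambda>k. real (s k) powr (-\<alpha>) * (X (s k) \<omega> j - real (s k) / real m))
            \<longlonglongrightarrow> Re (exp (\<i> * of_real (\<gamma> - 2 * pi * real j / real m)) * Z \<omega>)"
              unfolding rot by (simp only: mult_ac)
          qed
        qed
      qed
    qed
  }
qed

end
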